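(* Let $(D,\phi)$ and $(D',\phi')$ be basic pairs for $U$. Then $$\xi_{D,\phi}(z_{D',\phi'})=\begin{cases} q^{-t(D,D')}\,\xi_{D,\phi}(1)\,c_{D,\phi}^{D',\phi'}\displaystyle\prod_{\alpha\in D\cap D'}\vartheta(\phi(\alpha)\phi'(\alpha)), & \text{if } D\subseteq R(D'),\\ 0, & \text{otherwise,}\end{cases}$$ where $t(D,D')=\sum_{\alpha\in D}|D'(\alpha)|$, and $$c_{D,\phi}^{D',\phi'}=q^{\frac12\left(t(D_0,D')-t_0(D,D')\right)}\,G(\eta,\vartheta)^{t_0(D,D')}\prod_{\alpha\in D_0}\ \prod_{\beta\in D'_0(\alpha)}\eta(\phi(\alpha)^{-1}\phi'(\beta))$$ for $t(D_0,D')=\sum_{\alpha\in D_0}|D'(\alpha)|$ and $t_0(D,D')=\sum_{\alpha\in D_0}|D'_0(\alpha)|$.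
   Context: Let $p$ be an odd prime, $q=p^{e}$ ($e\ge 1$), $\mathbb{F}_q$ the field with $q$ elements, $\mathbb{F}_q^{\times}=\mathbb{F}_q\setminus\{0\}$, and $n\ge 1$. Let $G$ be one of $Sp_{2n}(q)$, $O_{2n}(q)$, $O_{2n+1}(q)$; put $m=2n$ in the first two cases and $m=2n+1$ in the third. $U_m(q)$ is the group of unipotent upper-triangular $m\times m$ matrices over $\mathbb{F}_q$, and $U=G\cap U_m(q)$. Explicitly, with $J$ the $n\times n$ matrix with $1$'s on the anti-diagonal and $0$'s elsewhere, $U$ consists of all block matrices $\begin{pmatrix} x & xv & xw\\ 0 & I_r & -v^{T}J\\ 0&0&Jx^{-T}J\end{pmatrix}$ with $x\in U_n(q)$, $v$ an $n\times r$ matrix, $w$ an $n\times n$ matrix over $\mathbb{F}_q$, where: $r=0$ and $Jw^T-wJ=0$ if $G=Sp_{2n}(q)$; $r=0$ and $Jw^T+wJ=0$ if $G=O_{2n}(q)$; $r=1$ and $Jw^T+wJ=-vv^T$ if $G=O_{2n+1}(q)$. Indexing. Rows and columns of $m\times m$ matrices are indexed by $1\prec 2\prec\cdots\prec n\prec 0\prec -n\prec\cdots\prec -2\prec -1$ (index $0$ present only if $G=O_{2n+1}(q)$); $e_{i,j}$ denotes a matrix unit. Roots. $\varepsilon_1,\dots,\varepsilon_n$ are formal independent symbols; $\Phi=\{\varepsilon_i\pm\varepsilon_j:1\le i<j\le n\}\cup\Phi'$ with $\Phi'=\{2\varepsilon_i:1\le i\le n\}$ if $G=Sp_{2n}(q)$,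 $\Phi'=\emptyset$ if $G=O_{2n}(q)$, $\Phi'=\{\varepsilon_i:1\le i\le n\}$ if $G=O_{2n+1}(q)$. For $\alpha\in\Phi$ let $\mathcal{E}(\alpha)$ be: $\{(i,j),(-j,-i)\}$ if $\alpha=\varepsilon_i-\varepsilon_j$; $\{(i,-j),(j,-i)\}$ if $\alpha=\varepsilon_i+\varepsilon_j$ ($i<j$); $\{(i,-i)\}$ if $\alpha=2\varepsilon_i$; $\{(i,0),(0,-i)\}$ if $\alpha=\varepsilon_i$. For $\Psi\subseteq\Phi$, $\mathcal{E}(\Psi)=\bigcup_{\alpha\in\Psi}\mathcal{E}(\alpha)$; $\mathcal{E}=\mathcal{E}(\Phi)$. Each $\mathcal{E}(\alpha)$ contains exactly one entry $(i,j)$ with $1\le i\le n$ and $i\prec j\preceq -i$; it is called the positive entry of $\alpha$. Basic pairs. $D\subseteq\Phi$ is basic if $\mathcal{E}(D)$ contains at most one entry from each row and at most one from each column. A basic pair for $U$ is $(D,\phi)$ with $D\subseteq\Phi$ basic (possibly empty) and $\phi:D\to\mathbb{F}_q^\times$ a map. Representatives $z_{D,\phi}$. Let $e_\alpha$ be: $e_{i,j}-e_{-j,-i}$ if $\alpha=\varepsilon_i-\varepsilon_j$; $e_{i,-j}+e_{j,-i}$ if $\alpha=\varepsilon_i+\varepsilon_j$ and $G=Sp_{2n}(q)$; $e_{i,-j}-e_{j,-i}$ if $\alpha=\varepsilon_i+\varepsilon_j$ and $G$ is orthogonal; $e_{i,-i}$ if $\alpha=2\varepsilon_i$; $e_{i,0}-e_{0,-i}$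 if $\alpha=\varepsilon_i$. Put $e_{D,\phi}=\sum_{\alpha\in D}\phi(\alpha)e_\alpha$. For $z=\begin{pmatrix} x & xv & xw\\ 0 & I_r & -v^{T}J\\ 0&0&Jx^{-T}J\end{pmatrix}\in U$, with $x\in U_n(q)$, $v$ an $n\times r$ matrix and $w$ an $n\times n$ matrix over $\mathbb{F}_q$, let $a_z=\begin{pmatrix} x-1 & v & w'\\ 0&0_r&-v^TJ\\ 0&0&-J(x-1)^TJ\end{pmatrix}$ with $w'=w$ if $r=0$ and $w'=w+\frac12 vv^TJ$ if $r=1$; $z\mapsto a_z$ is a bijection from $U$ onto the $\mathbb{F}_q$-span of $\{e_\alpha:\alpha\in\Phi\}$. $z_{D,\phi}$ is the unique $z\in U$ with $a_z=e_{D,\phi}$; it lies in the superclass $K_{D,\phi}=\{x\in U:x-1\in U_m(q)e_{D,\phi}U_m(q)\}$. Supercharacters. Fix a nontrivial linear character $\vartheta:\mathbb{F}_q\to\mathbb{C}^\times$ of the additive group of $\mathbb{F}_q$. Define subgroups $U_\alpha\le U$: if $\alpha=\varepsilon_i-\varepsilon_j$, $U_\alpha=\{x\in U:x_{i,k}=0,\ i<k<j\}$; if $\alpha=\varepsilon_i+\varepsilon_j$ ($i<j$), $U_\alpha=\{x\in U:x_{i,k}=x_{j,l}=0,\ i<k\le n,\ j\prec l\preceq 0\}$ (when the index $0$ is absent, $l$ runs over $j<l\le n$); if $\alpha=2\varepsilon_i$ or $\alpha=\varepsilon_i$, $U_\alpha=\{x\in U:x_{i,k}=0,\ i<k\le n\}$.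 For $r\in\mathbb{F}_q^\times$, $\lambda_{\alpha,r}(x)=\vartheta(r x_{i,j})$, with $(i,j)$ the positive entry of $\alpha$, is a linear character of $U_\alpha$; the elementary character is the induced character $\xi_{\alpha,r}=(\lambda_{\alpha,r})^U$. The supercharacter of a basic pair is $\xi_{D,\phi}=\prod_{\alpha\in D}\xi_{\alpha,\phi(\alpha)}$ (the trivial character $1_U$ if $D=\emptyset$). Further notation for a basic subset $D\subseteq\Phi$. $S(\mathcal{E}(D))=\bigcup_{(i,j)\in\mathcal{E}(D)}\left(\{(i,s):j\prec s\preceq -1\}\cup\{(r,j):1\preceq r\prec i\}\right)$, $R(\mathcal{E}(D))=\mathcal{E}\setminus S(\mathcal{E}(D))$, and $R(D)=\{\beta\in\Phi:\mathcal{E}(\beta)\subseteq R(\mathcal{E}(D))\}$. For $\alpha\in\Phi$ with positive entry $(i,j)$, $D(\alpha)=\{(k,l)\in\mathcal{E}(D):i\prec k\prec l\prec j\}$. $D_0=D\cap\{2\varepsilon_i:1\le i\le n\}$ (empty when $G$ is orthogonal) and, for $\alpha=2\varepsilon_i$, $D_0(\alpha)=D\cap\{2\varepsilon_k:i<k\le n\}$. $\eta$ is the quadratic character of $\mathbb{F}_q^\times$ ($\eta(c)=1$ if $c$ is a nonzero square, $-1$ otherwise), and $G(\eta,\vartheta)=\sum_{c\in\mathbb{F}_q^\times}\eta(c)\vartheta(c)$ is the Gauss sum. The notations $D'(\alpha)$, $D'_0(\alpha)$, $R(D')$ mean the same with $D'$ in place of $D$. *)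

theory Defs
  imports
    Complex_Main
    "HOL-Library.Cardinality"
    "HOL-Computational_Algebra.Primes"
    "HOL-Algebra.Group"
    "Jordan_Normal_Form.Matrix"
begin

section \<open>Groups, matrix indices and roots\<close>

text \<open>The three families \<open>Sp\<^sub>2\<^sub>n(q)\<close>, \<open>O\<^sub>2\<^sub>n(q)\<close> and \<open>O\<^sub>2\<^sub>n\<^sub>+\<^sub>1(q)\<close>; the field
  \<open>F\<^sub>q\<close> is a finite field type \<open>'a\<close> throughout.\<close>

datatype family = Sp_even | O_even | O_odd

definition middle :: "family \<Rightarrow> nat" where
  "middle G = (case G of Sp_even \<Rightarrow> 0 | O_even \<Rightarrow> 0 | O_odd \<Rightarrow> 1)"

definition msize :: "family \<Rightarrow> nat \<Rightarrow> nat" where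
  "msize G n = 2 * n + middle G"

text \<open>Rows and columns are labelled by integers, listed in the order
  \<open>1, 2, \<dots>, n, 0, -n, \<dots>, -2, -1\<close>, where the label 0 only exists for \<open>O_odd\<close>.\<close>

definition Idx :: "family \<Rightarrow> nat \<Rightarrow> int set" where
  "Idx G n = {1..int n} \<union> (if G = O_odd then {0} else {}) \<union> {- int n..-1}"

definition prec :: "int \<Rightarrow> int \<Rightarrow> bool"  (infix \<open>\<prec>\<close> 50) where
  "i \<prec> j \<longleftrightarrow>
     (if 0 < i then j \<le> 0 \<or> i < j
      else if i = 0 then j < 0
      else j < 0 \<and> i < j)"

definition preceq :: "int \<Rightarrow> int \<Rightarrow> bool"  (infix \<open>\<preceq>\<close> 50) where
  "i \<preceq> j \<longleftrightarrow> i \<prec> j \<or> i = j"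

text \<open>Matrices of the library are indexed by \<open>0, \<dots>, m - 1\<close>; \<open>place G n i\<close> is the place of
  the label \<open>i\<close> in the above list, and \<open>entry G n x i j\<close> is the entry \<open>x\<^sub>i\<^sub>,\<^sub>j\<close> for labels
  \<open>i, j\<close>.\<close>

definition place :: "family \<Rightarrow> nat \<Rightarrow> int \<Rightarrow> nat" where
  "place G n i =
     nat (if 0 < i then i - 1 else if i = 0 then int n else int (msize G n) + i)"

definition entry :: "family \<Rightarrow> nat \<Rightarrow> 'a mat \<Rightarrow> int \<Rightarrow> int \<Rightarrow> 'a" where
  "entry G n x i j = x $$ (place G n i, place G n j)"

text \<open>\<open>Minus i j\<close>, \<open>Plus i j\<close>, \<open>Twice i\<close>, \<open>Single i\<close> are the formal expressions
  \<open>\<epsilon>\<^sub>i - \<epsilon>\<^sub>j\<close>, \<open>\<epsilon>\<^sub>i + \<epsilon>\<^sub>j\<close>, \<open>2\<epsilon>\<^sub>i\<close>, \<open>\<epsilon>\<^sub>i\<close>. In \<open>Roots\<close> the first two only occur with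
  \<open>i < j\<close>, so different terms are different roots.\<close>

datatype root = Minus int int | Plus int int | Twice int | Single int

definition Roots :: "family \<Rightarrow> nat \<Rightarrow> root set" where
  "Roots G n =
     {Minus i j | i j. 1 \<le> i \<and> i < j \<and> j \<le> int n} \<union>
     {Plus i j | i j. 1 \<le> i \<and> i < j \<and> j \<le> int n} \<union>
     (case G of
        Sp_even \<Rightarrow> {Twice i | i. 1 \<le> i \<and> i \<le> int n}
      | O_even \<Rightarrow> {}
      | O_odd \<Rightarrow> {Single i | i. 1 \<le> i \<and> i \<le> int n})"

fun entries :: "root \<Rightarrow> (int \<times> int) set" where
  "entries (Minus i j) = {(i, j), (- j, - i)}"
| "entries (Plus i j) = {(i, - j), (j, - i)}"
| "entries (Twice i) = {(i, - i)}"
| "entries (Single i) = {(i, 0), (0, - i)}"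

definition Entries :: "root set \<Rightarrow> (int \<times> int) set" where
  "Entries \<Psi> = (\<Union>\<alpha>\<in>\<Psi>. entries \<alpha>)"

definition pos_entry :: "nat \<Rightarrow> root \<Rightarrow> int \<times> int" where
  "pos_entry n \<alpha> =
     (THE (i, j). (i, j) \<in> entries \<alpha> \<and> 1 \<le> i \<and> i \<le> int n \<and> i \<prec> j \<and> j \<preceq> - i)"

section \<open>The unipotent group\<close>

definition UT :: "nat \<Rightarrow> 'a::field mat monoid" where
  "UT k =
     \<lparr>carrier = {x \<in> carrier_mat k k. upper_triangular x \<and> (\<forall>i<k. x $$ (i, i) = 1)},
      mult = (*), one = 1\<^sub>m k\<rparr>"

definition antidiag :: "nat \<Rightarrow> 'a::field mat" where
  "antidiag n = mat n n (\<lambda>(i, j). if i + j + 1 = n then 1 else 0)"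

text \<open>Block upper triangular matrix with rows \<open>(A B C)\<close>, \<open>(0 D E)\<close>, \<open>(0 0 F)\<close> of blocks,
  with block sizes \<open>n, r, n\<close>.\<close>

definition block3 ::
  "nat \<Rightarrow> nat \<Rightarrow> 'a::field mat \<Rightarrow> 'a mat \<Rightarrow> 'a mat \<Rightarrow> 'a mat \<Rightarrow> 'a mat \<Rightarrow> 'a mat \<Rightarrow> 'a mat"
  where
  "block3 n r A B C D E F =
     four_block_mat
       (four_block_mat A B (0\<^sub>m r n) D) (C @\<^sub>r E)
       (0\<^sub>m n (n + r)) F"

text \<open>The triples \<open>(x, v, w)\<close> parametrising \<open>U\<close>, and the matrix given by such a triple.\<close>

definition params :: "family \<Rightarrow> nat \<Rightarrow> ('a::field mat \<times> 'a mat \<times> 'a mat) set" where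
  "params G n =
     {(x, v, w). x \<in> carrier (UT n) \<and> v \<in> carrier_mat n (middle G) \<and> w \<in> carrier_mat n n \<and>
        (let J = antidiag n in
         case G of
           Sp_even \<Rightarrow> J * transpose_mat w - w * J = 0\<^sub>m n n
         | O_even \<Rightarrow> J * transpose_mat w + w * J = 0\<^sub>m n n
         | O_odd \<Rightarrow> J * transpose_mat w + w * J = - (v * transpose_mat v))}"

definition umat :: "family \<Rightarrow> nat \<Rightarrow> 'a::field mat \<times> 'a mat \<times> 'a mat \<Rightarrow> 'a mat" where
  "umat G n = (\<lambda>(x, v, w).
     let J = antidiag n in
     block3 n (middle G)
       x (x * v) (x * w)
       (1\<^sub>m (middle G)) (- (transpose_mat v * J))
       (J * transpose_mat (inv\<^bsub>UT n\<^esub> x) * J))"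

definition Ugrp :: "family \<Rightarrow> nat \<Rightarrow> 'a::field mat monoid" where
  "Ugrp G n = (UT (msize G n))\<lparr>carrier := umat G n ` params G n\<rparr>"

section \<open>Basic pairs and the representatives of the superclasses\<close>

definition basic :: "family \<Rightarrow> nat \<Rightarrow> root set \<Rightarrow> bool" where
  "basic G n D \<longleftrightarrow> D \<subseteq> Roots G n \<and>
     (\<forall>a\<in>Entries D. \<forall>b\<in>Entries D. fst a = fst b \<or> snd a = snd b \<longrightarrow> a = b)"

text \<open>A map \<open>D \<rightarrow> F\<^sub>q\<^sup>\<times>\<close> is given by a total function, of which only the values on \<open>D\<close>
  matter.\<close>

definition basic_pair :: "family \<Rightarrow> nat \<Rightarrow> root set \<Rightarrow> (root \<Rightarrow> 'a::field) \<Rightarrow> bool" where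
  "basic_pair G n D \<phi> \<longleftrightarrow> basic G n D \<and> (\<forall>\<alpha>\<in>D. \<phi> \<alpha> \<noteq> 0)"

definition unit_mat :: "family \<Rightarrow> nat \<Rightarrow> int \<Rightarrow> int \<Rightarrow> 'a::field mat" where
  "unit_mat G n i j =
     mat (msize G n) (msize G n) (\<lambda>(k, l). if k = place G n i \<and> l = place G n j then 1 else 0)"

fun root_mat :: "family \<Rightarrow> nat \<Rightarrow> root \<Rightarrow> 'a::field mat" where
  "root_mat G n (Minus i j) = unit_mat G n i j - unit_mat G n (- j) (- i)"
| "root_mat G n (Plus i j) =
     (if G = Sp_even then unit_mat G n i (- j) + unit_mat G n j (- i)
      else unit_mat G n i (- j) - unit_mat G n j (- i))"
| "root_mat G n (Twice i) = unit_mat G n i (- i)"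
| "root_mat G n (Single i) = unit_mat G n i 0 - unit_mat G n 0 (- i)"

text \<open>The sum \<open>\<Sum>\<^bsub>\<alpha>\<in>D\<^esub> \<phi>(\<alpha>)e\<^sub>\<alpha>\<close>, written entrywise since matrices of arbitrary size do not
  form an instance of the class of additive monoids.\<close>

definition e_pair :: "family \<Rightarrow> nat \<Rightarrow> root set \<Rightarrow> (root \<Rightarrow> 'a::field) \<Rightarrow> 'a mat" where
  "e_pair G n D \<phi> =
     mat (msize G n) (msize G n) (\<lambda>(k, l). \<Sum>\<alpha>\<in>D. \<phi> \<alpha> * root_mat G n \<alpha> $$ (k, l))"

definition amat :: "family \<Rightarrow> nat \<Rightarrow> 'a::field mat \<times> 'a mat \<times> 'a mat \<Rightarrow> 'a mat" where
  "amat G n = (\<lambda>(x, v, w).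
     let J = antidiag n;
         w' = (if G = O_odd then w + (1 / 2) \<cdot>\<^sub>m (v * transpose_mat v * J) else w)
     in block3 n (middle G)
          (x - 1\<^sub>m n) v w'
          (0\<^sub>m (middle G) (middle G)) (- (transpose_mat v * J))
          (- (J * transpose_mat (x - 1\<^sub>m n) * J)))"

text \<open>The matrix \<open>a\<^sub>z\<close>; the triple with \<open>umat G n (x, v, w) = z\<close> is determined by \<open>z\<close>.\<close>

definition a_of :: "family \<Rightarrow> nat \<Rightarrow> 'a::field mat \<Rightarrow> 'a mat" where
  "a_of G n z = (THE a. \<exists>t\<in>params G n. z = umat G n t \<and> a = amat G n t)"

definition z_rep :: "family \<Rightarrow> nat \<Rightarrow> root set \<Rightarrow> (root \<Rightarrow> 'a::field) \<Rightarrow> 'a mat" where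
  "z_rep G n D \<phi> = (THE z. z \<in> carrier (Ugrp G n) \<and> a_of G n z = e_pair G n D \<phi>)"

section \<open>Supercharacters\<close>

definition nontrivial_linear_char :: "('a::field \<Rightarrow> complex) \<Rightarrow> bool" where
  "nontrivial_linear_char \<theta> \<longleftrightarrow>
     (\<forall>a. \<theta> a \<noteq> 0) \<and> (\<forall>a b. \<theta> (a + b) = \<theta> a * \<theta> b) \<and> (\<exists>a. \<theta> a \<noteq> 1)"

definition induced_char ::
  "('g, 'b) monoid_scheme \<Rightarrow> 'g set \<Rightarrow> ('g \<Rightarrow> complex) \<Rightarrow> 'g \<Rightarrow> complex" where
  "induced_char K H \<chi> g =
     (\<Sum>x\<in>carrier K.
        if x \<otimes>\<^bsub>K\<^esub> g \<otimes>\<^bsub>K\<^esub> inv\<^bsub>K\<^esub> x \<in> H then \<chi> (x \<otimes>\<^bsub>K\<^esub> g \<otimes>\<^bsub>K\<^esub> inv\<^bsub>K\<^esub> x) else 0)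
     / of_nat (card H)"

fun root_subgroup :: "family \<Rightarrow> nat \<Rightarrow> root \<Rightarrow> 'a::field mat set" where
  "root_subgroup G n (Minus i j) =
     {x \<in> carrier (Ugrp G n). \<forall>k. i < k \<and> k < j \<longrightarrow> entry G n x i k = 0}"
| "root_subgroup G n (Plus i j) =
     {x \<in> carrier (Ugrp G n).
        (\<forall>k. i < k \<and> k \<le> int n \<longrightarrow> entry G n x i k = 0) \<and>
        (\<forall>l\<in>Idx G n. j \<prec> l \<and> l \<preceq> 0 \<longrightarrow> entry G n x j l = 0)}"
| "root_subgroup G n (Twice i) =
     {x \<in> carrier (Ugrp G n). \<forall>k. i < k \<and> k \<le> int n \<longrightarrow> entry G n x i k = 0}"
| "root_subgroup G n (Single i) =
     {x \<in> carrier (Ugrp G n). \<forall>k. i < k \<and> k \<le> int n \<longrightarrow> entry G n x i k = 0}"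

definition root_char ::
  "('a::field \<Rightarrow> complex) \<Rightarrow> family \<Rightarrow> nat \<Rightarrow> root \<Rightarrow> 'a \<Rightarrow> 'a mat \<Rightarrow> complex" where
  "root_char \<theta> G n \<alpha> r x = (case pos_entry n \<alpha> of (i, j) \<Rightarrow> \<theta> (r * entry G n x i j))"

definition elem_char ::
  "('a::field \<Rightarrow> complex) \<Rightarrow> family \<Rightarrow> nat \<Rightarrow> root \<Rightarrow> 'a \<Rightarrow> 'a mat \<Rightarrow> complex" where
  "elem_char \<theta> G n \<alpha> r =
     induced_char (Ugrp G n) (root_subgroup G n \<alpha>) (root_char \<theta> G n \<alpha> r)"

definition superchar ::
  "('a::field \<Rightarrow> complex) \<Rightarrow> family \<Rightarrow> nat \<Rightarrow> root set \<Rightarrow> (root \<Rightarrow> 'a) \<Rightarrow> 'a mat \<Rightarrow> complex"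
  where
  "superchar \<theta> G n D \<phi> x = (\<Prod>\<alpha>\<in>D. elem_char \<theta> G n \<alpha> (\<phi> \<alpha>) x)"

section \<open>Combinatorial data of basic subsets\<close>

definition sing :: "family \<Rightarrow> nat \<Rightarrow> root set \<Rightarrow> (int \<times> int) set" where
  "sing G n D =
     (\<Union>(i, j)\<in>Entries D.
        {(i, s) | s. s \<in> Idx G n \<and> j \<prec> s \<and> s \<preceq> -1} \<union>
        {(r, j) | r. r \<in> Idx G n \<and> 1 \<preceq> r \<and> r \<prec> i})"

definition reg_roots :: "family \<Rightarrow> nat \<Rightarrow> root set \<Rightarrow> root set" where
  "reg_roots G n D =
     {\<beta> \<in> Roots G n. entries \<beta> \<subseteq> Entries (Roots G n) - sing G n D}"

definition inner :: "nat \<Rightarrow> root set \<Rightarrow> root \<Rightarrow> (int \<times> int) set" where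
  "inner n D \<alpha> =
     (case pos_entry n \<alpha> of (i, j) \<Rightarrow> {(k, l) \<in> Entries D. i \<prec> k \<and> k \<prec> l \<and> l \<prec> j})"

definition twices :: "nat \<Rightarrow> root set \<Rightarrow> root set" where
  "twices n D = D \<inter> {Twice i | i. 1 \<le> i \<and> i \<le> int n}"

text \<open>This is \<open>D\<^sub>0(\<alpha>)\<close>, only meant for \<open>\<alpha>\<close> of the form \<open>Twice i\<close>.\<close>

definition inner_twices :: "nat \<Rightarrow> root set \<Rightarrow> root \<Rightarrow> root set" where
  "inner_twices n D \<alpha> =
     (case \<alpha> of Twice i \<Rightarrow> D \<inter> {Twice k | k. i < k \<and> k \<le> int n} | _ \<Rightarrow> {})"

definition t_num :: "nat \<Rightarrow> root set \<Rightarrow> root set \<Rightarrow> nat" where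
  "t_num n D D' = (\<Sum>\<alpha>\<in>D. card (inner n D' \<alpha>))"

definition t0_num :: "nat \<Rightarrow> root set \<Rightarrow> root set \<Rightarrow> nat" where
  "t0_num n D D' = (\<Sum>\<alpha>\<in>twices n D. card (inner_twices n D' \<alpha>))"

text \<open>Only used for nonzero arguments.\<close>

definition quad_char :: "'a::field \<Rightarrow> complex" where
  "quad_char c = (if \<exists>b. c = b ^ 2 then 1 else -1)"

definition gauss_sum :: "('a::{field, finite} \<Rightarrow> complex) \<Rightarrow> complex" where
  "gauss_sum \<theta> = (\<Sum>c\<in>UNIV - {0}. quad_char c * \<theta> c)"

definition c_factor ::
  "('a::{field, finite} \<Rightarrow> complex) \<Rightarrow> nat \<Rightarrow> root set \<Rightarrow> (root \<Rightarrow> 'a) \<Rightarrow>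
     root set \<Rightarrow> (root \<Rightarrow> 'a) \<Rightarrow> complex" where
  "c_factor \<theta> n D \<phi> D' \<phi>' =
     complex_of_real
       (real CARD('a) powr (1 / 2 * (real (t_num n (twices n D) D') - real (t0_num n D D')))) *
     gauss_sum \<theta> ^ t0_num n D D' *
     (\<Prod>\<alpha>\<in>twices n D. \<Prod>\<beta>\<in>inner_twices n D' \<alpha>. quad_char (inverse (\<phi> \<alpha>) * \<phi>' \<beta>))"

end

theory Submission
  imports Defs "Jordan_Normal_Form.Determinant" "HOL-Number_Theory.Residues"
begin

text \<open>
  The formula is a product over \<open>\<alpha> \<in> D\<close>, so it suffices to evaluate one elementary character at
  \<open>z = z\<^bsub>D',\<phi>'\<^esub>\<close>. Up to the factor \<open>\<xi>(1)\<close> it is the average over \<open>x \<in> U\<close> of \<open>\<lambda>(x z x\<inverse>)\<close>, extended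
  by 0 outside \<open>U\<^sub>\<alpha>\<close>. As \<open>x\<close> is unitriangular and preserves the form, both the condition
  \<open>x z x\<inverse> \<in> U\<^sub>\<alpha>\<close> and the value depend only on one or two of the first \<open>n\<close> rows of \<open>x\<close>, cut off after the
  column 0; the free entries of these rows are independent and uniformly distributed.

  Writing condition and value through \<open>a\<^sub>z = e\<^bsub>D',\<phi>'\<^esub>\<close>, the integrand becomes a product of factors, one
  for each \<open>\<beta> \<in> D'\<close>; since \<open>D'\<close> is basic these factors involve disjoint sets of entries, so the
  average factorises. What remains is an average for a pair \<open>(\<alpha>, \<beta>)\<close>: it is 0 if \<open>\<beta>\<close> forces
  \<open>\<alpha> \<notin> R(D')\<close>, and otherwise a power of \<open>1/q\<close>, a value of \<open>\<theta>\<close> if \<open>\<alpha> = \<beta>\<close>, or a quadratic Gauss sum if both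
  roots have the form \<open>2\<epsilon>\<^sub>i\<close>.
\<close>

section \<open>Averages over finite products\<close>

text \<open>The obstacle is the entry of \<open>x * z * inv x\<close> in a column -j: it involves
  the inverse of x and the upper right block of x, which cannot be prescribed freely. Up to the
  column 0 the inverse is harmless, because multiplying by a unitriangular matrix on the right keeps
  the first nonzero entry of each row, so x (z - 1) can be inspected instead. Beyond that column one
  uses the Gram matrix M of the form: the conjugate times M equals
  \<open>x * z * M * x\<^sup>T\<close>, and the relation \<open>x * M * x\<^sup>T = M\<close>
  cancels every term containing the block that is not free. What survives is bilinear in the rows i
  and j of x for \<alpha> = \<epsilon>_i + \<epsilon>_j. For \<alpha> = 2\<epsilon>_i both rows
  coincide and the value is quadratic; this is the origin of the Gauss sums and of the half exponent
  in the constant c. Averaging \<theta> over a free variable tests its coefficient for 0, and such a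
  test of a free entry has probability 1/q. Odd characteristic enters through the 1/2 in the
  definition of \<open>amat\<close>, through the two roots of each nonzero square, and through the
  value 2 Y(i,a) Y(i,b) that \<epsilon>_a + \<epsilon>_b contributes to 2\<epsilon>_i.\<close>

definition avg :: "'c set \<Rightarrow> ('c \<Rightarrow> 'v set) \<Rightarrow> (('c \<Rightarrow> 'v) \<Rightarrow> complex) \<Rightarrow> complex" where
  "avg I \<Omega> f = (\<Sum>y\<in>PiE I \<Omega>. f y) / of_nat (card (PiE I \<Omega>))"

text \<open>Stated for all functions and not only for members of a product
  \<open>PiE I \<Omega>\<close>. It therefore survives an update of one coordinate and is not tied
  to an index set, which lets inductions over \<open>I\<close> go through.\<close>

definition depends_on :: "(('c \<Rightarrow> 'v) \<Rightarrow> 'b) \<Rightarrow> 'c set \<Rightarrow> bool" where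
  "depends_on f S \<longleftrightarrow> (\<forall>y y'. (\<forall>c\<in>S. y c = y' c) \<longrightarrow> f y = f y')"

lemma depends_onD: "depends_on f S \<Longrightarrow> (\<And>c. c \<in> S \<Longrightarrow> y c = y' c) \<Longrightarrow> f y = f y'"
  unfolding depends_on_def by blast

lemma depends_on_upd: "depends_on f S \<Longrightarrow> depends_on (\<lambda>y. f (y(c := t))) S"
  unfolding depends_on_def by simp

lemma avg_cong: "(\<And>y. y \<in> PiE I \<Omega> \<Longrightarrow> f y = g y) \<Longrightarrow> avg I \<Omega> f = avg I \<Omega> g"
  unfolding avg_def by (simp cong: sum.cong)

lemma avg_empty: "avg {} \<Omega> f = f (\<lambda>_. undefined)"
  by (simp add: avg_def)

lemma avg_insert:
  assumes "finite I" "c \<notin> I"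
  shows "avg (insert c I) \<Omega> f = (\<Sum>t\<in>\<Omega> c. avg I \<Omega> (\<lambda>y. f (y(c := t)))) / of_nat (card (\<Omega> c))"
proof -
  have inj: "inj_on (\<lambda>(y, g). g(c := y)) (\<Omega> c \<times> PiE I \<Omega>)"
    using inj_combinator[OF assms(2)] by blast
  have "(\<Sum>y\<in>PiE (insert c I) \<Omega>. f y) = (\<Sum>t\<in>\<Omega> c. \<Sum>y\<in>PiE I \<Omega>. f (y(c := t)))"
    by (simp add: PiE_insert_eq sum.reindex[OF inj] sum.cartesian_product)
      (rule sum.cong, auto)
  moreover have "card (PiE (insert c I) \<Omega>) = card (\<Omega> c) * card (PiE I \<Omega>)"
    by (simp add: PiE_insert_eq card_image[OF inj] card_cartesian_product)
  ultimately show ?thesis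
    unfolding avg_def by (simp add: sum_divide_distrib field_simps)
qed

lemma avg_const:
  assumes "finite I" "\<And>c. c \<in> I \<Longrightarrow> finite (\<Omega> c)" "\<And>c. c \<in> I \<Longrightarrow> \<Omega> c \<noteq> {}"
  shows "avg I \<Omega> (\<lambda>_. k) = k"
proof -
  have "card (PiE I \<Omega>) \<noteq> 0"
    using assms by (simp add: card_PiE)
  then show ?thesis by (simp add: avg_def)
qed

text \<open>Once the coordinate c is split off, the resampled integrand is constant in it, and its
  mean over \<open>\<Omega> c\<close> is the mean of f. This integrates out a single coordinate
  while the index set stays the same.\<close>

lemma avg_resample:
  assumes "finite I" "c \<in> I" "finite (\<Omega> c)" "\<Omega> c \<noteq> {}"
  shows "avg I \<Omega> f = avg I \<Omega> (\<lambda>y. (\<Sum>t\<in>\<Omega> c. f (y(c := t))) / of_nat (card (\<Omega> c)))"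
proof -
  have I: "I = insert c (I - {c})" using assms by auto
  have "card (\<Omega> c) \<noteq> 0" using assms by simp
  moreover have "avg (I - {c}) \<Omega> (\<lambda>y. (\<Sum>t\<in>\<Omega> c. f (y(c := t))) / of_nat (card (\<Omega> c))) =
      (\<Sum>t\<in>\<Omega> c. avg (I - {c}) \<Omega> (\<lambda>y. f (y(c := t)))) / of_nat (card (\<Omega> c))"
    unfolding avg_def
    by (simp only: sum_divide_distrib[symmetric] sum.swap[of _ "\<Omega> c"]) (simp add: mult.commute)
  ultimately show ?thesis
    by (subst (1 2) I, subst (1 2) avg_insert) (use assms in auto)
qed

text \<open>As S and T are disjoint, the coordinate added in the induction step lies outside one of
  them. The factor belonging to that set is constant in it and can be pulled out of the sum over
  this coordinate.\<close>

lemma avg_mult_indep: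
  assumes "finite I" "depends_on f S" "depends_on g T" "S \<inter> T = {}"
    and "\<And>c. c \<in> I \<Longrightarrow> finite (\<Omega> c)" "\<And>c. c \<in> I \<Longrightarrow> \<Omega> c \<noteq> {}"
  shows "avg I \<Omega> (\<lambda>y. f y * g y) = avg I \<Omega> f * avg I \<Omega> g"
  using assms
proof (induction I arbitrary: f g rule: finite_induct)
  case empty
  then show ?case by (simp add: avg_empty)
next
  case (insert c I)
  have card: "of_nat (card (\<Omega> c)) \<noteq> (0 :: complex)"
    using insert.prems by simp
  have up: "avg I \<Omega> (\<lambda>y. f (y(c := t)) * g (y(c := t))) =
      avg I \<Omega> (\<lambda>y. f (y(c := t))) * avg I \<Omega> (\<lambda>y. g (y(c := t)))" for t
    by (rule insert.IH) (use insert.prems in \<open>auto intro: depends_on_upd simp del: fun_upd_apply\<close>)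
  have const: "h (y(c := t)) = h y" if "depends_on h R" "c \<notin> R" for h :: "('a \<Rightarrow> 'b) \<Rightarrow> complex" and R y t
    by (rule depends_onD[OF that(1)]) (use that in auto)
  consider "c \<notin> S" | "c \<notin> T" using insert.prems by blast
  then show ?case
  proof cases
    case 1
    have "avg (insert c I) \<Omega> f = avg I \<Omega> f"
      using card by (simp add: avg_insert[OF insert.hyps] const[OF insert.prems(1) 1] del: fun_upd_apply)
    then show ?thesis
      by (simp add: avg_insert[OF insert.hyps] up)
        (simp add: const[OF insert.prems(1) 1] flip: sum_distrib_left del: fun_upd_apply)
  next
    case 2
    have "avg (insert c I) \<Omega> g = avg I \<Omega> g"
      using card by (simp add: avg_insert[OF insert.hyps] const[OF insert.prems(2) 2] del: fun_upd_apply)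
    then show ?thesis
      by (simp add: avg_insert[OF insert.hyps] up)
        (simp add: const[OF insert.prems(2) 2] flip: sum_distrib_right del: fun_upd_apply)
  qed
qed

lemma depends_on_prod:
  assumes "\<And>b. b \<in> B \<Longrightarrow> depends_on (g b) (S b)"
  shows "depends_on (\<lambda>y. \<Prod>b\<in>B. g b y) (\<Union>b\<in>B. S b)"
  unfolding depends_on_def
  by (intro allI impI prod.cong refl depends_onD[OF assms]) auto

lemma avg_prod_indep:
  assumes "finite I" "finite B" "\<And>b. b \<in> B \<Longrightarrow> depends_on (g b) (S b)"
    and "\<And>b b'. b \<in> B \<Longrightarrow> b' \<in> B \<Longrightarrow> b \<noteq> b' \<Longrightarrow> S b \<inter> S b' = {}"
    and "\<And>c. c \<in> I \<Longrightarrow> finite (\<Omega> c)" "\<And>c. c \<in> I \<Longrightarrow> \<Omega> c \<noteq> {}"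
  shows "avg I \<Omega> (\<lambda>y. \<Prod>b\<in>B. g b y) = (\<Prod>b\<in>B. avg I \<Omega> (g b))"
  using assms(2,3,4)
proof (induction B rule: finite_induct)
  case empty
  then show ?case using assms by (simp add: avg_const)
next
  case (insert b B)
  have "avg I \<Omega> (\<lambda>y. g b y * (\<Prod>b\<in>B. g b y)) = avg I \<Omega> (g b) * avg I \<Omega> (\<lambda>y. \<Prod>b\<in>B. g b y)"
  proof (rule avg_mult_indep[OF assms(1)])
    show "depends_on (\<lambda>y. \<Prod>b\<in>B. g b y) (\<Union>b\<in>B. S b)"
      by (rule depends_on_prod) (use insert in auto)
    show "S b \<inter> (\<Union>b\<in>B. S b) = {}"
      using insert.hyps insert.prems(2)[of b] by fastforce
  qed (use insert assms in auto)
  then show ?case using insert by simp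
qed

section \<open>Additive characters and Gauss sums\<close>

lemma linear_char_zero:
  assumes "nontrivial_linear_char \<theta>"
  shows "\<theta> 0 = 1"
  using assms unfolding nontrivial_linear_char_def
  by (metis add_0 mult_cancel_right1 mult.right_neutral)

lemma linear_char_sum:
  assumes "nontrivial_linear_char \<theta>"
  shows "\<theta> (\<Sum>x\<in>A. f x) = (\<Prod>x\<in>A. \<theta> (f x))"
  using assms by (induction A rule: infinite_finite_induct)
    (auto simp: linear_char_zero nontrivial_linear_char_def)

text \<open>For c \<noteq> 0 multiplication by c permutes the field, and a shift by some s with
  \<theta> s \<noteq> 1 multiplies the sum by \<theta> s, which forces it to be 0.\<close>

lemma sum_linear_char:
  fixes \<theta> :: "'a::{field, finite} \<Rightarrow> complex"
  assumes "nontrivial_linear_char \<theta>"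
  shows "(\<Sum>t\<in>UNIV. \<theta> (c * t)) = (if c = 0 then of_nat CARD('a) else 0)"
proof (cases "c = 0")
  case True
  then show ?thesis using linear_char_zero[OF assms] by simp
next
  case False
  obtain s where s: "\<theta> s \<noteq> 1"
    using assms by (auto simp: nontrivial_linear_char_def)
  have add: "\<theta> (a + b) = \<theta> a * \<theta> b" for a b
    using assms by (auto simp: nontrivial_linear_char_def)
  have "(\<Sum>t\<in>UNIV. \<theta> (c * t)) = (\<Sum>t\<in>UNIV. \<theta> t)"
    by (rule sum.reindex_bij_witness[of _ "\<lambda>t. t / c" "\<lambda>t. c * t"]) (use False in auto)
  moreover have "(\<Sum>t\<in>UNIV. \<theta> t) = (\<Sum>t\<in>UNIV. \<theta> (s + t))"
    by (rule sum.reindex_bij_witness[of _ "\<lambda>t. s + t" "\<lambda>t. t - s"]) auto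
  then have "(\<Sum>t\<in>UNIV. \<theta> t) = \<theta> s * (\<Sum>t\<in>UNIV. \<theta> t)"
    unfolding add sum_distrib_left[symmetric] .
  ultimately show ?thesis using s False by auto
qed

text \<open>Since 2 \<noteq> 0, a nonzero square has exactly two distinct roots b and -b.\<close>

lemma sum_over_squares:
  fixes f :: "'a::{field, finite} \<Rightarrow> complex"
  assumes "(2 :: 'a) \<noteq> 0"
  shows "(\<Sum>t\<in>UNIV - {0}. f (t ^ 2)) = 2 * (\<Sum>s\<in>{s. s \<noteq> 0 \<and> (\<exists>b. s = b ^ 2)}. f s)"
proof -
  let ?Q = "{s::'a. s \<noteq> 0 \<and> (\<exists>b. s = b ^ 2)}"
  have "(\<Sum>t\<in>UNIV - {0}. f (t ^ 2)) = (\<Sum>s\<in>?Q. \<Sum>t | t \<in> UNIV - {0} \<and> t ^ 2 = s. f (t ^ 2))"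
    by (rule sum.group[symmetric]) auto
  also have "\<dots> = (\<Sum>s\<in>?Q. 2 * f s)"
  proof (rule sum.cong[OF refl])
    fix s assume "s \<in> ?Q"
    then obtain b where b: "s = b ^ 2" "b \<noteq> 0" by auto
    have "{t. t \<in> UNIV - {0} \<and> t ^ 2 = s} = {b, - b}"
      using b by (auto simp: power2_eq_iff)
    moreover have "b \<noteq> - b"
    proof
      assume "b = - b"
      then have "2 * b = 0" unfolding eq_neg_iff_add_eq_0 mult_2 .
      then show False using assms b by simp
    qed
    ultimately show "(\<Sum>t | t \<in> UNIV - {0} \<and> t ^ 2 = s. f (t ^ 2)) = 2 * f s"
      using b by simp
  qed
  finally show ?thesis by (simp add: sum_distrib_left)
qed

text \<open>Multiplication by a nonsquare maps the nonzero squares onto the nonsquares, so the sums of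
  \<open>\<theta>(t\<^sup>2)\<close> and of \<open>\<theta>(c t\<^sup>2)\<close> add up to twice a full character sum.\<close>

lemma sum_linear_char_square:
  fixes \<theta> :: "'a::{field, finite} \<Rightarrow> complex"
  assumes "nontrivial_linear_char \<theta>" "(2 :: 'a) \<noteq> 0" "c \<noteq> 0"
  shows "(\<Sum>t\<in>UNIV. \<theta> (c * t ^ 2)) = quad_char c * gauss_sum \<theta>"
proof -
  define Q where "Q = {s::'a. s \<noteq> 0 \<and> (\<exists>b. s = b ^ 2)}"
  define N where "N = {s::'a. \<not> (\<exists>b. s = b ^ 2)}"
  have N0: "0 \<notin> N" by (auto simp: N_def intro!: exI[of _ 0])
  have part: "UNIV - {0} = Q \<union> N" "Q \<inter> N = {}" using N0 by (auto simp: Q_def N_def)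
  have split: "(\<Sum>t\<in>UNIV. h t) = h 0 + (\<Sum>t\<in>UNIV - {0}. h t)" for h :: "'a \<Rightarrow> complex"
    by (simp add: sum.remove)
  have \<theta>0: "\<theta> 0 = 1" by (rule linear_char_zero[OF assms(1)])
  \<comment> \<open>The summand 1 is the value of \<open>\<theta>\<close> at 0, which belongs
    neither to \<open>Q\<close> nor to \<open>N\<close>.\<close>
  have total: "1 + sum \<theta> Q + sum \<theta> N = 0"
    using sum_linear_char[OF assms(1), of 1] \<theta>0 part
    by (simp add: split[of \<theta>] sum.union_disjoint add.assoc)
  have gauss: "gauss_sum \<theta> = sum \<theta> Q - sum \<theta> N"
  proof -
    have "(\<Sum>c\<in>Q. quad_char c * \<theta> c) = sum \<theta> Q"
      by (rule sum.cong) (auto simp: quad_char_def Q_def)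
    moreover have "(\<Sum>c\<in>N. quad_char c * \<theta> c) = - sum \<theta> N"
      unfolding sum_negf[symmetric] by (rule sum.cong) (auto simp: quad_char_def N_def)
    ultimately show ?thesis
      unfolding gauss_sum_def part(1) using part by (simp add: sum.union_disjoint)
  qed
  have sq: "(\<Sum>t\<in>UNIV. \<theta> (c * t ^ 2)) = 1 + 2 * (\<Sum>s\<in>Q. \<theta> (c * s))" for c
    using sum_over_squares[OF assms(2), of "\<lambda>s. \<theta> (c * s)"] \<theta>0 by (simp add: split Q_def)
  show ?thesis
  proof (cases "\<exists>b. c = b ^ 2")
    case True
    then obtain b where b: "c = b ^ 2" "b \<noteq> 0" using assms(3) by auto
    have "s / c \<in> Q" if s: "s \<in> Q" for s
    proof -
      obtain d where "s = d ^ 2" "d \<noteq> 0" using s by (auto simp: Q_def)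
      then have "s / c = (d / b) ^ 2" "s / c \<noteq> 0" using b by (simp_all add: power_divide)
      then show ?thesis unfolding Q_def by blast
    qed
    moreover have "c * s \<in> Q" if s: "s \<in> Q" for s
    proof -
      obtain d where "s = d ^ 2" "d \<noteq> 0" using s by (auto simp: Q_def)
      then have "c * s = (b * d) ^ 2" "c * s \<noteq> 0" using b by (simp_all add: power_mult_distrib)
      then show ?thesis unfolding Q_def by blast
    qed
    ultimately have "(\<Sum>s\<in>Q. \<theta> (c * s)) = sum \<theta> Q"
      using assms(3) by (intro sum.reindex_bij_witness[of _ "\<lambda>s. s / c" "\<lambda>s. c * s"]) auto
    moreover have "sum \<theta> N = - 1 - sum \<theta> Q" using total by (simp add: algebra_simps eq_neg_iff_add_eq_0)
    moreover have "quad_char c = 1" using True by (simp add: quad_char_def)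
    ultimately show ?thesis
      using gauss unfolding sq by simp
  next
    case False
    have sub: "(*) c ` Q \<subseteq> N"
    proof clarify
      fix s assume "s \<in> Q"
      then obtain b where b: "s = b ^ 2" "b \<noteq> 0" by (auto simp: Q_def)
      show "c * s \<in> N"
      proof (rule ccontr)
        assume "c * s \<notin> N"
        then obtain d where "c * b ^ 2 = d ^ 2" using b by (auto simp: N_def)
        then have "c = (d / b) ^ 2" using b by (simp add: power_divide field_simps)
        then show False using False by blast
      qed
    qed
    have inj: "inj_on ((*) c) A" for A using assms(3) by (auto simp: inj_on_def)
    obtain d where d: "d \<in> N" using False by (auto simp: N_def)
    \<comment> \<open>With the constant function 1, \<open>sum_over_squares\<close> says that the
      nonzero squares are half of all nonzero elements. Hence the injective image of
      \<open>Q\<close> under multiplication by c must fill \<open>N\<close>.\<close>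
    have cardN: "card N \<le> card Q"
    proof -
      have "complex_of_nat (card (UNIV - {0::'a})) = 2 * of_nat (card Q)"
        using sum_over_squares[OF assms(2), of "\<lambda>_. 1"] by (simp add: Q_def)
      then have "card (UNIV - {0::'a}) = 2 * card Q"
        by (metis of_nat_eq_iff of_nat_mult of_nat_numeral)
      then show ?thesis using part by (simp add: card_Un_disjoint)
    qed
    have "(*) c ` Q = N"
      by (rule card_seteq) (use sub cardN inj in \<open>auto simp: card_image\<close>)
    then have "(\<Sum>s\<in>Q. \<theta> (c * s)) = sum \<theta> N"
      using sum.reindex[OF inj[of Q], of \<theta>] by (simp add: o_def)
    moreover have "quad_char c = -1" using False by (simp add: quad_char_def)
    moreover have "sum \<theta> Q = - 1 - sum \<theta> N" using total by (simp add: algebra_simps eq_neg_iff_add_eq_0)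
    ultimately show ?thesis
      using gauss unfolding sq by simp
  qed
qed

text \<open>If 2 = 0, then the characteristic is 2, and it divides the number of elements.\<close>

lemma two_neq_zero_if_odd_card:
  assumes "odd CARD('a::{field, finite})"
  shows "(2 :: 'a) \<noteq> 0"
proof
  assume "(2 :: 'a) = 0"
  then have "of_nat 2 = (0 :: 'a)" by simp
  then have "CHAR('a) dvd 2" by (simp only: of_nat_eq_0_iff_char_dvd)
  then have "CHAR('a) = 2"
    using CHAR_not_1[where ?'a = 'a] by (metis One_nat_def prime_nat_iff two_is_prime_nat)
  then show False using CHAR_dvd_CARD[where ?'a = 'a] assms by simp
qed

text \<open>The two arguments differ by the square of r. The averages produce the product of the two
  coefficients, whereas the constant c is written with a quotient.\<close>

lemma quad_char_inverse_mult:
  assumes "r \<noteq> 0"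
  shows "quad_char (inverse r * c) = quad_char (r * c)"
proof -
  have "(\<exists>b. inverse r * c = b ^ 2) \<longleftrightarrow> (\<exists>b. r * c = b ^ 2)"
  proof safe
    fix b assume "inverse r * c = b ^ 2"
    then have "r * c = (r * b) ^ 2" using assms by (simp add: field_simps power2_eq_square)
    then show "\<exists>b. r * c = b ^ 2" by blast
  next
    fix b assume "r * c = b ^ 2"
    then have "inverse r * c = (b / r) ^ 2" using assms by (simp add: field_simps power2_eq_square)
    then show "\<exists>b. inverse r * c = b ^ 2" by blast
  qed
  then show ?thesis by (simp add: quad_char_def)
qed

section \<open>Unitriangular matrices\<close>

lemma UT_iff:
  "x \<in> carrier (UT k) \<longleftrightarrow> x \<in> carrier_mat k k \<and>
     (\<forall>i<k. \<forall>j<i. x $$ (i, j) = 0) \<and> (\<forall>i<k. x $$ (i, i) = 1)"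
  by (auto simp: UT_def upper_triangular_def)

lemma UT_mult [simp]: "x \<otimes>\<^bsub>UT k\<^esub> y = x * y"
  by (simp add: UT_def)

lemma UT_one [simp]: "\<one>\<^bsub>UT k\<^esub> = 1\<^sub>m k"
  by (simp add: UT_def)

lemma UT_carrier_mat: "x \<in> carrier (UT k) \<Longrightarrow> x \<in> carrier_mat k k"
  by (simp add: UT_iff)

lemma UT_one_closed: "1\<^sub>m k \<in> carrier (UT k)"
  by (simp add: UT_iff)

lemma index_mult_sum:
  assumes "x \<in> carrier_mat a b" "y \<in> carrier_mat b c" "i < a" "j < c"
  shows "(x * y) $$ (i, j) = (\<Sum>t<b. x $$ (i, t) * y $$ (t, j))"
  using assms by (auto simp: scalar_prod_def lessThan_atLeast0 intro!: sum.cong)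

lemma UT_mult_closed:
  fixes x y :: "'a::field mat"
  assumes "x \<in> carrier (UT k)" "y \<in> carrier (UT k)"
  shows "x * y \<in> carrier (UT k)"
proof -
  have c: "x \<in> carrier_mat k k" "y \<in> carrier_mat k k" using assms by (auto simp: UT_iff)
  have xz: "x $$ (i, t) = 0" if "t < i" "i < k" for i t using assms that by (auto simp: UT_iff)
  have yz: "y $$ (i, t) = 0" if "t < i" "i < k" for i t using assms that by (auto simp: UT_iff)
  have "(x * y) $$ (i, j) = 0" if "i < k" "j < i" for i j
  proof -
    have "x $$ (i, t) * y $$ (t, j) = 0" if "t < k" for t
      using xz[of t i] yz[of j t] that \<open>i < k\<close> \<open>j < i\<close> by (cases "t < i") auto
    then show ?thesis using that by (simp add: index_mult_sum[OF c] sum.neutral del: mult_eq_0_iff)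
  qed
  moreover have "(x * y) $$ (i, i) = 1" if "i < k" for i
  proof -
    have "(x * y) $$ (i, i) = (\<Sum>t<k. x $$ (i, t) * y $$ (t, i))"
      using that by (simp add: index_mult_sum[OF c])
    also have "\<dots> = (\<Sum>t<k. if t = i then 1 else 0)"
    proof (rule sum.cong[OF refl])
      fix t assume "t \<in> {..<k}"
      then show "x $$ (i, t) * y $$ (t, i) = (if t = i then 1 else 0)"
        using xz[of t i] yz[of i t] that assms by (cases t i rule: linorder_cases) (auto simp: UT_iff)
    qed
    finally show ?thesis using that by simp
  qed
  ultimately show ?thesis using c by (simp add: UT_iff)
qed

lemma finite_carrier_mat: "finite (carrier_mat a b :: 'a::finite mat set)"
proof (rule finite_imageD)
  let ?f = "\<lambda>x::'a mat. restrict (\<lambda>p. x $$ p) ({..<a} \<times> {..<b})"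
  show "finite (?f ` carrier_mat a b)"
    by (rule finite_subset[of _ "PiE ({..<a} \<times> {..<b}) (\<lambda>_. UNIV)"])
      (auto intro: finite_PiE split: if_splits)
  show "inj_on ?f (carrier_mat a b)"
  proof (rule inj_onI)
    fix x y assume xy: "x \<in> carrier_mat a b" "y \<in> carrier_mat a b" "?f x = ?f y"
    show "x = y"
    proof (rule eq_matI)
      fix i j assume "i < dim_row y" "j < dim_col y"
      moreover have "?f x (i, j) = ?f y (i, j)" using xy(3) by simp
      ultimately show "x $$ (i, j) = y $$ (i, j)" using xy(1,2) by simp
    qed (use xy in auto)
  qed
qed

lemma finite_UT: "finite (carrier (UT k) :: 'a::{field, finite} mat set)"
  by (rule finite_subset[OF _ finite_carrier_mat[of k k]]) (auto simp: UT_iff)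

text \<open>The determinant is the product of the diagonal entries, hence 1. The inverse obtained
  here is just some square matrix; that it is unitriangular again is shown in
  \<open>UT_inverse\<close>.\<close>

lemma UT_left_inverse:
  fixes x :: "'a::field mat"
  assumes "x \<in> carrier (UT k)"
  obtains u where "u \<in> carrier_mat k k" "u * x = 1\<^sub>m k"
proof -
  have "det x = prod_list (diag_mat x)"
    using assms by (intro det_upper_triangular[of _ k]) (auto simp: UT_def)
  also have "diag_mat x = replicate k 1"
    using assms by (intro nth_equalityI) (auto simp: UT_iff diag_mat_def)
  finally have "det x \<noteq> 0" by simp
  then have "x \<in> Units (ring_mat TYPE('a) k ())"
    using assms by (intro det_non_zero_imp_unit) (auto simp: UT_iff)
  then show ?thesis
    using that by (auto simp: Units_def ring_mat_simps)
qed

text \<open>Left multiplication by a fixed element is injective on the finite carrier, hence onto.\<close>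

lemma UT_inverse:
  fixes x :: "'a::{field, finite} mat"
  assumes x: "x \<in> carrier (UT k)"
  obtains y where "y \<in> carrier (UT k)" "x * y = 1\<^sub>m k" "y * x = 1\<^sub>m k"
proof -
  obtain u where u: "u \<in> carrier_mat k k" "u * x = 1\<^sub>m k" using UT_left_inverse[OF x] .
  have "inj_on ((*) x) (carrier (UT k))"
  proof (rule inj_onI)
    fix y z assume yz: "y \<in> carrier (UT k)" "z \<in> carrier (UT k)" "x * y = x * z"
    have "(u * x) * y = (u * x) * z"
      using yz u(1) x UT_carrier_mat by (metis assoc_mult_mat)
    then show "y = z" using u yz UT_carrier_mat by (metis left_mult_one_mat)
  qed
  moreover have "(*) x ` carrier (UT k) \<subseteq> carrier (UT k)"
    using UT_mult_closed[OF x] by auto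
  ultimately have "(*) x ` carrier (UT k) = carrier (UT k)"
    by (simp add: endo_inj_surj finite_UT)
  then obtain y where y: "y \<in> carrier (UT k)" "x * y = 1\<^sub>m k"
    using UT_one_closed[of k] by (metis imageE)
  then have "y * x = 1\<^sub>m k"
    using mat_mult_left_right_inverse[of x k y] x UT_carrier_mat by blast
  then show ?thesis using that y by blast
qed

lemma UT_group: "group (UT k :: 'a::{field, finite} mat monoid)"
proof (rule groupI)
  fix x y z :: "'a mat"
  assume "x \<in> carrier (UT k)" "y \<in> carrier (UT k)" "z \<in> carrier (UT k)"
  then show "x \<otimes>\<^bsub>UT k\<^esub> y \<otimes>\<^bsub>UT k\<^esub> z = x \<otimes>\<^bsub>UT k\<^esub> (y \<otimes>\<^bsub>UT k\<^esub> z)"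
    using UT_carrier_mat by (metis UT_mult assoc_mult_mat)
next
  fix x :: "'a mat" assume x: "x \<in> carrier (UT k)"
  show "\<exists>y\<in>carrier (UT k). y \<otimes>\<^bsub>UT k\<^esub> x = \<one>\<^bsub>UT k\<^esub>" using UT_inverse[OF x] by auto
  show "\<one>\<^bsub>UT k\<^esub> \<otimes>\<^bsub>UT k\<^esub> x = x" using UT_carrier_mat[OF x] by simp
qed (auto simp: UT_mult_closed UT_one_closed)

lemma UT_inv:
  fixes x :: "'a::{field, finite} mat"
  assumes "x \<in> carrier (UT k)"
  shows "inv\<^bsub>UT k\<^esub> x \<in> carrier (UT k)" "x * inv\<^bsub>UT k\<^esub> x = 1\<^sub>m k" "inv\<^bsub>UT k\<^esub> x * x = 1\<^sub>m k"
proof -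
  interpret group "UT k :: 'a mat monoid" by (rule UT_group)
  show "inv\<^bsub>UT k\<^esub> x \<in> carrier (UT k)" using assms by simp
  show "x * inv\<^bsub>UT k\<^esub> x = 1\<^sub>m k" using r_inv[OF assms] by simp
  show "inv\<^bsub>UT k\<^esub> x * x = 1\<^sub>m k" using l_inv[OF assms] by simp
qed

section \<open>Three by three block matrices\<close>

definition blk :: "nat \<Rightarrow> nat \<Rightarrow> nat \<Rightarrow> nat" where
  "blk n r k = (if k < n then 0 else if k < n + r then 1 else 2)"

definition off :: "nat \<Rightarrow> nat \<Rightarrow> nat \<Rightarrow> nat" where
  "off n r k = (if k < n then k else if k < n + r then k - n else k - n - r)"

definition bsize :: "nat \<Rightarrow> nat \<Rightarrow> nat \<Rightarrow> nat" where
  "bsize n r p = (if p = 1 then r else n)"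

text \<open>The blocks are kept in a list of lists so that products and transposes are given by one
  formula in the block positions p and q. The nested form of \<open>block3\<close> is translated
  once, in \<open>block3_mat3\<close>.\<close>

definition mat3 :: "nat \<Rightarrow> nat \<Rightarrow> 'a mat list list \<Rightarrow> 'a mat" where
  "mat3 n r X = mat (2 * n + r) (2 * n + r)
     (\<lambda>(k, l). (X ! blk n r k ! blk n r l) $$ (off n r k, off n r l))"

definition blocks :: "nat \<Rightarrow> nat \<Rightarrow> 'a mat list list \<Rightarrow> bool" where
  "blocks n r X \<longleftrightarrow> (\<forall>p<3. \<forall>q<3. X ! p ! q \<in> carrier_mat (bsize n r p) (bsize n r q))"

abbreviation upper3 :: "nat \<Rightarrow> nat \<Rightarrow> 'a mat \<Rightarrow> 'a mat \<Rightarrow> 'a mat \<Rightarrow> 'a mat \<Rightarrow> 'a mat \<Rightarrow> 'a::field mat" where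
  "upper3 n r A B C F H \<equiv> mat3 n r [[A, B, C], [0\<^sub>m r n, 1\<^sub>m r, F], [0\<^sub>m n n, 0\<^sub>m n r, H]]"

lemma all_less_3: "(\<forall>p<(3::nat). P p) \<longleftrightarrow> P 0 \<and> P 1 \<and> P 2"
  by (auto simp: numeral_3_eq_3 less_Suc_eq numeral_2_eq_2)

lemma mat3_carrier [simp]: "mat3 n r X \<in> carrier_mat (2 * n + r) (2 * n + r)"
  by (simp add: mat3_def)

lemma blk_less: "k < 2 * n + r \<Longrightarrow> blk n r k < 3" by (simp add: blk_def)

lemma off_less: "k < 2 * n + r \<Longrightarrow> off n r k < bsize n r (blk n r k)"
  by (auto simp: blk_def off_def bsize_def)

lemma sum_lessThan_add:
  fixes g :: "nat \<Rightarrow> 'a::comm_monoid_add"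
  shows "(\<Sum>t<a + b. g t) = (\<Sum>t<a. g t) + (\<Sum>t<b. g (a + t))"
  by (induction b) (auto simp: ac_simps)

lemma sum_blocks:
  fixes g :: "nat \<Rightarrow> 'a::comm_monoid_add"
  shows "(\<Sum>t<2 * n + r. g t) = (\<Sum>t<n. g t) + (\<Sum>t<r. g (n + t)) + (\<Sum>t<n. g (n + r + t))"
proof -
  have "2 * n + r = n + r + n" by simp
  then show ?thesis by (simp only: sum_lessThan_add)
qed

definition mult_blocks :: "'a::semiring_0 mat list list \<Rightarrow> 'a mat list list \<Rightarrow> 'a mat list list" where
  "mult_blocks X Y = map (\<lambda>p. map (\<lambda>q.
     X ! p ! 0 * Y ! 0 ! q + X ! p ! 1 * Y ! 1 ! q + X ! p ! 2 * Y ! 2 ! q) [0, 1, 2]) [0, 1, 2]"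

lemma mult_blocks_nth:
  assumes "p < 3" "q < 3"
  shows "mult_blocks X Y ! p ! q =
    X ! p ! 0 * Y ! 0 ! q + X ! p ! 1 * Y ! 1 ! q + X ! p ! 2 * Y ! 2 ! q"
  using assms by (auto simp: mult_blocks_def numeral_3_eq_3 less_Suc_eq numeral_2_eq_2)

lemma blocksD: "blocks n r X \<Longrightarrow> p < 3 \<Longrightarrow> q < 3 \<Longrightarrow> X ! p ! q \<in> carrier_mat (bsize n r p) (bsize n r q)"
  by (simp add: blocks_def)

text \<open>The summation range of a matrix product falls into three intervals of lengths n, r and
  n, one for each middle block.\<close>

lemma mat3_mult:
  fixes X Y :: "'a::semiring_0 mat list list"
  assumes X: "blocks n r X" and Y: "blocks n r Y"
  shows "mat3 n r X * mat3 n r Y = mat3 n r (mult_blocks X Y)"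
proof (rule eq_matI)
  fix i j assume "i < dim_row (mat3 n r (mult_blocks X Y))" "j < dim_col (mat3 n r (mult_blocks X Y))"
  then have i: "i < 2 * n + r" and j: "j < 2 * n + r" by (auto simp: mat3_def)
  let ?p = "blk n r i" and ?q = "blk n r j" and ?i = "off n r i" and ?j = "off n r j"
  note b = blk_less[OF i] blk_less[OF j] off_less[OF i] off_less[OF j]
  have part: "(X ! ?p ! s * Y ! s ! ?q) $$ (?i, ?j) =
      (\<Sum>t<bsize n r s. (X ! ?p ! s) $$ (?i, t) * (Y ! s ! ?q) $$ (t, ?j))" if "s < 3" for s
    using that b by (intro index_mult_sum[OF blocksD[OF X] blocksD[OF Y]]) auto
  have c: "X ! ?p ! s * Y ! s ! ?q \<in> carrier_mat (bsize n r ?p) (bsize n r ?q)" if "s < 3" for s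
    using that b blocksD[OF X, of ?p s] blocksD[OF Y, of s ?q] by auto
  have "(mat3 n r X * mat3 n r Y) $$ (i, j) =
      (\<Sum>t<2 * n + r. (X ! ?p ! blk n r t) $$ (?i, off n r t) * (Y ! blk n r t ! ?q) $$ (off n r t, ?j))"
    using i j by (simp add: index_mult_sum[OF mat3_carrier mat3_carrier]) (simp add: mat3_def)
  also have "\<dots> = (X ! ?p ! 0 * Y ! 0 ! ?q) $$ (?i, ?j) + (X ! ?p ! 1 * Y ! 1 ! ?q) $$ (?i, ?j) +
      (X ! ?p ! 2 * Y ! 2 ! ?q) $$ (?i, ?j)"
    by (simp add: sum_blocks part) (simp add: blk_def off_def bsize_def)
  also have "\<dots> = mat3 n r (mult_blocks X Y) $$ (i, j)"
    using i j b c[of 0] c[of 1] c[of 2]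
    by (simp add: mat3_def mult_blocks_nth carrier_matD[OF blocksD[OF X]] carrier_matD[OF blocksD[OF Y]]
        del: assoc_add_mat)
  finally show "(mat3 n r X * mat3 n r Y) $$ (i, j) = mat3 n r (mult_blocks X Y) $$ (i, j)" .
qed (auto simp: mat3_def)

definition transpose_blocks :: "'a mat list list \<Rightarrow> 'a mat list list" where
  "transpose_blocks X = map (\<lambda>p. map (\<lambda>q. (X ! q ! p)\<^sup>T) [0, 1, 2]) [0, 1, 2]"

lemma transpose_blocks_nth:
  "p < 3 \<Longrightarrow> q < 3 \<Longrightarrow> transpose_blocks X ! p ! q = (X ! q ! p)\<^sup>T"
  by (auto simp: transpose_blocks_def numeral_3_eq_3 less_Suc_eq numeral_2_eq_2)

lemma mat3_transpose:
  assumes "blocks n r X"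
  shows "(mat3 n r X)\<^sup>T = mat3 n r (transpose_blocks X)"
proof (rule eq_matI)
  fix i j assume "i < dim_row (mat3 n r (transpose_blocks X))" "j < dim_col (mat3 n r (transpose_blocks X))"
  then have i: "i < 2 * n + r" and j: "j < 2 * n + r" by (auto simp: mat3_def)
  show "(mat3 n r X)\<^sup>T $$ (i, j) = mat3 n r (transpose_blocks X) $$ (i, j)"
    using i j blk_less[OF i] blk_less[OF j] off_less[OF i] off_less[OF j]
      blocksD[OF assms, of "blk n r j" "blk n r i"]
    by (auto simp: mat3_def transpose_blocks_nth)
qed (auto simp: mat3_def)

lemma blocks_transpose: "blocks n r X \<Longrightarrow> blocks n r (transpose_blocks X)"
  by (auto simp: blocks_def transpose_blocks_nth)

lemma blocks_iff:
  "blocks n r [[A, B, C], [D, E, F], [H, K, L]] \<longleftrightarrow>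
     A \<in> carrier_mat n n \<and> B \<in> carrier_mat n r \<and> C \<in> carrier_mat n n \<and>
     D \<in> carrier_mat r n \<and> E \<in> carrier_mat r r \<and> F \<in> carrier_mat r n \<and>
     H \<in> carrier_mat n n \<and> K \<in> carrier_mat n r \<and> L \<in> carrier_mat n n"
  unfolding blocks_def all_less_3 bsize_def by (auto simp: numeral_2_eq_2)

lemma mult_blocks_eq:
  "mult_blocks [[A, B, C], [D, E, F], [H, K, L]] [[A', B', C'], [D', E', F'], [H', K', L']] =
     [[A * A' + B * D' + C * H', A * B' + B * E' + C * K', A * C' + B * F' + C * L'],
      [D * A' + E * D' + F * H', D * B' + E * E' + F * K', D * C' + E * F' + F * L'],
      [H * A' + K * D' + L * H', H * B' + K * E' + L * K', H * C' + K * F' + L * L']]"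
  by (simp add: mult_blocks_def numeral_2_eq_2)

lemma transpose_blocks_eq:
  "transpose_blocks [[A, B, C], [D, E, F], [H, K, L]] =
     [[A\<^sup>T, D\<^sup>T, H\<^sup>T], [B\<^sup>T, E\<^sup>T, K\<^sup>T], [C\<^sup>T, F\<^sup>T, L\<^sup>T]]"
  by (simp add: transpose_blocks_def numeral_2_eq_2)

lemma mat3_cong:
  "X = Y \<Longrightarrow> mat3 n r X = mat3 n r Y" by simp

lemma block3_mat3:
  assumes "blocks n r [[A, B, C], [0\<^sub>m r n, D, E], [0\<^sub>m n n, 0\<^sub>m n r, F]]"
  shows "block3 n r A B C D E F = mat3 n r [[A, B, C], [0\<^sub>m r n, D, E], [0\<^sub>m n n, 0\<^sub>m n r, F]]"
  using assms unfolding blocks_iff block3_def append_rows_def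
  by (intro eq_matI) (auto simp: mat3_def blk_def off_def numeral_2_eq_2)

section \<open>Matrix identities with dimension side conditions\<close>

text \<open>The library states these with carriers, whose inner dimensions the simplifier cannot guess.\<close>

named_theorems mat_dim

lemma assoc_mult_dim [mat_dim]:
  fixes A B C :: "'a::field mat"
  shows "dim_col A = dim_row B \<Longrightarrow> dim_col B = dim_row C \<Longrightarrow> A * B * C = A * (B * C)"
  by (rule assoc_mult_mat[of _ "dim_row A" "dim_row B" _ "dim_row C" _ "dim_col C"]) auto

lemma transpose_mult_dim [mat_dim]:
  fixes A B :: "'a::field mat"
  shows "dim_col A = dim_row B \<Longrightarrow> (A * B)\<^sup>T = B\<^sup>T * A\<^sup>T"
  by (rule transpose_mult[of _ "dim_row A" "dim_row B" _ "dim_col B"]) auto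

lemma add_mult_dim [mat_dim]:
  fixes A B C :: "'a::field mat"
  shows "dim_row A = dim_row B \<Longrightarrow> dim_col A = dim_col B \<Longrightarrow> dim_col B = dim_row C \<Longrightarrow>
    (A + B) * C = A * C + B * C"
  by (rule add_mult_distrib_mat[of _ "dim_row A" "dim_row C" _ _ "dim_col C"]) auto

lemma mult_add_dim [mat_dim]:
  fixes A B C :: "'a::field mat"
  shows "dim_row B = dim_row C \<Longrightarrow> dim_col B = dim_col C \<Longrightarrow> dim_col A = dim_row C \<Longrightarrow>
    A * (B + C) = A * B + A * C"
  by (rule mult_add_distrib_mat[of _ "dim_row A" "dim_row C" _ "dim_col C"]) auto

lemma minus_mult_dim [mat_dim]:
  fixes A B C :: "'a::field mat"
  shows "dim_row A = dim_row B \<Longrightarrow> dim_col A = dim_col B \<Longrightarrow> dim_col B = dim_row C \<Longrightarrow>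
    (A - B) * C = A * C - B * C"
  by (rule minus_mult_distrib_mat[of _ "dim_row A" "dim_row C" _ _ "dim_col C"]) auto

lemma mult_minus_dim [mat_dim]:
  fixes A B C :: "'a::field mat"
  shows "dim_row B = dim_row C \<Longrightarrow> dim_col B = dim_col C \<Longrightarrow> dim_col A = dim_row C \<Longrightarrow>
    A * (B - C) = A * B - A * C"
  by (rule mult_minus_distrib_mat[of _ "dim_row A" "dim_row C" _ "dim_col C"]) auto

lemma smult_mult_dim [mat_dim]:
  fixes A B :: "'a::field mat"
  shows "dim_col A = dim_row B \<Longrightarrow> (k \<cdot>\<^sub>m A) * B = k \<cdot>\<^sub>m (A * B)"
  by (rule mult_smult_assoc_mat[of _ "dim_row A" "dim_row B" _ "dim_col B"]) auto

lemma mult_smult_dim [mat_dim]: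
  fixes A B :: "'a::field mat"
  shows "dim_col A = dim_row B \<Longrightarrow> A * (k \<cdot>\<^sub>m B) = k \<cdot>\<^sub>m (A * B)"
  by (rule mult_smult_distrib[of _ "dim_row A" "dim_row B" _ "dim_col B"]) auto

lemma one_mult_dim [mat_dim]:
  fixes A :: "'a::field mat"
  shows "dim_row A = k \<Longrightarrow> 1\<^sub>m k * A = A" "dim_col A = k \<Longrightarrow> A * 1\<^sub>m k = A"
  by (rule left_mult_one_mat[of _ _ "dim_col A"] right_mult_one_mat[of _ "dim_row A"]; auto)+

lemma zero_mult_dim [mat_dim]:
  fixes A :: "'a::field mat"
  shows "dim_row A = l \<Longrightarrow> 0\<^sub>m k l * A = 0\<^sub>m k (dim_col A)"
    "dim_col A = k \<Longrightarrow> A * 0\<^sub>m k l = 0\<^sub>m (dim_row A) l"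
  by (rule left_mult_zero_mat[of _ _ "dim_col A"] right_mult_zero_mat[of _ "dim_row A"]; auto)+

lemma transpose_linear_dim [mat_dim]:
  fixes A B :: "'a::field mat"
  shows "dim_row A = dim_row B \<Longrightarrow> dim_col A = dim_col B \<Longrightarrow>
      (A + B)\<^sup>T = A\<^sup>T + B\<^sup>T"
    "dim_row A = dim_row B \<Longrightarrow> dim_col A = dim_col B \<Longrightarrow>
      (A - B)\<^sup>T = A\<^sup>T - B\<^sup>T"
    "(- A)\<^sup>T = - A\<^sup>T"
    "(k \<cdot>\<^sub>m A)\<^sup>T = k \<cdot>\<^sub>m A\<^sup>T"
  by (auto intro!: eq_matI)

lemma smult_uminus_dim [mat_dim]:
  fixes A :: "'a::field mat"
  shows "k \<cdot>\<^sub>m (- A) = - (k \<cdot>\<^sub>m A)"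
  by (auto intro!: eq_matI)

lemma add_zero_dim [mat_dim]:
  fixes A :: "'a::field mat"
  shows "dim_row A = k \<Longrightarrow> dim_col A = l \<Longrightarrow> A + 0\<^sub>m k l = A"
    "dim_row A = k \<Longrightarrow> dim_col A = l \<Longrightarrow> 0\<^sub>m k l + A = A"
    "dim_row A = k \<Longrightarrow> dim_col A = l \<Longrightarrow> A + - A = 0\<^sub>m k l"
    "dim_row A = k \<Longrightarrow> dim_col A = l \<Longrightarrow> - A + A = 0\<^sub>m k l"
    "dim_row A = k \<Longrightarrow> dim_col A = l \<Longrightarrow> A - A = 0\<^sub>m k l"
  by (auto intro!: eq_matI)

text \<open>The rules \<open>mat_dim\<close> associate all products to the right, so an inverse pair
  A B appears in front of a remaining factor C. The cancellation is stated in exactly this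
  shape.\<close>

lemma mult_cancel_dim:
  fixes A B C :: "'a::field mat"
  shows "A * B = 1\<^sub>m k \<Longrightarrow> dim_col A = dim_row B \<Longrightarrow> dim_col B = dim_row C \<Longrightarrow> dim_row C = k \<Longrightarrow>
    A * (B * C) = C"
  by (simp add: one_mult_dim flip: assoc_mult_dim)

section \<open>The isometry group\<close>

text \<open>The symmetry sign of the form: its Gram matrix M satisfies
  \<open>M\<^sup>T = eps G \<cdot>\<^sub>m M\<close>, so -1 means alternating and 1 means symmetric.
  With it the equations for w in the three families become one.\<close>

definition eps :: "family \<Rightarrow> 'a::field" where
  "eps G = (if G = Sp_even then - 1 else 1)"

text \<open>The Gram matrix of the form whose unitriangular isometries make up U. Closure under
  products and inverses is immediate for isometries, but not for the triples (x, v, w).\<close>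

definition form_mat :: "family \<Rightarrow> nat \<Rightarrow> 'a::field mat" where
  "form_mat G n = mat3 n (middle G)
     [[0\<^sub>m n n, 0\<^sub>m n (middle G), antidiag n],
      [0\<^sub>m (middle G) n, 1\<^sub>m (middle G), 0\<^sub>m (middle G) n],
      [eps G \<cdot>\<^sub>m antidiag n, 0\<^sub>m n (middle G), 0\<^sub>m n n]]"

lemma eps_sq [simp]: "eps G * eps G = (1 :: 'a::field)"
  by (simp add: eps_def)

lemma middle_less_2: "middle G < 2"
  by (cases G) (auto simp: middle_def)

lemma antidiag_carrier [simp]: "antidiag n \<in> carrier_mat n n"
  by (simp add: antidiag_def)

lemma antidiag_dim [simp]: "dim_row (antidiag n) = n" "dim_col (antidiag n) = n"
  by (simp_all add: antidiag_def)

lemma antidiag_transpose [simp]: "(antidiag n)\<^sup>T = antidiag n"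
  by (rule eq_matI) (auto simp: antidiag_def add.commute)

lemma mult_antidiag_index:
  fixes A :: "'a::field mat"
  assumes "A \<in> carrier_mat k n" "i < k" "j < n"
  shows "(A * antidiag n) $$ (i, j) = A $$ (i, n - 1 - j)"
proof -
  have "(A * antidiag n) $$ (i, j) = (\<Sum>t<n. A $$ (i, t) * antidiag n $$ (t, j))"
    by (rule index_mult_sum) (use assms in auto)
  also have "\<dots> = (\<Sum>t<n. if t = n - 1 - j then A $$ (i, t) else 0)"
    using assms by (intro sum.cong) (auto simp: antidiag_def)
  finally show ?thesis using assms by simp
qed

lemma antidiag_mult_index:
  fixes A :: "'a::field mat"
  assumes "A \<in> carrier_mat n k" "i < n" "j < k"
  shows "(antidiag n * A) $$ (i, j) = A $$ (n - 1 - i, j)"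
proof -
  have "(antidiag n * A) $$ (i, j) = (\<Sum>t<n. antidiag n $$ (i, t) * A $$ (t, j))"
    by (rule index_mult_sum) (use assms in auto)
  also have "\<dots> = (\<Sum>t<n. if t = n - 1 - i then A $$ (t, j) else 0)"
    using assms by (intro sum.cong) (auto simp: antidiag_def)
  finally show ?thesis using assms by simp
qed

lemma antidiag_square [simp]: "antidiag n * antidiag n = (1\<^sub>m n :: 'a::field mat)"
proof (rule eq_matI)
  fix i j assume "i < dim_row (1\<^sub>m n :: 'a mat)" "j < dim_col (1\<^sub>m n :: 'a mat)"
  then show "(antidiag n * antidiag n) $$ (i, j) = (1\<^sub>m n :: 'a mat) $$ (i, j)"
    by (subst mult_antidiag_index[of _ n]) (auto simp: antidiag_def)
qed auto

lemma mat3_inj: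
  assumes "mat3 n r X = mat3 n r Y" "blocks n r X" "blocks n r Y" "p < 3" "q < 3"
  shows "X ! p ! q = Y ! p ! q"
proof (rule eq_matI)
  have ex: "\<exists>k<2 * n + r. blk n r k = p \<and> off n r k = i" if "i < bsize n r p" "p < 3" for i p
  proof -
    consider "p = 0" | "p = 1" | "p = 2" using \<open>p < 3\<close> by linarith
    then show ?thesis
    proof cases
      case 1 then show ?thesis using that by (intro exI[of _ i]) (auto simp: bsize_def blk_def off_def)
    next
      case 2 then show ?thesis using that by (intro exI[of _ "n + i"]) (auto simp: bsize_def blk_def off_def)
    next
      case 3 then show ?thesis using that by (intro exI[of _ "n + r + i"]) (auto simp: bsize_def blk_def off_def)
    qed
  qed
  fix i j assume "i < dim_row (Y ! p ! q)" "j < dim_col (Y ! p ! q)"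
  then have "i < bsize n r p" "j < bsize n r q"
    using blocksD[OF assms(3-5)] by auto
  then obtain k l where kl: "k < 2 * n + r" "blk n r k = p" "off n r k = i"
    "l < 2 * n + r" "blk n r l = q" "off n r l = j"
    using ex assms(4,5) by metis
  have "mat3 n r X $$ (k, l) = mat3 n r Y $$ (k, l)" using assms by simp
  then show "(X ! p ! q) $$ (i, j) = (Y ! p ! q) $$ (i, j)"
    using kl by (simp add: mat3_def)
qed (use blocksD[OF assms(2,4,5)] blocksD[OF assms(3-5)] in auto)

text \<open>Two different matrices are allowed because the formula is applied not only to
  \<open>x * M * x\<^sup>T\<close>, but also to the pair x z, x and to the pair consisting of a
  conjugate and the identity.\<close>

lemma form_product:
  fixes A :: "'a::field mat"
  assumes "A \<in> carrier_mat n n" "B \<in> carrier_mat n (middle G)" "C \<in> carrier_mat n n"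
    "F \<in> carrier_mat (middle G) n" "H \<in> carrier_mat n n"
    and "A' \<in> carrier_mat n n" "B' \<in> carrier_mat n (middle G)" "C' \<in> carrier_mat n n"
    "F' \<in> carrier_mat (middle G) n" "H' \<in> carrier_mat n n"
  defines "U \<equiv> upper3 n (middle G) A B C F H"
    and "U' \<equiv> upper3 n (middle G) A' B' C' F' H'"
  shows "U * form_mat G n * U'\<^sup>T = mat3 n (middle G)
    [[eps G \<cdot>\<^sub>m (C * antidiag n * A'\<^sup>T) + B * B'\<^sup>T + A * antidiag n * C'\<^sup>T,
      B + A * antidiag n * F'\<^sup>T, A * antidiag n * H'\<^sup>T],
     [eps G \<cdot>\<^sub>m (F * antidiag n * A'\<^sup>T) + B'\<^sup>T, 1\<^sub>m (middle G), 0\<^sub>m (middle G) n],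
     [eps G \<cdot>\<^sub>m (H * antidiag n * A'\<^sup>T), 0\<^sub>m n (middle G), 0\<^sub>m n n]]"
proof -
  let ?X = "[[A', B', C'], [0\<^sub>m (middle G) n, 1\<^sub>m (middle G), F'], [0\<^sub>m n n, 0\<^sub>m n (middle G), H']]"
  let ?J = "antidiag n :: 'a mat"
  have bX: "blocks n (middle G) ?X" using assms by (simp add: blocks_iff)
  have UM: "U * form_mat G n = mat3 n (middle G)
     [[eps G \<cdot>\<^sub>m (C * ?J), B, A * ?J], [eps G \<cdot>\<^sub>m (F * ?J), 1\<^sub>m (middle G), 0\<^sub>m (middle G) n],
      [eps G \<cdot>\<^sub>m (H * ?J), 0\<^sub>m n (middle G), 0\<^sub>m n n]]" (is "_ = mat3 _ _ ?Y")
    unfolding U_def form_mat_def using assms(1-5)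
    by (subst mat3_mult) (auto simp: blocks_iff mult_blocks_eq mult_smult_distrib[of C n n ?J n]
        mult_smult_distrib[of F _ n ?J n] mult_smult_distrib[of H n n ?J n])
  have bY: "blocks n (middle G) ?Y" using assms by (auto simp: blocks_iff)
  have UT: "U'\<^sup>T = mat3 n (middle G) (transpose_blocks ?X)"
    unfolding U'_def by (rule mat3_transpose[OF bX])
  show ?thesis
    unfolding UM UT mat3_mult[OF bY blocks_transpose[OF bX]] using assms(1-10)
    by (intro mat3_cong) (auto simp: transpose_blocks_eq mult_blocks_eq mult_smult_assoc_mat[of _ _ n])
qed

text \<open>For r = 0 the product \<open>v * v\<^sup>T\<close> has an empty inner dimension and is
  therefore 0, so one equation with the sign \<open>eps G\<close> covers all families.\<close>

lemma params_iff:
  "(x, v, w) \<in> params G n \<longleftrightarrow>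
     x \<in> carrier (UT n) \<and> v \<in> carrier_mat n (middle G) \<and> w \<in> carrier_mat n n \<and>
     antidiag n * w\<^sup>T + eps G \<cdot>\<^sub>m (w * antidiag n) = - (v * v\<^sup>T)"
proof -
  have v: "v * v\<^sup>T = 0\<^sub>m n n" if "v \<in> carrier_mat n 0"
    using that by (intro eq_matI) (auto simp: scalar_prod_def)
  have sub: "A - B = A + (- 1) \<cdot>\<^sub>m B" if "dim_row A = dim_row B" "dim_col A = dim_col B" for A B :: "'a mat"
    using that by (intro eq_matI) auto
  have one: "1 \<cdot>\<^sub>m B = B" for B :: "'a mat" by (intro eq_matI) auto
  have z: "- 0\<^sub>m n n = (0\<^sub>m n n :: 'a mat)" by (intro eq_matI) auto
  show ?thesis
    by (cases G) (auto simp: params_def Let_def eps_def middle_def one v z sub)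
qed

definition iso_grp :: "family \<Rightarrow> nat \<Rightarrow> 'a::field mat set" where
  "iso_grp G n = {x \<in> carrier (UT (msize G n)). x * form_mat G n * x\<^sup>T = form_mat G n}"

lemma form_mat_carrier [simp]: "form_mat G n \<in> carrier_mat (msize G n) (msize G n)"
  by (simp add: form_mat_def msize_def)

lemma umat_mat3:
  fixes x :: "'a::{field, finite} mat"
  assumes "x \<in> carrier (UT n)" "v \<in> carrier_mat n (middle G)" "w \<in> carrier_mat n n"
  shows "umat G n (x, v, w) = upper3 n (middle G) x (x * v) (x * w) (- (v\<^sup>T * antidiag n)) (antidiag n * (inv\<^bsub>UT n\<^esub> x)\<^sup>T * antidiag n)"
proof -
  have "inv\<^bsub>UT n\<^esub> x \<in> carrier_mat n n" using UT_inv(1)[OF assms(1)] UT_carrier_mat by blast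
  then show ?thesis
    unfolding umat_def Let_def prod.case using assms UT_carrier_mat[OF assms(1)]
    by (subst block3_mat3) (auto simp: blocks_iff)
qed

text \<open>The upper left block of the product is \<open>x * R * x\<^sup>T\<close>, where R = 0 is
  the equation of the triple with all terms on one side. In the other blocks x cancels against its
  inverse and J against J.\<close>

lemma umat_isometry:
  fixes x :: "'a::{field, finite} mat"
  assumes "(x, v, w) \<in> params G n"
  shows "umat G n (x, v, w) * form_mat G n * (umat G n (x, v, w))\<^sup>T = form_mat G n"
proof -
  let ?r = "middle G" and ?J = "antidiag n :: 'a mat"
  define y where "y = inv\<^bsub>UT n\<^esub> x"
  have xU: "x \<in> carrier (UT n)" and v: "v \<in> carrier_mat n ?r" and w: "w \<in> carrier_mat n n"
    and eq: "?J * w\<^sup>T + eps G \<cdot>\<^sub>m (w * ?J) = - (v * v\<^sup>T)"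
    using assms by (auto simp: params_iff)
  have x: "x \<in> carrier_mat n n" using xU by (rule UT_carrier_mat)
  have y: "y \<in> carrier_mat n n" "x * y = 1\<^sub>m n" "y * x = 1\<^sub>m n"
    using UT_inv[OF xU] UT_carrier_mat by (auto simp: y_def)
  note [simp] = x v w y(1)
  have yx: "y\<^sup>T * x\<^sup>T = 1\<^sub>m n" "x\<^sup>T * y\<^sup>T = 1\<^sub>m n"
    using y by (simp_all flip: transpose_mult[of _ n n _ n])
  note dims [simp] = carrier_matD[OF x] carrier_matD[OF v] carrier_matD[OF w] carrier_matD[OF y(1)]
  note cancel = mult_cancel_dim[OF antidiag_square[of n]] mult_cancel_dim[OF yx(1)]
    mult_cancel_dim[OF yx(2)] mult_cancel_dim[OF y(2)] mult_cancel_dim[OF y(3)]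
  have b00: "eps G \<cdot>\<^sub>m (x * w * ?J * x\<^sup>T) + x * v * (x * v)\<^sup>T +
      x * ?J * (x * w)\<^sup>T = 0\<^sub>m n n"
  proof -
    have "x * (?J * w\<^sup>T + eps G \<cdot>\<^sub>m (w * ?J)) * x\<^sup>T =
        x * (- (v * v\<^sup>T)) * x\<^sup>T"
      by (simp only: eq)
    then have e: "x * (?J * (w\<^sup>T * x\<^sup>T)) + eps G \<cdot>\<^sub>m (x * (w * (?J * x\<^sup>T))) =
        - (x * (v * (v\<^sup>T * x\<^sup>T)))"
      by (simp add: mat_dim)
    have "eps G \<cdot>\<^sub>m (x * w * ?J * x\<^sup>T) + x * v * (x * v)\<^sup>T +
        x * ?J * (x * w)\<^sup>T =
        (x * (?J * (w\<^sup>T * x\<^sup>T)) + eps G \<cdot>\<^sub>m (x * (w * (?J * x\<^sup>T)))) +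
        x * (v * (v\<^sup>T * x\<^sup>T))"
      by (simp add: mat_dim) (intro eq_matI; simp del: index_mult_mat(1))
    then show ?thesis unfolding e by (simp add: mat_dim)
  qed
  have b01: "x * v + x * ?J * (- (v\<^sup>T * ?J))\<^sup>T = 0\<^sub>m n ?r"
    by (simp add: mat_dim cancel)
  have b02: "x * ?J * (?J * y\<^sup>T * ?J)\<^sup>T = ?J"
    by (simp add: mat_dim cancel)
  \<comment> \<open>The sign in this block has to be 1. Either the block has no rows, or the family
    is \<open>O_odd\<close>, where \<open>eps G\<close> is 1.\<close>
  have b10: "eps G \<cdot>\<^sub>m (- (v\<^sup>T * ?J) * ?J * x\<^sup>T) + (x * v)\<^sup>T = 0\<^sub>m ?r n"
  proof (cases "?r = 0")
    case True
    then show ?thesis by (intro eq_matI) auto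
  next
    case False
    then have "eps G = (1 :: 'a)" by (cases G) (auto simp: middle_def eps_def)
    moreover have "1 \<cdot>\<^sub>m B = B" for B :: "'a mat" by (intro eq_matI) auto
    ultimately show ?thesis by (simp add: mat_dim cancel)
  qed
  have b20: "?J * y\<^sup>T * ?J * ?J * x\<^sup>T = ?J"
    by (simp add: mat_dim cancel yx)
  show ?thesis
    unfolding umat_mat3[OF xU v w] y_def[symmetric] form_mat_def[of G n]
    by (subst form_product[unfolded form_mat_def])
      (auto simp only: b00 b01 b02 b10 b20 uminus_carrier_iff_mat intro!: mult_carrier_mat[of _ _ n] x v w y
         antidiag_carrier transpose_carrier_mat[THEN iffD2])
qed

lemma msize_eq: "msize G n = 2 * n + middle G"
  by (simp add: msize_def)

lemma mat3_upper_UT: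
  fixes A :: "'a::field mat"
  assumes "A \<in> carrier (UT n)" "B \<in> carrier_mat n r" "C \<in> carrier_mat n n"
    "F \<in> carrier_mat r n" "H \<in> carrier (UT n)" "r < 2"
  shows "upper3 n r A B C F H \<in> carrier (UT (2 * n + r))"
  using assms by (auto simp: UT_iff mat3_def blk_def off_def numeral_2_eq_2)

lemma antidiag_conj_index:
  fixes A :: "'a::field mat"
  assumes "A \<in> carrier_mat n n" "i < n" "j < n"
  shows "(antidiag n * A * antidiag n) $$ (i, j) = A $$ (n - 1 - i, n - 1 - j)"
proof -
  have "antidiag n * A \<in> carrier_mat n n" using assms by (intro carrier_matI) auto
  then show ?thesis
    using assms mult_antidiag_index[of "antidiag n * A" n n i j] antidiag_mult_index[of A n n i "n - 1 - j"]
    by (simp del: index_mult_mat(1))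
qed

text \<open>\<open>J * A\<^sup>T * J\<close> is the reflection of A in the antidiagonal, which maps
  the upper triangle to itself and the diagonal to itself.\<close>

lemma antidiag_conj_UT:
  fixes A :: "'a::field mat"
  assumes "A \<in> carrier (UT n)"
  shows "antidiag n * A\<^sup>T * antidiag n \<in> carrier (UT n)"
proof -
  have A: "A \<in> carrier_mat n n" using assms by (rule UT_carrier_mat)
  have e: "(antidiag n * A\<^sup>T * antidiag n) $$ (i, j) = A $$ (n - 1 - j, n - 1 - i)"
    if "i < n" "j < n" for i j
    using antidiag_conj_index[of "A\<^sup>T" n i j] A that by auto
  show ?thesis using assms A by (auto simp: UT_iff e simp del: index_mult_mat(1))
qed

lemma umat_in_iso_grp:
  fixes x :: "'a::{field, finite} mat"
  assumes "(x, v, w) \<in> params G n"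
  shows "umat G n (x, v, w) \<in> iso_grp G n"
proof -
  have p: "x \<in> carrier (UT n)" "v \<in> carrier_mat n (middle G)" "w \<in> carrier_mat n n"
    using assms by (auto simp: params_iff)
  note x = UT_carrier_mat[OF p(1)]
  have "umat G n (x, v, w) \<in> carrier (UT (msize G n))"
    unfolding umat_mat3[OF p] msize_eq
    by (intro mat3_upper_UT p antidiag_conj_UT UT_inv middle_less_2) (use x p in auto)
  then show ?thesis using umat_isometry[OF assms] by (simp add: iso_grp_def)
qed

text \<open>As r < 2, the middle diagonal block is empty or the single entry 1, which is why it
  appears as an identity matrix.\<close>

lemma UT_mat3:
  fixes x :: "'a::field mat"
  assumes "x \<in> carrier (UT (2 * n + r))" "r < 2"
  obtains A B C F H where "A \<in> carrier (UT n)" "B \<in> carrier_mat n r" "C \<in> carrier_mat n n"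
    "F \<in> carrier_mat r n" "H \<in> carrier (UT n)"
    "x = upper3 n r A B C F H"
proof
  let ?A = "mat n n (\<lambda>(i, j). x $$ (i, j))" and ?B = "mat n r (\<lambda>(i, j). x $$ (i, n + j))"
    and ?C = "mat n n (\<lambda>(i, j). x $$ (i, n + r + j))" and ?F = "mat r n (\<lambda>(i, j). x $$ (n + i, n + r + j))"
    and ?H = "mat n n (\<lambda>(i, j). x $$ (n + r + i, n + r + j))"
  show "?A \<in> carrier (UT n)" "?H \<in> carrier (UT n)" using assms by (auto simp: UT_iff)
  show "x = upper3 n r ?A ?B ?C ?F ?H"
  proof (rule eq_matI)
    fix i j assume "i < dim_row (upper3 n r ?A ?B ?C ?F ?H)"
      "j < dim_col (upper3 n r ?A ?B ?C ?F ?H)"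
    then have ij: "i < 2 * n + r" "j < 2 * n + r" by (auto simp: mat3_def)
    consider "r = 0" | "r = 1" using assms(2) by linarith
    then show "x $$ (i, j) = upper3 n r ?A ?B ?C ?F ?H $$ (i, j)"
      using ij assms by cases (auto simp: mat3_def blk_def off_def numeral_2_eq_2 UT_iff less_Suc_eq)
  qed (use assms in \<open>auto simp: UT_iff mat3_def\<close>)
qed auto

text \<open>Put v = y B and w = y C with y the inverse of the upper left block A. The blocks (0,1)
  and (0,2) of the isometry equation then determine \<open>F\<close> and \<open>H\<close>, and the
  block (0,0), multiplied by y on the left and \<open>y\<^sup>T\<close> on the right, becomes the
  equation for the triple.\<close>

lemma iso_grp_umat:
  fixes x :: "'a::{field, finite} mat"
  assumes "x \<in> iso_grp G n"
  obtains A v w where "(A, v, w) \<in> params G n" "x = umat G n (A, v, w)"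
proof -
  let ?r = "middle G" and ?J = "antidiag n :: 'a mat"
  have xU: "x \<in> carrier (UT (2 * n + ?r))" and xM: "x * form_mat G n * x\<^sup>T = form_mat G n"
    using assms by (auto simp: iso_grp_def msize_eq)
  obtain A B C F H where U: "A \<in> carrier (UT n)" "H \<in> carrier (UT n)" and
    c: "B \<in> carrier_mat n ?r" "C \<in> carrier_mat n n" "F \<in> carrier_mat ?r n" and
    xeq: "x = upper3 n ?r A B C F H"
    using UT_mat3[OF xU middle_less_2] by metis
  have A: "A \<in> carrier_mat n n" and H: "H \<in> carrier_mat n n" using U UT_carrier_mat by auto
  define y where "y = inv\<^bsub>UT n\<^esub> A"
  have y: "y \<in> carrier_mat n n" "A * y = 1\<^sub>m n" "y * A = 1\<^sub>m n"
    using UT_inv[OF U(1)] UT_carrier_mat by (auto simp: y_def)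
  have yx: "y\<^sup>T * A\<^sup>T = 1\<^sub>m n" "A\<^sup>T * y\<^sup>T = 1\<^sub>m n"
    using y A by (simp_all flip: transpose_mult[of _ n n _ n])
  note dims [simp] = carrier_matD[OF A] carrier_matD[OF H] carrier_matD[OF y(1)] carrier_matD[OF c(1)]
    carrier_matD[OF c(2)] carrier_matD[OF c(3)]
  note cancel = mult_cancel_dim[OF antidiag_square[of n]] mult_cancel_dim[OF yx(1)]
    mult_cancel_dim[OF yx(2)] mult_cancel_dim[OF y(2)] mult_cancel_dim[OF y(3)]
  let ?L = "[[eps G \<cdot>\<^sub>m (C * ?J * A\<^sup>T) + B * B\<^sup>T + A * ?J * C\<^sup>T,
      B + A * ?J * F\<^sup>T, A * ?J * H\<^sup>T],
     [eps G \<cdot>\<^sub>m (F * ?J * A\<^sup>T) + B\<^sup>T, 1\<^sub>m ?r, 0\<^sub>m ?r n],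
     [eps G \<cdot>\<^sub>m (H * ?J * A\<^sup>T), 0\<^sub>m n ?r, 0\<^sub>m n n]]"
  let ?R = "[[0\<^sub>m n n, 0\<^sub>m n ?r, ?J], [0\<^sub>m ?r n, 1\<^sub>m ?r, 0\<^sub>m ?r n], [eps G \<cdot>\<^sub>m ?J, 0\<^sub>m n ?r, 0\<^sub>m n n]]"
  have eq: "mat3 n ?r ?L = mat3 n ?r ?R"
    using xM unfolding xeq form_product[OF A c H A c H] by (simp add: form_mat_def)
  have bl: "blocks n ?r ?L" "blocks n ?r ?R" unfolding blocks_iff by (auto intro!: carrier_matI)
  have e00: "eps G \<cdot>\<^sub>m (C * ?J * A\<^sup>T) + B * B\<^sup>T + A * ?J * C\<^sup>T = 0\<^sub>m n n"
    and e01: "B + A * ?J * F\<^sup>T = 0\<^sub>m n ?r" and e02: "A * ?J * H\<^sup>T = ?J"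
    using mat3_inj[OF eq bl, of 0 0] mat3_inj[OF eq bl, of 0 1] mat3_inj[OF eq bl, of 0 2]
    by (auto simp: numeral_2_eq_2)
  define v where "v = y * B"
  define w where "w = y * C"
  have [simp]: "dim_row v = n" "dim_col v = ?r" "dim_row w = n" "dim_col w = n" by (auto simp: v_def w_def)
  have B: "A * v = B" and C: "A * w = C" by (simp_all add: v_def w_def cancel)
  have "y * (eps G \<cdot>\<^sub>m (C * ?J * A\<^sup>T) + B * B\<^sup>T + A * ?J * C\<^sup>T) *
      y\<^sup>T = y * 0\<^sub>m n n * y\<^sup>T"
    by (simp only: e00)
  then have s0: "eps G \<cdot>\<^sub>m (w * ?J) + v * v\<^sup>T + ?J * w\<^sup>T = 0\<^sub>m n n"
    by (simp add: mat_dim cancel yx v_def w_def)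
  have "(eps G \<cdot>\<^sub>m (w * ?J) + v * v\<^sup>T + ?J * w\<^sup>T) + - (v * v\<^sup>T) =
      ?J * w\<^sup>T + eps G \<cdot>\<^sub>m (w * ?J)"
    by (intro eq_matI) (simp_all del: index_mult_mat(1))
  then have par: "(A, v, w) \<in> params G n"
    unfolding s0 params_iff using U by (auto simp: add_zero_dim)
  have "(?J * y * (B + A * ?J * F\<^sup>T))\<^sup>T = (?J * y * 0\<^sub>m n ?r)\<^sup>T"
    by (simp only: e01)
  then have "v\<^sup>T * ?J + F = 0\<^sub>m ?r n"
    by (simp add: mat_dim cancel v_def)
  then have "- (v\<^sup>T * ?J) + (v\<^sup>T * ?J + F) = - (v\<^sup>T * ?J) + 0\<^sub>m ?r n"
    by simp
  moreover have "- (v\<^sup>T * ?J) + (v\<^sup>T * ?J + F) = F"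
    by (intro eq_matI) (simp_all del: index_mult_mat(1))
  ultimately have F: "F = - (v\<^sup>T * ?J)"
    by (simp add: mat_dim)
  have "(?J * y * (A * ?J * H\<^sup>T))\<^sup>T = (?J * y * ?J)\<^sup>T"
    by (simp only: e02)
  then have H': "H = ?J * y\<^sup>T * ?J"
    by (simp add: mat_dim cancel)
  have "x = umat G n (A, v, w)"
    unfolding xeq by (subst umat_mat3) (use U in \<open>auto simp: B C F H' y_def intro!: carrier_matI\<close>)
  with par show ?thesis using that by blast
qed

lemma carrier_Ugrp:
  "carrier (Ugrp G n :: 'a::{field, finite} mat monoid) = iso_grp G n"
proof -
  have "umat G n ` params G n = (iso_grp G n :: 'a mat set)"
    using umat_in_iso_grp by (fastforce elim: iso_grp_umat)
  then show ?thesis by (simp add: Ugrp_def)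
qed

lemma Ugrp_mult [simp]: "x \<otimes>\<^bsub>Ugrp G n\<^esub> y = x * y"
  by (simp add: Ugrp_def UT_def)

lemma Ugrp_one [simp]: "\<one>\<^bsub>Ugrp G n\<^esub> = 1\<^sub>m (msize G n)"
  by (simp add: Ugrp_def UT_def)

lemma iso_grp_UT: "x \<in> iso_grp G n \<Longrightarrow> x \<in> carrier (UT (msize G n))"
  by (simp add: iso_grp_def)

lemma iso_grp_carrier_mat: "x \<in> iso_grp G n \<Longrightarrow> x \<in> carrier_mat (msize G n) (msize G n)"
  using iso_grp_UT UT_carrier_mat by blast

lemma iso_grp_mult:
  fixes x y :: "'a::field mat"
  assumes "x \<in> iso_grp G n" "y \<in> iso_grp G n"
  shows "x * y \<in> iso_grp G n"
proof -
  note [simp] = carrier_matD[OF iso_grp_carrier_mat[OF assms(1)]]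
    carrier_matD[OF iso_grp_carrier_mat[OF assms(2)]] carrier_matD[OF form_mat_carrier[of G n]]
  have "x * y * form_mat G n * (x * y)\<^sup>T =
      x * (y * form_mat G n * y\<^sup>T) * x\<^sup>T"
    by (simp add: mat_dim)
  also have "\<dots> = form_mat G n" using assms by (simp add: iso_grp_def)
  finally show ?thesis using assms UT_mult_closed by (auto simp: iso_grp_def)
qed

lemma iso_grp_inverse:
  fixes x :: "'a::{field, finite} mat"
  assumes "x \<in> iso_grp G n"
  obtains y where "y \<in> iso_grp G n" "x * y = 1\<^sub>m (msize G n)" "y * x = 1\<^sub>m (msize G n)"
proof -
  obtain y where y: "y \<in> carrier (UT (msize G n))" "x * y = 1\<^sub>m (msize G n)" "y * x = 1\<^sub>m (msize G n)"
    using UT_inverse[OF iso_grp_UT[OF assms]] .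
  note [simp] = carrier_matD[OF iso_grp_carrier_mat[OF assms]]
    carrier_matD[OF UT_carrier_mat[OF y(1)]] carrier_matD[OF form_mat_carrier[of G n]]
  have xy: "x\<^sup>T * y\<^sup>T = 1\<^sub>m (msize G n)"
    using arg_cong[OF y(3), of transpose_mat] by (simp add: mat_dim)
  have "y * form_mat G n * y\<^sup>T = y * (x * form_mat G n * x\<^sup>T) * y\<^sup>T"
    using assms by (simp add: iso_grp_def)
  also have "\<dots> = form_mat G n"
    by (simp add: mat_dim xy mult_cancel_dim[OF y(3)])
  finally show ?thesis using that y by (simp add: iso_grp_def)
qed

lemma one_in_iso_grp: "1\<^sub>m (msize G n) \<in> iso_grp G n"
  by (simp add: iso_grp_def UT_one_closed mat_dim carrier_matD[OF form_mat_carrier])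

lemma Ugrp_group: "group (Ugrp G n :: 'a::{field, finite} mat monoid)"
proof (rule groupI)
  fix x y z :: "'a mat"
  assume "x \<in> carrier (Ugrp G n)" "y \<in> carrier (Ugrp G n)" "z \<in> carrier (Ugrp G n)"
  then show "x \<otimes>\<^bsub>Ugrp G n\<^esub> y \<otimes>\<^bsub>Ugrp G n\<^esub> z = x \<otimes>\<^bsub>Ugrp G n\<^esub> (y \<otimes>\<^bsub>Ugrp G n\<^esub> z)"
    by (simp add: carrier_Ugrp assoc_mult_dim carrier_matD[OF iso_grp_carrier_mat])
next
  fix x :: "'a mat" assume x: "x \<in> carrier (Ugrp G n)"
  then show "\<exists>y\<in>carrier (Ugrp G n). y \<otimes>\<^bsub>Ugrp G n\<^esub> x = \<one>\<^bsub>Ugrp G n\<^esub>"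
    using iso_grp_inverse[of x G n] by (auto simp: carrier_Ugrp)
  show "\<one>\<^bsub>Ugrp G n\<^esub> \<otimes>\<^bsub>Ugrp G n\<^esub> x = x"
    using x by (simp add: carrier_Ugrp one_mult_dim carrier_matD[OF iso_grp_carrier_mat])
qed (auto simp: carrier_Ugrp iso_grp_mult one_in_iso_grp)

lemma Ugrp_inv:
  fixes x :: "'a::{field, finite} mat"
  assumes "x \<in> iso_grp G n"
  shows "inv\<^bsub>Ugrp G n\<^esub> x \<in> iso_grp G n" "x * inv\<^bsub>Ugrp G n\<^esub> x = 1\<^sub>m (msize G n)"
    "inv\<^bsub>Ugrp G n\<^esub> x * x = 1\<^sub>m (msize G n)"
proof -
  interpret group "Ugrp G n :: 'a mat monoid" by (rule Ugrp_group)
  have x: "x \<in> carrier (Ugrp G n)" using assms by (simp add: carrier_Ugrp)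
  show "inv\<^bsub>Ugrp G n\<^esub> x \<in> iso_grp G n" using inv_closed[OF x] by (simp add: carrier_Ugrp)
  show "x * inv\<^bsub>Ugrp G n\<^esub> x = 1\<^sub>m (msize G n)" using r_inv[OF x] by simp
  show "inv\<^bsub>Ugrp G n\<^esub> x * x = 1\<^sub>m (msize G n)" using l_inv[OF x] by simp
qed

lemma finite_iso_grp: "finite (iso_grp G n :: 'a::{field, finite} mat set)"
  by (rule finite_subset[OF _ finite_UT[of "msize G n"]]) (auto simp: iso_grp_def)

section \<open>Elementary characters as averages\<close>

text \<open>Right multiplication by u carries the fibre through the identity bijectively onto the
  fibre through u, so all fibres have the same size. Thus p sends the uniform distribution on the
  group to the uniform distribution on its image.\<close>

lemma sum_over_fibres:
  fixes K :: "('g, 'b) monoid_scheme" and f :: "'y \<Rightarrow> complex"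
  assumes "group K" "finite (carrier K)"
    and equivariant: "\<And>x x' u. x \<in> carrier K \<Longrightarrow> x' \<in> carrier K \<Longrightarrow> u \<in> carrier K \<Longrightarrow> p x = p x' \<Longrightarrow>
      p (x \<otimes>\<^bsub>K\<^esub> u) = p (x' \<otimes>\<^bsub>K\<^esub> u)"
  shows "(\<Sum>x\<in>carrier K. f (p x)) / of_nat (card (carrier K)) =
    (\<Sum>y\<in>p ` carrier K. f y) / of_nat (card (p ` carrier K))"
proof -
  interpret group K by fact
  define c where "c = card {x \<in> carrier K. p x = p \<one>\<^bsub>K\<^esub>}"
  have fibre: "card {x \<in> carrier K. p x = y} = c" if y: "y \<in> p ` carrier K" for y
  proof -
    obtain u where u: "u \<in> carrier K" "y = p u" using y by blast
    have "bij_betw (\<lambda>x. x \<otimes>\<^bsub>K\<^esub> u) {x \<in> carrier K. p x = p \<one>\<^bsub>K\<^esub>} {x \<in> carrier K. p x = y}"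
    proof (rule bij_betwI[where g = "\<lambda>x. x \<otimes>\<^bsub>K\<^esub> inv\<^bsub>K\<^esub> u"])
      show "(\<lambda>x. x \<otimes>\<^bsub>K\<^esub> u) \<in> {x \<in> carrier K. p x = p \<one>\<^bsub>K\<^esub>} \<rightarrow> {x \<in> carrier K. p x = y}"
        using equivariant[of _ "\<one>\<^bsub>K\<^esub>" u] u by auto
      show "(\<lambda>x. x \<otimes>\<^bsub>K\<^esub> inv\<^bsub>K\<^esub> u) \<in> {x \<in> carrier K. p x = y} \<rightarrow> {x \<in> carrier K. p x = p \<one>\<^bsub>K\<^esub>}"
        using equivariant[of _ u "inv\<^bsub>K\<^esub> u"] u by auto
    qed (use u in \<open>auto simp: m_assoc\<close>)
    then show ?thesis unfolding c_def by (rule bij_betw_same_card[symmetric])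
  qed
  have fin: "finite (p ` carrier K)" using assms by simp
  have "(\<Sum>x\<in>carrier K. f (p x)) = (\<Sum>y\<in>p ` carrier K. \<Sum>x\<in>{x \<in> carrier K. p x = y}. f (p x))"
    using sum.image_gen[OF assms(2), of "\<lambda>x. f (p x)" p] .
  also have "\<dots> = (\<Sum>y\<in>p ` carrier K. of_nat c * f y)"
    by (rule sum.cong) (simp_all add: fibre)
  finally have 1: "(\<Sum>x\<in>carrier K. f (p x)) = of_nat c * (\<Sum>y\<in>p ` carrier K. f y)"
    by (simp add: sum_distrib_left)
  have "card (carrier K) = (\<Sum>y\<in>p ` carrier K. \<Sum>x\<in>{x \<in> carrier K. p x = y}. 1)"
    using sum.image_gen[OF assms(2), of "\<lambda>x. 1 :: nat" p] by simp
  then have 2: "card (carrier K) = c * card (p ` carrier K)"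
    by (simp add: fibre)
  have "card (carrier K) \<noteq> 0" using assms(2) one_closed by auto
  then show ?thesis using 1 2 by simp
qed

lemma place_less: "k \<in> Idx G n \<Longrightarrow> place G n k < msize G n"
  by (cases G) (auto simp: Idx_def place_def msize_def middle_def)

lemma place_eq_iff: "k \<in> Idx G n \<Longrightarrow> l \<in> Idx G n \<Longrightarrow> place G n k = place G n l \<longleftrightarrow> k = l"
  by (cases G) (auto simp: Idx_def place_def msize_def middle_def)

lemma entry_one:
  assumes "k \<in> Idx G n" "l \<in> Idx G n" "k \<noteq> l"
  shows "entry G n (1\<^sub>m (msize G n)) k l = 0"
  using assms place_less[of k G n] place_less[of l G n] by (simp add: entry_def place_eq_iff)

lemma one_in_root_subgroup:
  assumes "\<alpha> \<in> Roots G n"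
  shows "1\<^sub>m (msize G n) \<in> (root_subgroup G n \<alpha> :: 'a::{field, finite} mat set)"
  using assms
  by (cases \<alpha>) (auto simp: Roots_def carrier_Ugrp one_in_iso_grp prec_def preceq_def Idx_def
      split: family.splits if_splits intro!: entry_one)

lemma pos_entry_simps:
  "1 \<le> i \<Longrightarrow> i < j \<Longrightarrow> j \<le> int n \<Longrightarrow> pos_entry n (Minus i j) = (i, j)"
  "1 \<le> i \<Longrightarrow> i < j \<Longrightarrow> j \<le> int n \<Longrightarrow> pos_entry n (Plus i j) = (i, - j)"
  "1 \<le> i \<Longrightarrow> i \<le> int n \<Longrightarrow> pos_entry n (Twice i) = (i, - i)"
  "1 \<le> i \<Longrightarrow> i \<le> int n \<Longrightarrow> pos_entry n (Single i) = (i, 0)"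
  unfolding pos_entry_def
  by (rule the_equality; auto simp: prec_def preceq_def)+

lemma root_char_one:
  assumes "\<alpha> \<in> Roots G n" "\<theta> 0 = 1"
  shows "root_char \<theta> G n \<alpha> r (1\<^sub>m (msize G n) :: 'a::{field, finite} mat) = 1"
  using assms
  by (cases \<alpha>)
    (auto simp: root_char_def pos_entry_simps Roots_def entry_one Idx_def split: family.splits)

definition conj_char ::
  "('a::field \<Rightarrow> complex) \<Rightarrow> family \<Rightarrow> nat \<Rightarrow> root \<Rightarrow> 'a \<Rightarrow> 'a mat \<Rightarrow> 'a mat \<Rightarrow> complex" where
  "conj_char \<theta> G n \<alpha> r z x =
    (if x * z * inv\<^bsub>Ugrp G n\<^esub> x \<in> root_subgroup G n \<alpha>
     then root_char \<theta> G n \<alpha> r (x * z * inv\<^bsub>Ugrp G n\<^esub> x) else 0)"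

text \<open>At the identity every summand is 1, so the degree is the index of the root subgroup in
  U. Dividing by it turns the induced character into a mean over the whole group.\<close>

lemma elem_char_average:
  fixes \<theta> :: "'a::{field, finite} \<Rightarrow> complex"
  assumes "\<alpha> \<in> Roots G n" "\<theta> 0 = 1"
  shows "elem_char \<theta> G n \<alpha> r z = elem_char \<theta> G n \<alpha> r (1\<^sub>m (msize G n)) *
    ((\<Sum>x\<in>iso_grp G n. conj_char \<theta> G n \<alpha> r z x) / of_nat (card (iso_grp G n :: 'a mat set)))"
proof -
  have "conj_char \<theta> G n \<alpha> r (1\<^sub>m (msize G n)) x = 1" if x: "x \<in> iso_grp G n" for x
    using Ugrp_inv[OF x] one_in_root_subgroup[OF assms(1)] root_char_one[of \<alpha> G n \<theta> r, OF assms]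
    by (simp add: conj_char_def one_mult_dim carrier_matD[OF iso_grp_carrier_mat[OF x]])
  moreover have elem: "elem_char \<theta> G n \<alpha> r g =
      (\<Sum>x\<in>iso_grp G n. conj_char \<theta> G n \<alpha> r g x) / of_nat (card (root_subgroup G n \<alpha> :: 'a mat set))" for g
    unfolding elem_char_def induced_char_def carrier_Ugrp Ugrp_mult conj_char_def ..
  ultimately have one: "elem_char \<theta> G n \<alpha> r (1\<^sub>m (msize G n)) =
      of_nat (card (iso_grp G n :: 'a mat set)) / of_nat (card (root_subgroup G n \<alpha> :: 'a mat set))"
    by simp
  have "card (iso_grp G n :: 'a mat set) \<noteq> 0"
    using finite_iso_grp one_in_iso_grp by (metis card_0_eq empty_iff)
  then show ?thesis unfolding one elem[of z] by simp
qed

section \<open>Equidistribution of the free entries of the first n rows\<close>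

definition top_labels :: "family \<Rightarrow> nat \<Rightarrow> int set" where
  "top_labels G n = {l \<in> Idx G n. 0 \<le> l}"

definition coords :: "family \<Rightarrow> nat \<Rightarrow> (int \<times> int) set" where
  "coords G n = {1..int n} \<times> top_labels G n"

text \<open>The diagonal entries and those left of it are kept as coordinates with a single possible
  value. Every entry of the rows is then a random variable, and sums over roots need no case
  distinction on its position.\<close>

definition range_of :: "int \<times> int \<Rightarrow> 'a::field set" where
  "range_of c = (if fst c = snd c then {1} else if fst c \<prec> snd c then UNIV else {0})"

text \<open>The part of the first \<open>n\<close> rows that can be prescribed freely within the ranges \<open>range_of\<close>: the block \<open>w\<close> only
  has to solve an equation depending on \<open>v\<close>.\<close>

definition top_rows :: "family \<Rightarrow> nat \<Rightarrow> 'a mat \<Rightarrow> int \<times> int \<Rightarrow> 'a" where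
  "top_rows G n x = restrict (\<lambda>(k, l). entry G n x k l) (coords G n)"

lemma place_pos: "1 \<le> k \<Longrightarrow> place G n k = nat k - 1"
  by (simp add: place_def)

lemma place_zero: "place G n 0 = n"
  by (simp add: place_def)

lemma top_labels_iff: "l \<in> top_labels G n \<longleftrightarrow> 1 \<le> l \<and> l \<le> int n \<or> l = 0 \<and> G = O_odd"
  by (auto simp: top_labels_def Idx_def)

lemma finite_coords: "finite (coords G n)"
proof -
  have "top_labels G n \<subseteq> {0..int n}" by (auto simp: top_labels_iff)
  then show ?thesis unfolding coords_def by (meson finite_SigmaI finite_atLeastAtMost_int finite_subset)
qed

lemma place_top: "l \<in> top_labels G n \<Longrightarrow> place G n l < n + middle G"
  by (auto simp: top_labels_iff place_pos place_zero middle_def)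

text \<open>The columns of x u up to place n + r - 1 are combinations of the same columns of x,
  since u is upper triangular. This is the equivariance required by
  \<open>sum_over_fibres\<close>.\<close>

lemma top_rows_mult:
  fixes x x' u :: "'a::{field, finite} mat"
  assumes "x \<in> iso_grp G n" "x' \<in> iso_grp G n" "u \<in> iso_grp G n" "top_rows G n x = top_rows G n x'"
  shows "top_rows G n (x * u) = top_rows G n (x' * u)"
proof -
  have m: "n + middle G \<le> msize G n" by (simp add: msize_def)
  have same: "x $$ (k, t) = x' $$ (k, t)" if "k < n" "t < n + middle G" for k t
  proof -
    \<comment> \<open>Places count from 0: a place t < n carries the label t + 1, and place n,
      present only for \<open>O_odd\<close>, carries the label 0.\<close>
    define l where "l = (if t < n then int t + 1 else 0)"
    have "(int k + 1, l) \<in> coords G n"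
      using that by (cases G) (auto simp: coords_def top_labels_iff l_def middle_def)
    moreover have "place G n l = t" using that by (cases G) (auto simp: l_def place_def middle_def)
    ultimately show ?thesis
      using fun_cong[OF assms(4), of "(int k + 1, l)"] that
      by (simp add: top_rows_def entry_def place_pos nat_add_distrib)
  qed
  have "(x * u) $$ (k, l) = (x' * u) $$ (k, l)" if "k < n" "l < n + middle G" for k l
  proof -
    have "(x * u) $$ (k, l) = (\<Sum>t<msize G n. x $$ (k, t) * u $$ (t, l))"
      using that m by (intro index_mult_sum[OF iso_grp_carrier_mat[OF assms(1)] iso_grp_carrier_mat[OF assms(3)]]) auto
    also have "\<dots> = (\<Sum>t<msize G n. x' $$ (k, t) * u $$ (t, l))"
    proof (rule sum.cong[OF refl])
      fix t assume "t \<in> {..<msize G n}"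
      then show "x $$ (k, t) * u $$ (t, l) = x' $$ (k, t) * u $$ (t, l)"
        using same[of k t] that iso_grp_UT[OF assms(3)] by (cases "t \<le> l") (auto simp: UT_iff)
    qed
    also have "\<dots> = (x' * u) $$ (k, l)"
      using that m
      by (intro index_mult_sum[OF iso_grp_carrier_mat[OF assms(2)] iso_grp_carrier_mat[OF assms(3)], symmetric]) auto
    finally show ?thesis .
  qed
  then show ?thesis unfolding top_rows_def
    by (intro restrict_ext) (auto simp: coords_def entry_def place_top place_pos)
qed

lemma top_rows_in:
  assumes "x \<in> iso_grp G n"
  shows "top_rows G n x \<in> PiE (coords G n) range_of"
proof -
  have "entry G n x k l \<in> range_of (k, l)" if "1 \<le> k" "k \<le> int n" "l \<in> top_labels G n" for k l
    using that iso_grp_UT[OF assms] place_top[OF that(3)]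
    by (auto simp: range_of_def entry_def place_pos place_zero UT_iff prec_def top_labels_iff msize_def)
  then show ?thesis by (auto simp: top_rows_def coords_def)
qed

text \<open>The matrix \<open>- (1 / 2) \<cdot>\<^sub>m (v * v\<^sup>T * J)\<close> is a particular
  solution of the inhomogeneous equation for w, to which a solution W of the homogeneous equation is
  added. With W = 0 it proves solvability for every v; with the upper right block of
  \<open>e_pair\<close> as W it yields the representative.\<close>

lemma half_relation:
  fixes v :: "'a::{field, finite} mat"
  assumes "v \<in> carrier_mat n (middle G)" "(2 :: 'a) \<noteq> 0" "W \<in> carrier_mat n n"
    "antidiag n * W\<^sup>T + eps G \<cdot>\<^sub>m (W * antidiag n) = 0\<^sub>m n n"
  shows "antidiag n * (W - (1 / 2) \<cdot>\<^sub>m (v * v\<^sup>T * antidiag n))\<^sup>T +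
    eps G \<cdot>\<^sub>m ((W - (1 / 2) \<cdot>\<^sub>m (v * v\<^sup>T * antidiag n)) * antidiag n) = - (v * v\<^sup>T)"
proof -
  let ?J = "antidiag n :: 'a mat" and ?V = "v * v\<^sup>T"
  note [simp] = carrier_matD[OF assms(1)] carrier_matD[OF assms(3)]
  note cancel = mult_cancel_dim[OF antidiag_square[of n]]
  have e: "eps G \<cdot>\<^sub>m ?V = ?V"
  proof (cases "middle G = 0")
    case True
    then show ?thesis by (intro eq_matI) (auto simp: scalar_prod_def)
  next
    case False
    then show ?thesis by (intro eq_matI) (cases G; auto simp: eps_def middle_def)+
  qed
  have "?J * (W - (1 / 2) \<cdot>\<^sub>m (?V * ?J))\<^sup>T + eps G \<cdot>\<^sub>m ((W - (1 / 2) \<cdot>\<^sub>m (?V * ?J)) * ?J) =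
      (?J * W\<^sup>T - (1 / 2) \<cdot>\<^sub>m ?V) + eps G \<cdot>\<^sub>m (W * ?J - (1 / 2) \<cdot>\<^sub>m ?V)"
    by (simp add: mat_dim cancel)
  also have "\<dots> = (?J * W\<^sup>T + eps G \<cdot>\<^sub>m (W * ?J)) - ((1 / 2) \<cdot>\<^sub>m ?V + (1 / 2) \<cdot>\<^sub>m (eps G \<cdot>\<^sub>m ?V))"
    by (intro eq_matI) (simp_all add: algebra_simps del: index_mult_mat(1))
  also have "\<dots> = - ?V"
  proof -
    have "c / 2 + c / 2 = c" for c :: 'a
      using assms(2) by (metis add_divide_distrib mult_2 nonzero_mult_div_cancel_left)
    then show ?thesis unfolding assms(4) e
      by (intro eq_matI) (simp_all del: index_mult_mat(1))
  qed
  finally show ?thesis .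
qed

text \<open>The values y prescribe the blocks A and B = A v, hence A and v. The block w is then
  chosen as the particular solution from \<open>half_relation\<close>, so nothing obstructs the
  choice of y.\<close>

lemma top_rows_onto:
  fixes y :: "int \<times> int \<Rightarrow> 'a::{field, finite}"
  assumes y: "y \<in> PiE (coords G n) range_of" and two: "(2 :: 'a) \<noteq> 0"
  obtains x where "x \<in> iso_grp G n" "top_rows G n x = y"
proof -
  let ?r = "middle G"
  define A where "A = mat n n (\<lambda>(i, j). y (int i + 1, int j + 1))"
  define B where "B = mat n ?r (\<lambda>(i, j). y (int i + 1, 0))"
  have yA: "y (int i + 1, int j + 1) \<in> range_of (int i + 1, int j + 1)" if "i < n" "j < n" for i j
    using that by (intro PiE_mem[OF y]) (auto simp: coords_def top_labels_iff)
  have A: "A \<in> carrier (UT n)"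
    unfolding UT_iff
  proof (intro conjI allI impI)
    fix i j assume "i < n" "j < i"
    then show "A $$ (i, j) = 0" using yA[of i j] by (auto simp: A_def range_of_def prec_def)
  next
    fix i assume "i < n"
    then show "A $$ (i, i) = 1" using yA[of i i] by (auto simp: A_def range_of_def)
  qed (simp add: A_def)
  define u where "u = inv\<^bsub>UT n\<^esub> A"
  have u: "u \<in> carrier_mat n n" "A * u = 1\<^sub>m n" using UT_inv[OF A] UT_carrier_mat by (auto simp: u_def)
  define v where "v = u * B"
  have v: "v \<in> carrier_mat n ?r" using u by (auto simp: v_def B_def)
  have B: "B = A * v" unfolding v_def using u
    by (subst mult_cancel_dim[OF u(2)]) (auto simp: A_def B_def)
  define w where "w = 0\<^sub>m n n - (1 / 2) \<cdot>\<^sub>m (v * v\<^sup>T * antidiag n)"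
  have w: "w \<in> carrier_mat n n" using v by (auto simp: w_def)
  have "(A, v, w) \<in> params G n"
    unfolding params_iff
  proof (intro conjI A v w)
    show "antidiag n * w\<^sup>T + eps G \<cdot>\<^sub>m (w * antidiag n) = - (v * v\<^sup>T)"
      unfolding w_def by (rule half_relation[OF v two]) (auto simp: mat_dim intro!: eq_matI)
  qed
  then have x: "umat G n (A, v, w) \<in> iso_grp G n" by (rule umat_in_iso_grp)
  have "top_rows G n (umat G n (A, v, w)) = y"
  proof (rule PiE_ext[OF top_rows_in[OF x] y])
    fix c assume "c \<in> coords G n"
    then obtain k l where c: "c = (k, l)" "1 \<le> k" "k \<le> int n" "l \<in> top_labels G n"
      by (auto simp: coords_def)
    define i where "i = nat k - 1"
    have i: "k = int i + 1" "i < n" using c by (auto simp: i_def)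
    show "top_rows G n (umat G n (A, v, w)) c = y c"
    proof (cases "l = 0")
      case True
      then have r: "?r = 1" using c by (auto simp: top_labels_iff middle_def)
      show ?thesis
        using \<open>c \<in> coords G n\<close> True i r
        unfolding c(1) top_rows_def entry_def umat_mat3[OF A v w] B[symmetric]
        by (simp add: place_pos place_zero nat_add_distrib mat3_def blk_def off_def B_def)
    next
      case False
      then have l: "1 \<le> l" "l \<le> int n" using c by (auto simp: top_labels_iff)
      define j where "j = nat l - 1"
      have j: "l = int j + 1" "j < n" using l by (auto simp: j_def)
      show ?thesis
        using \<open>c \<in> coords G n\<close> i j
        unfolding c(1) top_rows_def entry_def umat_mat3[OF A v w] B[symmetric]
        by (simp add: place_pos nat_add_distrib mat3_def blk_def off_def A_def)
    qed
  qed
  with x show ?thesis using that by blast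
qed

text \<open>\<open>top_rows\<close> has fibres of equal size and maps onto the full product. This
  turns the group average into an expectation over independent entries.\<close>

lemma iso_grp_average:
  fixes f :: "(int \<times> int \<Rightarrow> 'a::{field, finite}) \<Rightarrow> complex"
  assumes "(2 :: 'a) \<noteq> 0"
  shows "(\<Sum>x\<in>iso_grp G n. f (top_rows G n x)) / of_nat (card (iso_grp G n :: 'a mat set)) =
    avg (coords G n) range_of f"
proof -
  have im: "top_rows G n ` iso_grp G n = PiE (coords G n) (range_of :: _ \<Rightarrow> 'a set)"
  proof (intro equalityI subsetI)
    fix y assume "y \<in> PiE (coords G n) (range_of :: _ \<Rightarrow> 'a set)"
    from top_rows_onto[OF this assms] show "y \<in> top_rows G n ` iso_grp G n" by blast
  next
    fix y assume "y \<in> top_rows G n ` (iso_grp G n :: 'a mat set)"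
    then show "y \<in> PiE (coords G n) range_of" by (metis imageE top_rows_in)
  qed
  have "(\<Sum>x\<in>carrier (Ugrp G n). f (top_rows G n x)) / of_nat (card (carrier (Ugrp G n :: 'a mat monoid))) =
    (\<Sum>y\<in>top_rows G n ` carrier (Ugrp G n). f y) /
      of_nat (card (top_rows G n ` carrier (Ugrp G n :: 'a mat monoid)))"
    by (rule sum_over_fibres[OF Ugrp_group])
      (auto simp: carrier_Ugrp finite_iso_grp intro: top_rows_mult)
  then show ?thesis by (simp add: carrier_Ugrp im avg_def)
qed

lemma minus_zero_dim:
  fixes A :: "'a::field mat"
  shows "dim_row A = k \<Longrightarrow> dim_col A = l \<Longrightarrow> A - 0\<^sub>m k l = A"
  by (auto intro!: eq_matI)

section \<open>Conjugates in the isometry group\<close>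

text \<open>Multiplying by u on the right adds to each column multiples of earlier columns only.
  Hence neither the zeros at the start of a row nor the first entry after them change.\<close>

lemma unitriangular_row:
  fixes d u :: "'a::field mat"
  assumes "d \<in> carrier_mat m m" "u \<in> carrier (UT m)" "i < m" "K \<le> m" "\<And>k. k < K \<Longrightarrow> d $$ (i, k) = 0"
  shows "k < K \<Longrightarrow> (d * u) $$ (i, k) = 0" "K < m \<Longrightarrow> (d * u) $$ (i, K) = d $$ (i, K)"
proof -
  have e: "(d * u) $$ (i, k) = (\<Sum>t<m. d $$ (i, t) * u $$ (t, k))" if "k < m" for k
    using that assms UT_carrier_mat[OF assms(2)] by (intro index_mult_sum) auto
  have u: "u $$ (t, k) = 0" if "k < t" "t < m" for t k
    using assms(2) that by (auto simp: UT_iff)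
  show "(d * u) $$ (i, k) = 0" if "k < K"
  proof -
    have "d $$ (i, t) * u $$ (t, k) = 0" if "t < m" for t
      using assms(5)[of t] u[of k t] that \<open>k < K\<close> by (cases "t < K") auto
    then show ?thesis using that assms(4) by (simp add: e sum.neutral del: mult_eq_0_iff)
  qed
  show "(d * u) $$ (i, K) = d $$ (i, K)" if "K < m"
  proof -
    have "d $$ (i, t) * u $$ (t, K) = (if t = K then d $$ (i, t) else 0)" if "t < m" for t
      using assms(2) assms(5)[of t] u[of K t] that \<open>K < m\<close> by (cases t K rule: linorder_cases) (auto simp: UT_iff)
    then show ?thesis using that by (simp add: e)
  qed
qed

definition conjg :: "family \<Rightarrow> nat \<Rightarrow> 'a::field mat \<Rightarrow> 'a mat \<Rightarrow> 'a mat" where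
  "conjg G n x z = x * z * inv\<^bsub>Ugrp G n\<^esub> x"

lemma conjg_in_iso_grp:
  fixes x :: "'a::{field, finite} mat"
  shows "x \<in> iso_grp G n \<Longrightarrow> z \<in> iso_grp G n \<Longrightarrow> conjg G n x z \<in> iso_grp G n"
  by (simp add: conjg_def iso_grp_mult Ugrp_inv)

text \<open>The conjugate minus 1 equals d times the inverse of x, and multiplying by x leads back
  to d. By \<open>unitriangular_row\<close> both matrices have the same initial zeros in each row
  and the same next entry, so the inverse of x can be forgotten.\<close>

lemma conjg_row:
  fixes x z :: "'a::{field, finite} mat"
  assumes x: "x \<in> iso_grp G n" and z: "z \<in> iso_grp G n" and "i < msize G n" "K \<le> msize G n"
  defines "d \<equiv> x * (z - 1\<^sub>m (msize G n))"
  shows "(\<forall>k. i < k \<and> k < K \<longrightarrow> conjg G n x z $$ (i, k) = 0) \<longleftrightarrow> (\<forall>k<K. d $$ (i, k) = 0)"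
    and "i < K \<Longrightarrow> K < msize G n \<Longrightarrow> (\<forall>k<K. d $$ (i, k) = 0) \<Longrightarrow> conjg G n x z $$ (i, K) = d $$ (i, K)"
proof -
  let ?m = "msize G n" and ?y = "conjg G n x z" and ?u = "inv\<^bsub>Ugrp G n\<^esub> x"
  note u = Ugrp_inv[OF x]
  note [simp] = carrier_matD[OF iso_grp_carrier_mat[OF x]] carrier_matD[OF iso_grp_carrier_mat[OF z]]
    carrier_matD[OF iso_grp_carrier_mat[OF u(1)]]
  have y: "?y \<in> carrier (UT ?m)" using conjg_in_iso_grp[OF x z] by (rule iso_grp_UT)
  have du: "d * ?u = ?y - 1\<^sub>m ?m"
    by (simp add: d_def conjg_def mat_dim u)
  have yx: "(?y - 1\<^sub>m ?m) * x = d"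
    unfolding du[symmetric] by (simp add: d_def mat_dim u)
  have d: "d \<in> carrier_mat ?m ?m" and y1: "?y - 1\<^sub>m ?m \<in> carrier_mat ?m ?m"
    by (auto simp: d_def conjg_def intro!: carrier_matI)
  \<comment> \<open>A unitriangular matrix minus 1 vanishes up to and including the diagonal, so
    conditions on the columns right of the diagonal amount to conditions on a whole initial segment
    of the row.\<close>
  have y0: "(?y - 1\<^sub>m ?m) $$ (i, k) = (if k \<le> i then 0 else ?y $$ (i, k))" if "k < ?m" for k
    using y that assms(3) by (auto simp: UT_iff)
  have "(\<forall>k. i < k \<and> k < K \<longrightarrow> ?y $$ (i, k) = 0) \<longleftrightarrow> (\<forall>k<K. (?y - 1\<^sub>m ?m) $$ (i, k) = 0)"
    using y0 assms(4) by (metis linorder_not_le order_less_le_trans)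
  also have "\<dots> \<longleftrightarrow> (\<forall>k<K. d $$ (i, k) = 0)"
    using unitriangular_row(1)[OF d iso_grp_UT[OF u(1)] assms(3,4)]
      unitriangular_row(1)[OF y1 iso_grp_UT[OF x] assms(3,4)] unfolding du yx by blast
  finally show "(\<forall>k. i < k \<and> k < K \<longrightarrow> ?y $$ (i, k) = 0) \<longleftrightarrow> (\<forall>k<K. d $$ (i, k) = 0)" .
  show "?y $$ (i, K) = d $$ (i, K)" if "i < K" "K < ?m" "\<forall>k<K. d $$ (i, k) = 0"
    using unitriangular_row(2)[OF d iso_grp_UT[OF u(1)] assms(3,4)] that y0[of K]
    unfolding du by auto
qed

lemma form_product_index:
  fixes A :: "'a::field mat"
  assumes "A \<in> carrier_mat n n" "B \<in> carrier_mat n (middle G)" "C \<in> carrier_mat n n"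
    "F \<in> carrier_mat (middle G) n" "H \<in> carrier_mat n n"
    and "A' \<in> carrier_mat n n" "B' \<in> carrier_mat n (middle G)" "C' \<in> carrier_mat n n"
    "F' \<in> carrier_mat (middle G) n" "H' \<in> carrier_mat n n"
    and "U = upper3 n (middle G) A B C F H"
    and "U' = upper3 n (middle G) A' B' C' F' H'"
    and "i < n" "j < n"
  shows "(U * form_mat G n * U'\<^sup>T) $$ (i, j) =
    (eps G \<cdot>\<^sub>m (C * antidiag n * A'\<^sup>T) + B * B'\<^sup>T + A * antidiag n * C'\<^sup>T) $$ (i, j)"
  unfolding assms(11,12) form_product[OF assms(1-10)]
  using assms(13,14) by (simp add: mat3_def blk_def off_def del: index_mult_mat(1) index_add_mat(1))

locale conjugation =
  fixes G :: family and n :: nat and x Z v w :: "'a::{field, finite} mat"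
  assumes x: "x \<in> iso_grp G n" and params: "(Z, v, w) \<in> params G n"
begin

abbreviation "r \<equiv> middle G"
abbreviation "J \<equiv> antidiag n :: 'a mat"
abbreviation "z \<equiv> umat G n (Z, v, w)"
abbreviation "y \<equiv> conjg G n x z"

lemma z: "z \<in> iso_grp G n"
  using params by (rule umat_in_iso_grp)

lemma ZU: "Z \<in> carrier (UT n)" and v: "v \<in> carrier_mat n r" and w: "w \<in> carrier_mat n n"
  using params by (auto simp: params_iff)

lemma Z: "Z \<in> carrier_mat n n" using ZU by (rule UT_carrier_mat)

definition "Zi = inv\<^bsub>UT n\<^esub> Z"

lemma Zi: "Zi \<in> carrier_mat n n" "Z * Zi = 1\<^sub>m n" "Zi * Z = 1\<^sub>m n"
  using UT_inv[OF ZU] UT_carrier_mat by (auto simp: Zi_def)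

definition "X = mat n n (\<lambda>(i, j). x $$ (i, j))"
definition "B = mat n r (\<lambda>(i, j). x $$ (i, n + j))"
definition "C = mat n n (\<lambda>(i, j). x $$ (i, n + r + j))"

lemma dims [simp]:
  "dim_row X = n" "dim_col X = n" "dim_row B = n" "dim_col B = r" "dim_row C = n" "dim_col C = n"
  "dim_row Z = n" "dim_col Z = n" "dim_row Zi = n" "dim_col Zi = n"
  "dim_row v = n" "dim_col v = r" "dim_row w = n" "dim_col w = n"
  using Z Zi v w by (auto simp: X_def B_def C_def)

lemma x_blocks:
  obtains F H where "F \<in> carrier_mat r n" "H \<in> carrier_mat n n"
    "x = upper3 n r X B C F H"
proof -
  obtain A B' C' F H where *: "A \<in> carrier (UT n)" "B' \<in> carrier_mat n r" "C' \<in> carrier_mat n n"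
    "F \<in> carrier_mat r n" "H \<in> carrier (UT n)" and
    x': "x = upper3 n r A B' C' F H"
    using UT_mat3[OF iso_grp_UT[OF x, unfolded msize_eq] middle_less_2] by metis
  have A: "A \<in> carrier_mat n n" using * UT_carrier_mat by auto
  have "X = A" "B = B'" "C = C'"
    unfolding X_def B_def C_def unfolding x' using A *
    by (auto simp: mat3_def blk_def off_def numeral_2_eq_2 intro!: eq_matI)
  then show ?thesis using that * x' UT_carrier_mat by blast
qed

lemma z_blocks:
  "z = upper3 n r Z (Z * v) (Z * w) (- (v\<^sup>T * J)) (J * Zi\<^sup>T * J)"
  unfolding Zi_def by (rule umat_mat3[OF ZU v w])

text \<open>Only the three upper blocks are ever evaluated; the lower blocks are merely known to
  have the right size.\<close>

lemma xz_blocks: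
  obtains F H where "F \<in> carrier_mat r n" "H \<in> carrier_mat n n"
    "x * z = upper3 n r (X * Z) (X * (Z * v) + B) (X * (Z * w) - B * (v\<^sup>T * J) + C * (J * Zi\<^sup>T * J)) F H"
proof -
  obtain F H where FH: "F \<in> carrier_mat r n" "H \<in> carrier_mat n n" and
    x': "x = upper3 n r X B C F H"
    using x_blocks .
  note [simp] = carrier_matD[OF FH(1)] carrier_matD[OF FH(2)]
  show ?thesis
  proof (rule that)
    show "x * z = upper3 n r (X * Z) (X * (Z * v) + B) (X * (Z * w) - B * (v\<^sup>T * J) + C * (J * Zi\<^sup>T * J)) (- (v\<^sup>T * J) + F * (J * Zi\<^sup>T * J)) (H * (J * Zi\<^sup>T * J))"
      unfolding z_blocks
      by (subst x', subst mat3_mult)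
        (auto simp: blocks_iff mult_blocks_eq mat_dim add_uminus_minus_mat[of _ n n] intro!: carrier_matI mat3_cong)
  qed (auto intro!: carrier_matI)
qed

definition "d = x * (z - 1\<^sub>m (msize G n))"

lemma d_eq: "d = x * z - x"
proof -
  note [simp] = carrier_matD[OF iso_grp_carrier_mat[OF x]] carrier_matD[OF iso_grp_carrier_mat[OF z]]
  show ?thesis by (simp add: d_def mat_dim)
qed

lemma d_index:
  assumes "i < n" "j < 2 * n + r"
  shows "d $$ (i, j) = (x * z) $$ (i, j) - x $$ (i, j)"
  using assms carrier_matD[OF iso_grp_carrier_mat[OF x]] unfolding d_eq
  by (simp add: msize_eq del: index_mult_mat(1))

lemma d_left:
  assumes "i < n" "k < n"
  shows "d $$ (i, k) = (X * (Z - 1\<^sub>m n)) $$ (i, k)"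
proof -
  obtain F H where "x * z = upper3 n r (X * Z) (X * (Z * v) + B) (X * (Z * w) - B * (v\<^sup>T * J) + C * (J * Zi\<^sup>T * J)) F H" using xz_blocks by metis
  then have "(x * z) $$ (i, k) = (X * Z) $$ (i, k)"
    using assms by (simp add: mat3_def blk_def off_def del: index_mult_mat(1))
  moreover have "x $$ (i, k) = X $$ (i, k)" using assms by (simp add: X_def)
  ultimately show ?thesis
    using assms by (simp add: d_index mat_dim del: index_mult_mat(1))
qed

lemma d_middle:
  assumes "i < n" "r = 1"
  shows "d $$ (i, n) = (X * (Z * v)) $$ (i, 0)"
proof -
  obtain F H where "x * z = upper3 n r (X * Z) (X * (Z * v) + B) (X * (Z * w) - B * (v\<^sup>T * J) + C * (J * Zi\<^sup>T * J)) F H" using xz_blocks by metis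
  then have "(x * z) $$ (i, n) = (X * (Z * v)) $$ (i, 0) + B $$ (i, 0)"
    using assms by (simp add: mat3_def blk_def off_def del: index_mult_mat(1))
  moreover have "x $$ (i, n) = B $$ (i, 0)" using assms by (simp add: B_def)
  ultimately show ?thesis
    using assms by (simp add: d_index del: index_mult_mat(1))
qed

text \<open>Comparing the upper left blocks of \<open>x z M x\<^sup>T\<close> and \<open>x M x\<^sup>T = M\<close>, where \<open>M\<close> is the form.\<close>

lemma conj_value_blocks:
  assumes "P \<in> carrier_mat 1 n" "Q \<in> carrier_mat 1 n"
    and "P * X * (Z - 1\<^sub>m n) = 0\<^sub>m 1 n" "Q * X * (Z - 1\<^sub>m n) = 0\<^sub>m 1 n" "Q * X * v = 0\<^sub>m 1 r"
  obtains K where "K \<in> carrier_mat n n" "\<And>i j. i < n \<Longrightarrow> j < n \<Longrightarrow> K $$ (i, j) = y $$ (i, n + r + j)"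
    "eps G \<cdot>\<^sub>m (P * K * J * Q\<^sup>T) =
      eps G \<cdot>\<^sub>m (P * X * (w * J) * (Q * X)\<^sup>T) + P * X * v * (Q * B)\<^sup>T"
proof -
  let ?M = "form_mat G n :: 'a mat" and ?u = "inv\<^bsub>Ugrp G n\<^esub> x" and ?Hz = "J * Zi\<^sup>T * J"
  obtain F H where FH: "F \<in> carrier_mat r n" "H \<in> carrier_mat n n" and
    x': "x = upper3 n r X B C F H"
    using x_blocks .
  obtain F' H' where FH': "F' \<in> carrier_mat r n" "H' \<in> carrier_mat n n" and
    xz: "x * z = upper3 n r (X * Z) (X * (Z * v) + B) (X * (Z * w) - B * (v\<^sup>T * J) + C * ?Hz) F' H'"
    using xz_blocks .
  have yU: "y \<in> iso_grp G n" by (rule conjg_in_iso_grp[OF x z])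
  obtain Y By K Fy Hy where *: "Y \<in> carrier (UT n)" "By \<in> carrier_mat n r" "K \<in> carrier_mat n n"
    "Fy \<in> carrier_mat r n" "Hy \<in> carrier (UT n)" and
    y': "y = upper3 n r Y By K Fy Hy"
    using UT_mat3[OF iso_grp_UT[OF yU, unfolded msize_eq] middle_less_2] by metis
  have Y: "Y \<in> carrier_mat n n" "Hy \<in> carrier_mat n n" using * UT_carrier_mat by auto
  note u = Ugrp_inv[OF x]
  note [simp] = carrier_matD[OF iso_grp_carrier_mat[OF x]] carrier_matD[OF iso_grp_carrier_mat[OF z]]
    carrier_matD[OF iso_grp_carrier_mat[OF u(1)]] carrier_matD[OF form_mat_carrier[of G n]]
    carrier_matD[OF FH(1)] carrier_matD[OF FH(2)] carrier_matD[OF FH'(1)] carrier_matD[OF FH'(2)]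
    carrier_matD[OF Y(1)] carrier_matD[OF Y(2)] carrier_matD[OF *(2)] carrier_matD[OF *(3)] carrier_matD[OF *(4)]
    carrier_matD[OF assms(1)] carrier_matD[OF assms(2)]
  have xMx: "x * ?M * x\<^sup>T = ?M" using x by (simp add: iso_grp_def)
  \<comment> \<open>Replacing M by \<open>x * M * x\<^sup>T\<close> removes the inverse of x from
    the conjugate.\<close>
  have xzM: "x * z * ?M * x\<^sup>T = y * ?M"
  proof -
    have "y * ?M = y * (x * ?M * x\<^sup>T)" by (simp only: xMx)
    also have "\<dots> = x * z * ?M * x\<^sup>T"
      by (simp add: conjg_def mat_dim mult_cancel_dim[OF u(3)])
    finally show ?thesis by simp
  qed
  define T where "T = X * (Z * w) - B * (v\<^sup>T * J) + C * ?Hz"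
  have T[simp]: "dim_row T = n" "dim_col T = n" by (auto simp: T_def)
  let ?L1 = "eps G \<cdot>\<^sub>m (T * J * X\<^sup>T) + (X * (Z * v) + B) * B\<^sup>T +
    X * Z * J * C\<^sup>T"
  let ?L2 = "eps G \<cdot>\<^sub>m (C * J * X\<^sup>T) + B * B\<^sup>T + X * J * C\<^sup>T"
  have L1: "(x * z * ?M * x\<^sup>T) $$ (i, j) = ?L1 $$ (i, j)" if "i < n" "j < n" for i j
    by (rule form_product_index[OF _ _ _ _ _ _ _ _ _ _ xz[folded T_def] x' that])
      (use FH FH' in \<open>auto intro!: carrier_matI\<close>)
  have L2: "?L2 = 0\<^sub>m n n"
  proof (rule eq_matI)
    fix i j assume ij: "i < dim_row (0\<^sub>m n n :: 'a mat)" "j < dim_col (0\<^sub>m n n :: 'a mat)"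
    have "(x * ?M * x\<^sup>T) $$ (i, j) = ?L2 $$ (i, j)"
      by (rule form_product_index[OF _ _ _ _ _ _ _ _ _ _ x' x']) (use FH ij in \<open>auto intro!: carrier_matI\<close>)
    then show "?L2 $$ (i, j) = 0\<^sub>m n n $$ (i, j)"
      using ij unfolding xMx by (simp add: form_mat_def mat3_def blk_def off_def)
  qed auto
  \<comment> \<open>With the identity in block form, \<open>y * M\<close> becomes a product to which
    \<open>form_product_index\<close> applies; its upper left block isolates K, the upper right
    block of y.\<close>
  have one: "1\<^sub>m (msize G n) = upper3 n r (1\<^sub>m n) (0\<^sub>m n r) (0\<^sub>m n n) (0\<^sub>m r n) (1\<^sub>m n)"
    by (rule eq_matI) (auto simp: mat3_def blk_def off_def numeral_2_eq_2 msize_eq)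
  have L3: "(y * ?M) $$ (i, j) = (eps G \<cdot>\<^sub>m (K * J)) $$ (i, j)" if "i < n" "j < n" for i j
  proof -
    have "y * ?M = y * ?M * (1\<^sub>m (msize G n))\<^sup>T"
      using carrier_matD[OF iso_grp_carrier_mat[OF yU]] by (simp add: mat_dim)
    also have "\<dots> $$ (i, j) = (eps G \<cdot>\<^sub>m (K * J * (1\<^sub>m n)\<^sup>T) + By * (0\<^sub>m n r)\<^sup>T +
        Y * J * (0\<^sub>m n n)\<^sup>T) $$ (i, j)"
      by (rule form_product_index[OF _ _ _ _ _ _ _ _ _ _ y' one that]) (use * Y in auto)
    also have "eps G \<cdot>\<^sub>m (K * J * (1\<^sub>m n)\<^sup>T) + By * (0\<^sub>m n r)\<^sup>T +
        Y * J * (0\<^sub>m n n)\<^sup>T = eps G \<cdot>\<^sub>m (K * J)"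
      by (simp add: mat_dim)
    finally show ?thesis .
  qed
  have KJ: "eps G \<cdot>\<^sub>m (K * J) = ?L1"
    by (rule eq_matI) (simp_all add: L1[symmetric] L3[symmetric] xzM del: index_mult_mat(1) index_add_mat(1) index_smult_mat(1))
  \<comment> \<open>The hypothesis on P says that the row vector P X is fixed by Z. The same holds
    for Q below, and then also for the inverse of Z.\<close>
  have PZ: "P * (X * (Z * A)) = P * (X * A)" if "dim_row A = n" for A
  proof -
    have "P * X * (Z - 1\<^sub>m n) * A = 0\<^sub>m 1 n * A" by (simp only: assms(3))
    then have e: "P * (X * (Z * A)) - P * (X * A) = 0\<^sub>m 1 (dim_col A)" using that by (simp add: mat_dim)
    have "P * (X * (Z * A)) = (P * (X * (Z * A)) - P * (X * A)) + P * (X * A)"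
      using that by (intro eq_matI) (simp_all del: index_mult_mat(1))
    then show ?thesis unfolding e using that by (simp add: mat_dim)
  qed
  have QZ: "Q * (X * (Z * A)) = Q * (X * A)" if "dim_row A = n" for A
  proof -
    have "Q * X * (Z - 1\<^sub>m n) * A = 0\<^sub>m 1 n * A" by (simp only: assms(4))
    then have e: "Q * (X * (Z * A)) - Q * (X * A) = 0\<^sub>m 1 (dim_col A)" using that by (simp add: mat_dim)
    have "Q * (X * (Z * A)) = (Q * (X * (Z * A)) - Q * (X * A)) + Q * (X * A)"
      using that by (intro eq_matI) (simp_all del: index_mult_mat(1))
    then show ?thesis unfolding e using that by (simp add: mat_dim)
  qed
  have "(Q * (X * (Z * Zi)))\<^sup>T = (Q * (X * Zi))\<^sup>T" by (simp only: QZ dims)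
  then have QZi: "Zi\<^sup>T * (X\<^sup>T * Q\<^sup>T) = X\<^sup>T * Q\<^sup>T"
    by (simp add: mat_dim Zi)
  have "(Q * X * v)\<^sup>T = (0\<^sub>m 1 r)\<^sup>T" by (simp only: assms(5))
  then have Qv: "v\<^sup>T * (X\<^sup>T * Q\<^sup>T) = 0\<^sub>m r 1"
    by (simp add: mat_dim)
  note cancel = mult_cancel_dim[OF antidiag_square[of n]]
  \<comment> \<open>After P and Q have absorbed Z, the terms in C together with
    \<open>B * B\<^sup>T\<close> form exactly this vanishing expression. So the block C of x, whose
    entries are not free, drops out of the result.\<close>
  have "P * ?L2 * Q\<^sup>T = 0\<^sub>m 1 1" unfolding L2 by (simp add: mat_dim)
  then have e2: "eps G \<cdot>\<^sub>m (P * (C * (J * (X\<^sup>T * Q\<^sup>T)))) +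
      P * (B * (B\<^sup>T * Q\<^sup>T)) + P * (X * (J * (C\<^sup>T * Q\<^sup>T))) = 0\<^sub>m 1 1"
    by (simp add: mat_dim)
  have "eps G \<cdot>\<^sub>m (P * K * J * Q\<^sup>T) = P * (eps G \<cdot>\<^sub>m (K * J)) * Q\<^sup>T"
    by (simp add: mat_dim)
  also have "\<dots> = eps G \<cdot>\<^sub>m (P * (X * (w * (J * (X\<^sup>T * Q\<^sup>T)))) +
       P * (C * (J * (X\<^sup>T * Q\<^sup>T)))) +
      (P * (X * (v * (B\<^sup>T * Q\<^sup>T))) + P * (B * (B\<^sup>T * Q\<^sup>T))) +
      P * (X * (J * (C\<^sup>T * Q\<^sup>T)))"
    unfolding KJ T_def by (simp add: mat_dim cancel PZ QZi Qv minus_zero_dim)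
  also have "\<dots> = (eps G \<cdot>\<^sub>m (P * X * (w * J) * (Q * X)\<^sup>T) + P * X * v * (Q * B)\<^sup>T) +
     (eps G \<cdot>\<^sub>m (P * (C * (J * (X\<^sup>T * Q\<^sup>T)))) +
      P * (B * (B\<^sup>T * Q\<^sup>T)) + P * (X * (J * (C\<^sup>T * Q\<^sup>T))))"
    by (simp add: mat_dim) (intro eq_matI; simp add: algebra_simps del: index_mult_mat(1))
  finally have main: "eps G \<cdot>\<^sub>m (P * K * J * Q\<^sup>T) =
      eps G \<cdot>\<^sub>m (P * X * (w * J) * (Q * X)\<^sup>T) + P * X * v * (Q * B)\<^sup>T"
    unfolding e2 by (simp add: mat_dim)
  have "K $$ (i, j) = y $$ (i, n + r + j)" if "i < n" "j < n" for i j
    using that unfolding y' by (simp add: mat3_def blk_def off_def numeral_2_eq_2)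
  with main show ?thesis using that *(3) by blast
qed

end

section \<open>The representatives\<close>

text \<open>The labels are delivered as images of natural numbers, since \<open>place\<close> and
  matrix indices count in \<open>nat\<close>.\<close>

lemma Roots_cases:
  assumes "\<beta> \<in> Roots G n"
  obtains i j where "\<beta> = Minus (int i) (int j)" "1 \<le> i" "i < j" "j \<le> n"
  | i j where "\<beta> = Plus (int i) (int j)" "1 \<le> i" "i < j" "j \<le> n"
  | i where "\<beta> = Twice (int i)" "1 \<le> i" "i \<le> n" "G = Sp_even"
  | i where "\<beta> = Single (int i)" "1 \<le> i" "i \<le> n" "G = O_odd"
proof (cases \<beta>)
  case (Minus a b)
  then show ?thesis using assms that(1)[of "nat a" "nat b"] by (cases G) (auto simp: Roots_def)
next
  case (Plus a b)
  then show ?thesis using assms that(2)[of "nat a" "nat b"] by (cases G) (auto simp: Roots_def)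
next
  case (Twice a)
  then show ?thesis using assms that(3)[of "nat a"] by (cases G) (auto simp: Roots_def)
next
  case (Single a)
  then show ?thesis using assms that(4)[of "nat a"] by (cases G) (auto simp: Roots_def)
qed

lemma place_uminus: "a \<in> Idx G n \<Longrightarrow> place G n (- a) = msize G n - 1 - place G n a"
  by (cases G) (auto simp: Idx_def place_def msize_def middle_def)

lemma unit_mat_index:
  assumes "k < msize G n" "l < msize G n"
  shows "unit_mat G n a b $$ (k, l) = (if k = place G n a \<and> l = place G n b then 1 else 0)"
  using assms by (simp add: unit_mat_def)

lemma unit_mat_dim [simp]: "dim_row (unit_mat G n a b) = msize G n" "dim_col (unit_mat G n a b) = msize G n"
  by (simp_all add: unit_mat_def)

text \<open>Negating a label reflects its place, so reflection in the antidiagonal turns the matrix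
  unit at (a, b) into the one at (-b, -a).\<close>

lemma unit_mat_swap:
  assumes "a \<in> Idx G n" "b \<in> Idx G n" "k < msize G n" "l < msize G n"
  shows "unit_mat G n a b $$ (msize G n - 1 - l, msize G n - 1 - k) = unit_mat G n (- b) (- a) $$ (k, l)"
proof -
  have "msize G n - 1 - l = place G n a \<longleftrightarrow> l = place G n (- a)"
    using place_less[OF assms(1)] assms(4) unfolding place_uminus[OF assms(1)] by linarith
  moreover have "msize G n - 1 - k = place G n b \<longleftrightarrow> k = place G n (- b)"
    using place_less[OF assms(2)] assms(3) unfolding place_uminus[OF assms(2)] by linarith
  ultimately show ?thesis using assms(3,4) by (auto simp: unit_mat_index)
qed

lemma Idx_pos: "1 \<le> i \<Longrightarrow> i \<le> n \<Longrightarrow> int i \<in> Idx G n" "1 \<le> i \<Longrightarrow> i \<le> n \<Longrightarrow> - int i \<in> Idx G n"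
  by (auto simp: Idx_def)

lemma place_int: "1 \<le> i \<Longrightarrow> i \<le> n \<Longrightarrow> place G n (int i) = i - 1"
  "1 \<le> i \<Longrightarrow> i \<le> n \<Longrightarrow> place G n (- int i) = msize G n - i"
  by (auto simp: place_def)

lemma root_mat_upper:
  assumes "\<beta> \<in> Roots G n" "l \<le> k" "k < msize G n"
  shows "root_mat G n \<beta> $$ (k, l) = (0 :: 'a::field)"
proof -
  have U: "unit_mat G n a b $$ (k, l) = (0 :: 'a)" if "place G n a < place G n b" for a b
    using assms(2,3) that by (auto simp: unit_mat_index)
  from assms(1) show ?thesis
  proof (cases rule: Roots_cases)
    case (1 i j)
    then show ?thesis using U[of "int i" "int j"] U[of "- int j" "- int i"] assms(2,3)
      by (simp add: place_int msize_def)
  next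
    case (2 i j)
    then show ?thesis using U[of "int i" "- int j"] U[of "int j" "- int i"] assms(2,3)
      by (auto simp: place_int msize_def)
  next
    case (3 i)
    then show ?thesis using U[of "int i" "- int i"] assms(2,3) by (simp add: place_int msize_def)
  next
    case (4 i)
    then show ?thesis using U[of "int i" 0] U[of 0 "- int i"] assms(2,3)
      by (simp add: place_int place_zero msize_def middle_def)
  qed
qed

text \<open>For upper triangular a this is the entrywise form of
  \<open>a * M + M * a\<^sup>T = 0\<close>, the linearised isometry condition. The sign
  \<open>eps G\<close> appears only between the first n rows and the columns from place n
  on.\<close>

lemma root_mat_skew:
  assumes "\<beta> \<in> Roots G n" "k < msize G n" "l < msize G n"
  shows "root_mat G n \<beta> $$ (k, l) =
    - (if k < n \<and> n \<le> l then eps G else (1 :: 'a::field)) * root_mat G n \<beta> $$ (msize G n - 1 - l, msize G n - 1 - k)"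
proof -
  have m: "msize G n - 1 - l < msize G n" "msize G n - 1 - k < msize G n" using assms by auto
  note swap = unit_mat_swap[OF _ _ assms(2,3), simplified]
  from assms(1) show ?thesis
  proof (cases rule: Roots_cases)
    case (1 i j)
    have "unit_mat G n (int i) (int j) $$ (k, l) = (0 :: 'a)" "unit_mat G n (- int j) (- int i) $$ (k, l) = (0 :: 'a)"
      if "k < n" "n \<le> l"
      using 1 that assms(2,3) by (auto simp: unit_mat_index place_int msize_def)
    then show ?thesis using 1 assms(2,3) m by (auto simp: swap Idx_pos)
  next
    case (2 i j)
    have "unit_mat G n (int i) (- int j) $$ (k, l) = (0 :: 'a)" "unit_mat G n (int j) (- int i) $$ (k, l) = (0 :: 'a)"
      if "\<not> (k < n \<and> n \<le> l)"
      using 2 that assms(2,3) by (auto simp: unit_mat_index place_int msize_def)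
    then show ?thesis
      using 2 assms(2,3) m swap[of "int i" "- int j", where ?'a = 'a] swap[of "int j" "- int i", where ?'a = 'a]
      by (auto simp: Idx_pos eps_def)
  next
    case (3 i)
    have "unit_mat G n (int i) (- int i) $$ (k, l) = (0 :: 'a)" if "\<not> (k < n \<and> n \<le> l)"
      using 3 that assms(2,3) by (auto simp: unit_mat_index place_int msize_def)
    then show ?thesis
      using 3 assms(2,3) m swap[of "int i" "- int i", where ?'a = 'a] by (auto simp: Idx_pos eps_def)
  next
    case (4 i)
    have "0 \<in> Idx G n" using 4 by (simp add: Idx_def)
    then show ?thesis
      using 4 assms(2,3) m swap[of "int i" 0, where ?'a = 'a] swap[of 0 "- int i", where ?'a = 'a]
      by (auto simp: Idx_pos eps_def)
  qed
qed

lemma e_pair_index: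
  "k < msize G n \<Longrightarrow> l < msize G n \<Longrightarrow> e_pair G n D \<phi> $$ (k, l) = (\<Sum>\<alpha>\<in>D. \<phi> \<alpha> * root_mat G n \<alpha> $$ (k, l))"
  by (simp add: e_pair_def)

lemma e_pair_upper:
  assumes "D \<subseteq> Roots G n" "l \<le> k" "k < msize G n"
  shows "e_pair G n D \<phi> $$ (k, l) = 0"
  using assms by (subst e_pair_index) (auto simp: root_mat_upper subset_iff intro!: sum.neutral)

lemma e_pair_skew:
  fixes \<phi> :: "root \<Rightarrow> 'a::field"
  assumes "D \<subseteq> Roots G n" "k < msize G n" "l < msize G n"
  shows "e_pair G n D \<phi> $$ (k, l) =
    - (if k < n \<and> n \<le> l then eps G else 1) * e_pair G n D \<phi> $$ (msize G n - 1 - l, msize G n - 1 - k)"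
proof -
  have "e_pair G n D \<phi> $$ (k, l) = (\<Sum>\<alpha>\<in>D. - (if k < n \<and> n \<le> l then eps G else 1) *
      (\<phi> \<alpha> * root_mat G n \<alpha> $$ (msize G n - 1 - l, msize G n - 1 - k)))"
    unfolding e_pair_index[OF assms(2,3)]
  proof (rule sum.cong[OF refl])
    fix \<alpha> assume "\<alpha> \<in> D"
    then have "\<alpha> \<in> Roots G n" using assms(1) by blast
    from root_mat_skew[OF this assms(2,3), where ?'a = 'a]
    show "\<phi> \<alpha> * root_mat G n \<alpha> $$ (k, l) = - (if k < n \<and> n \<le> l then eps G else 1) *
      (\<phi> \<alpha> * root_mat G n \<alpha> $$ (msize G n - 1 - l, msize G n - 1 - k))"
      by (simp only: mult.left_commute)
  qed
  also have "\<dots> = - (if k < n \<and> n \<le> l then eps G else 1) * e_pair G n D \<phi> $$ (msize G n - 1 - l, msize G n - 1 - k)"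
    using assms by (subst e_pair_index) (auto simp: sum_distrib_left)
  finally show ?thesis .
qed

text \<open>\<open>eN\<close>, \<open>ev\<close> and \<open>eW\<close> are the upper blocks of
  \<open>e_pair\<close>, in the roles of x - 1, v and w' in \<open>amat\<close>. By
  \<open>e_pair_skew\<close> they determine the remaining blocks.\<close>

definition eN :: "family \<Rightarrow> nat \<Rightarrow> root set \<Rightarrow> (root \<Rightarrow> 'a) \<Rightarrow> 'a::field mat" where
  "eN G n D \<phi> = mat n n (\<lambda>(i, j). e_pair G n D \<phi> $$ (i, j))"

definition ev :: "family \<Rightarrow> nat \<Rightarrow> root set \<Rightarrow> (root \<Rightarrow> 'a) \<Rightarrow> 'a::field mat" where
  "ev G n D \<phi> = mat n (middle G) (\<lambda>(i, j). e_pair G n D \<phi> $$ (i, n + j))"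

definition eW :: "family \<Rightarrow> nat \<Rightarrow> root set \<Rightarrow> (root \<Rightarrow> 'a) \<Rightarrow> 'a::field mat" where
  "eW G n D \<phi> = mat n n (\<lambda>(i, j). e_pair G n D \<phi> $$ (i, n + middle G + j))"

text \<open>The last component undoes the shift of \<open>w\<close> in \<open>amat\<close>; for \<open>G \<noteq> O_odd\<close> the matrix \<open>ev\<close> has no columns
  and the correction vanishes.\<close>

definition z_triple :: "family \<Rightarrow> nat \<Rightarrow> root set \<Rightarrow> (root \<Rightarrow> 'a) \<Rightarrow> 'a::field mat \<times> 'a mat \<times> 'a mat" where
  "z_triple G n D \<phi> = (1\<^sub>m n + eN G n D \<phi>, ev G n D \<phi>,
     eW G n D \<phi> - (1 / 2) \<cdot>\<^sub>m (ev G n D \<phi> * (ev G n D \<phi>)\<^sup>T * antidiag n))"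

lemma e_dims [simp]:
  "dim_row (eN G n D \<phi>) = n" "dim_col (eN G n D \<phi>) = n" "dim_row (ev G n D \<phi>) = n"
  "dim_col (ev G n D \<phi>) = middle G" "dim_row (eW G n D \<phi>) = n" "dim_col (eW G n D \<phi>) = n"
  by (simp_all add: eN_def ev_def eW_def)

text \<open>The skew symmetry of \<open>e_pair\<close>, restricted to the upper right block, is the
  homogeneous version of the equation for w.\<close>

lemma eW_relation:
  assumes "D \<subseteq> Roots G n"
  shows "antidiag n * (eW G n D \<phi>)\<^sup>T + eps G \<cdot>\<^sub>m (eW G n D \<phi> * antidiag n) = 0\<^sub>m n n"
proof (rule eq_matI)
  fix i j assume "i < dim_row (0\<^sub>m n n :: 'a mat)" "j < dim_col (0\<^sub>m n n :: 'a mat)"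
  then have ij: "i < n" "j < n" by auto
  let ?W = "eW G n D \<phi>"
  have w1: "(antidiag n * ?W\<^sup>T) $$ (i, j) = e_pair G n D \<phi> $$ (j, msize G n - 1 - i)"
    using ij by (subst antidiag_mult_index[of _ n n]) (auto simp: eW_def msize_def intro!: carrier_matI arg_cong[where f = "\<lambda>k. _ $$ (_, k)"])
  have w2: "(?W * antidiag n) $$ (i, j) = e_pair G n D \<phi> $$ (i, msize G n - 1 - j)"
    using ij by (subst mult_antidiag_index[of _ n n]) (auto simp: eW_def msize_def intro!: carrier_matI arg_cong[where f = "\<lambda>k. _ $$ (_, k)"])
  have "e_pair G n D \<phi> $$ (j, msize G n - 1 - i) = - eps G * e_pair G n D \<phi> $$ (i, msize G n - 1 - j)"
    using e_pair_skew[OF assms, of j "msize G n - 1 - i" \<phi>] ij by (simp add: msize_def)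
  then show "(antidiag n * ?W\<^sup>T + eps G \<cdot>\<^sub>m (?W * antidiag n)) $$ (i, j) = (0\<^sub>m n n :: 'a mat) $$ (i, j)"
    using ij w1 w2 by (simp del: index_mult_mat(1))
qed auto

lemma z_triple_params:
  fixes \<phi> :: "root \<Rightarrow> 'a::{field, finite}"
  assumes "D \<subseteq> Roots G n" "(2 :: 'a) \<noteq> 0"
  shows "z_triple G n D \<phi> \<in> params G n"
  unfolding z_triple_def params_iff
proof (intro conjI)
  have "e_pair G n D \<phi> $$ (i, j) = 0" if "j \<le> i" "i < n" for i j
    using e_pair_upper[OF assms(1) that(1)] that by (simp add: msize_def)
  then show "1\<^sub>m n + eN G n D \<phi> \<in> carrier (UT n)"
    by (auto simp: UT_iff eN_def)
  show "antidiag n * (eW G n D \<phi> - (1 / 2) \<cdot>\<^sub>m (ev G n D \<phi> * (ev G n D \<phi>)\<^sup>T * antidiag n))\<^sup>T +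
    eps G \<cdot>\<^sub>m ((eW G n D \<phi> - (1 / 2) \<cdot>\<^sub>m (ev G n D \<phi> * (ev G n D \<phi>)\<^sup>T * antidiag n)) * antidiag n) =
    - (ev G n D \<phi> * (ev G n D \<phi>)\<^sup>T)"
    by (rule half_relation) (use assms eW_relation in \<open>auto intro!: carrier_matI\<close>)
qed (auto intro!: carrier_matI)

lemma amat_mat3:
  assumes "x \<in> carrier_mat n n" "v \<in> carrier_mat n (middle G)" "w \<in> carrier_mat n n"
  shows "amat G n (x, v, w) = mat3 n (middle G)
    [[x - 1\<^sub>m n, v, w + (if G = O_odd then 1 / 2 else 0) \<cdot>\<^sub>m (v * v\<^sup>T * antidiag n)],
     [0\<^sub>m (middle G) n, 0\<^sub>m (middle G) (middle G), - (v\<^sup>T * antidiag n)],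
     [0\<^sub>m n n, 0\<^sub>m n (middle G), - (antidiag n * (x - 1\<^sub>m n)\<^sup>T * antidiag n)]]"
proof -
  have "w + 0 \<cdot>\<^sub>m (v * v\<^sup>T * antidiag n) = w"
    using assms by (intro eq_matI) (auto simp del: index_mult_mat(1))
  then show ?thesis
    unfolding amat_def Let_def prod.case using assms
    by (subst block3_mat3) (auto simp: blocks_iff minus_carrier_mat intro!: carrier_matI)
qed

text \<open>The upper blocks agree because the shift in \<open>z_triple\<close> is the opposite of
  the one in \<open>amat\<close>. The last column of blocks below them is recovered from the skew
  symmetry of \<open>e_pair\<close>, and the remaining entries vanish by triangularity.\<close>

lemma amat_z_triple:
  fixes \<phi> :: "root \<Rightarrow> 'a::{field, finite}"
  assumes "D \<subseteq> Roots G n" "(2 :: 'a) \<noteq> 0"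
  shows "amat G n (z_triple G n D \<phi>) = e_pair G n D \<phi>"
proof -
  let ?r = "middle G" and ?N = "eN G n D \<phi>" and ?v = "ev G n D \<phi>" and ?W = "eW G n D \<phi>" and ?J = "antidiag n :: 'a mat"
  have N: "1\<^sub>m n + ?N - 1\<^sub>m n = ?N" by (intro eq_matI) auto
  have W: "?W - (1 / 2) \<cdot>\<^sub>m (?v * ?v\<^sup>T * ?J) +
      (if G = O_odd then 1 / 2 else 0) \<cdot>\<^sub>m (?v * ?v\<^sup>T * ?J) = ?W"
  proof (cases "G = O_odd")
    case True
    then show ?thesis by (intro eq_matI) (simp_all del: index_mult_mat(1))
  next
    case False
    then have "?v * ?v\<^sup>T = 0\<^sub>m n n"
      by (intro eq_matI) (cases G; auto simp: scalar_prod_def middle_def)+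
    then have "?v * ?v\<^sup>T * ?J = 0\<^sub>m n n" by simp
    then show ?thesis using False by (intro eq_matI) simp_all
  qed
  have "amat G n (z_triple G n D \<phi>) = mat3 n ?r [[?N, ?v, ?W],
     [0\<^sub>m ?r n, 0\<^sub>m ?r ?r, - (?v\<^sup>T * ?J)], [0\<^sub>m n n, 0\<^sub>m n ?r, - (?J * ?N\<^sup>T * ?J)]]"
    unfolding z_triple_def by (subst amat_mat3) (auto simp: N W intro!: carrier_matI)
  also have "\<dots> = e_pair G n D \<phi>"
  proof (rule eq_matI)
    fix i j assume "i < dim_row (e_pair G n D \<phi>)" "j < dim_col (e_pair G n D \<phi>)"
    then have ij: "i < 2 * n + ?r" "j < 2 * n + ?r" "i < msize G n" "j < msize G n"
      by (auto simp: e_pair_def msize_def)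
    let ?e = "\<lambda>i j. e_pair G n D \<phi> $$ (i, j)"
    have r: "?r < 2" by (rule middle_less_2)
    consider "i < n" | "n \<le> i" "j < n + ?r" | "n \<le> i" "i < n + ?r" "n + ?r \<le> j" | "n + ?r \<le> i" "n + ?r \<le> j"
      by linarith
    then show "mat3 n ?r [[?N, ?v, ?W],
     [0\<^sub>m ?r n, 0\<^sub>m ?r ?r, - (?v\<^sup>T * ?J)], [0\<^sub>m n n, 0\<^sub>m n ?r, - (?J * ?N\<^sup>T * ?J)]] $$ (i, j) = ?e i j"
    proof cases
      case 1
      then show ?thesis using ij
        by (auto simp: mat3_def blk_def off_def numeral_2_eq_2 eN_def ev_def eW_def)
    next
      case 2
      then have "?e i j = 0" using ij r by (intro e_pair_upper[OF assms(1)]) auto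
      then show ?thesis using 2 ij
        by (auto simp: mat3_def blk_def off_def numeral_2_eq_2)
    next
      case 3
      then have i: "i = n" "?r = 1" using r by auto
      have "?e i j = - ?e (msize G n - 1 - j) n"
        using e_pair_skew[OF assms(1) ij(3,4), of \<phi>] i by (simp add: msize_def)
      moreover have "(?v\<^sup>T * ?J) $$ (0, j - n - 1) = ?e (msize G n - 1 - j) n"
        using i 3 ij by (subst mult_antidiag_index[of _ 1 n]) (auto simp: ev_def msize_def intro!: carrier_matI arg_cong[where f = "\<lambda>k. _ $$ (k, _)"])
      ultimately show ?thesis using 3 ij i
        by (simp add: mat3_def blk_def off_def numeral_2_eq_2 del: index_mult_mat(1))
    next
      case 4
      then have "?e i j = - ?e (msize G n - 1 - j) (msize G n - 1 - i)"
        using e_pair_skew[OF assms(1) ij(3,4), of \<phi>] by (simp add: msize_def)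
      moreover have "(?J * ?N\<^sup>T * ?J) $$ (i - n - ?r, j - n - ?r) = ?e (msize G n - 1 - j) (msize G n - 1 - i)"
      proof -
        have *: "n - 1 - (j - n - ?r) = msize G n - 1 - j" "n - 1 - (i - n - ?r) = msize G n - 1 - i"
          using 4 ij by (auto simp: msize_def)
        have "i - n - ?r < n" "j - n - ?r < n" using 4 ij by auto
        then show ?thesis
          unfolding *[symmetric] by (subst antidiag_conj_index) (auto simp: eN_def intro!: carrier_matI)
      qed
      ultimately show ?thesis using 4 ij
        by (simp add: mat3_def blk_def off_def numeral_2_eq_2 del: index_mult_mat(1))
    qed
  qed (auto simp: mat3_def e_pair_def msize_def)
  finally show ?thesis .
qed

lemma mat3_inj_row:
  assumes "mat3 n r [[A, B, C], [D, E, F], [H, K, L]] = mat3 n r [[A', B', C'], [D', E', F'], [H', K', L']]"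
    "blocks n r [[A, B, C], [D, E, F], [H, K, L]]" "blocks n r [[A', B', C'], [D', E', F'], [H', K', L']]"
  shows "A = A'" "B = B'" "C = C'"
  using mat3_inj[OF assms, of 0 0] mat3_inj[OF assms, of 0 1] mat3_inj[OF assms, of 0 2]
  by (auto simp: numeral_2_eq_2)

lemma umat_inj:
  fixes x :: "'a::{field, finite} mat"
  assumes "(x, v, w) \<in> params G n" "(x', v', w') \<in> params G n" "umat G n (x, v, w) = umat G n (x', v', w')"
  shows "(x, v, w) = (x', v', w')"
proof -
  have p: "x \<in> carrier (UT n)" "v \<in> carrier_mat n (middle G)" "w \<in> carrier_mat n n"
    and p': "x' \<in> carrier (UT n)" "v' \<in> carrier_mat n (middle G)" "w' \<in> carrier_mat n n"
    using assms by (auto simp: params_iff)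
  note i = UT_inv[OF p(1)] UT_inv[OF p'(1)]
  note c = carrier_matD[OF UT_carrier_mat[OF p(1)]] carrier_matD[OF UT_carrier_mat[OF p'(1)]]
    carrier_matD[OF UT_carrier_mat[OF i(1)]] carrier_matD[OF UT_carrier_mat[OF i(4)]]
    carrier_matD[OF p(2)] carrier_matD[OF p(3)] carrier_matD[OF p'(2)] carrier_matD[OF p'(3)]
  have bl: "blocks n (middle G) [[x, x * v, x * w],
      [0\<^sub>m (middle G) n, 1\<^sub>m (middle G), - (v\<^sup>T * antidiag n)],
      [0\<^sub>m n n, 0\<^sub>m n (middle G), antidiag n * (inv\<^bsub>UT n\<^esub> x)\<^sup>T * antidiag n]]"
    "blocks n (middle G) [[x', x' * v', x' * w'],
      [0\<^sub>m (middle G) n, 1\<^sub>m (middle G), - (v'\<^sup>T * antidiag n)],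
      [0\<^sub>m n n, 0\<^sub>m n (middle G), antidiag n * (inv\<^bsub>UT n\<^esub> x')\<^sup>T * antidiag n]]"
    unfolding blocks_iff by (auto simp: c intro!: carrier_matI)
  note eq = mat3_inj_row[OF assms(3)[unfolded umat_mat3[OF p] umat_mat3[OF p']] bl]
  have "inv\<^bsub>UT n\<^esub> x * (x * v) = inv\<^bsub>UT n\<^esub> x * (x * v')" "inv\<^bsub>UT n\<^esub> x * (x * w) = inv\<^bsub>UT n\<^esub> x * (x * w')"
    using eq(2,3) unfolding eq(1)[symmetric] by simp_all
  then have "v = v'" "w = w'" by (simp_all add: mult_cancel_dim[OF i(3)] c)
  then show ?thesis using eq(1) by simp
qed

lemma amat_inj:
  fixes x :: "'a::{field, finite} mat"
  assumes "(x, v, w) \<in> params G n" "(x', v', w') \<in> params G n" "amat G n (x, v, w) = amat G n (x', v', w')"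
  shows "(x, v, w) = (x', v', w')"
proof -
  have p: "x \<in> carrier_mat n n" "v \<in> carrier_mat n (middle G)" "w \<in> carrier_mat n n"
    and p': "x' \<in> carrier_mat n n" "v' \<in> carrier_mat n (middle G)" "w' \<in> carrier_mat n n"
    using assms UT_carrier_mat by (auto simp: params_iff)
  let ?k = "if G = O_odd then 1 / 2 else (0 :: 'a)"
  have bl: "blocks n (middle G) [[x - 1\<^sub>m n, v, w + ?k \<cdot>\<^sub>m (v * v\<^sup>T * antidiag n)],
     [0\<^sub>m (middle G) n, 0\<^sub>m (middle G) (middle G), - (v\<^sup>T * antidiag n)],
     [0\<^sub>m n n, 0\<^sub>m n (middle G), - (antidiag n * (x - 1\<^sub>m n)\<^sup>T * antidiag n)]]"
    if "x \<in> carrier_mat n n" "v \<in> carrier_mat n (middle G)" "w \<in> carrier_mat n n" for x v w :: "'a mat"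
    unfolding blocks_iff using that by (auto simp: carrier_matD[OF that(1)] carrier_matD[OF that(2)]
        carrier_matD[OF that(3)] intro!: carrier_matI)
  note * = mat3_inj_row[OF assms(3)[unfolded amat_mat3[OF p] amat_mat3[OF p']] bl[OF p] bl[OF p']]
  have add: "A = B" if "A + E = B + E" "A \<in> carrier_mat n n" "B \<in> carrier_mat n n" "E \<in> carrier_mat n n" for A B E :: "'a mat"
  proof (rule eq_matI)
    fix i j assume "i < dim_row B" "j < dim_col B"
    moreover have "(A + E) $$ (i, j) = (B + E) $$ (i, j)" using that(1) by simp
    ultimately show "A $$ (i, j) = B $$ (i, j)" using that(2-4) by simp
  qed (use that in auto)
  have "x - 1\<^sub>m n + 1\<^sub>m n = x" "x' - 1\<^sub>m n + 1\<^sub>m n = x'" using p p' by (auto intro!: eq_matI)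
  then have "x = x'" using *(1) by metis
  moreover have "w = w'"
    using *(3) unfolding *(2) by (rule add) (use p p' in \<open>auto intro!: carrier_matI\<close>)
  ultimately show ?thesis using *(2) by simp
qed

lemma a_of_umat:
  fixes t :: "'a::{field, finite} mat \<times> 'a mat \<times> 'a mat"
  assumes "t \<in> params G n"
  shows "a_of G n (umat G n t) = amat G n t"
  unfolding a_of_def
proof (rule the_equality)
  fix a assume "\<exists>t'\<in>params G n. umat G n t = umat G n t' \<and> a = amat G n t'"
  then obtain t' where t': "t' \<in> params G n" "umat G n t = umat G n t'" "a = amat G n t'" by blast
  then have "t = t'"
    using umat_inj assms by (cases t; cases t') blast
  then show "a = amat G n t" using t' by simp
qed (use assms in blast)

text \<open>Resolves the definite description: existence comes from the explicit triple, uniqueness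
  from the injectivity of \<open>amat\<close> on triples.\<close>

lemma z_rep_umat:
  fixes \<phi> :: "root \<Rightarrow> 'a::{field, finite}"
  assumes "D \<subseteq> Roots G n" "(2 :: 'a) \<noteq> 0"
  shows "z_rep G n D \<phi> = umat G n (z_triple G n D \<phi>)"
  unfolding z_rep_def
proof (rule the_equality)
  note t = z_triple_params[OF assms, of \<phi>]
  show "umat G n (z_triple G n D \<phi>) \<in> carrier (Ugrp G n) \<and> a_of G n (umat G n (z_triple G n D \<phi>)) = e_pair G n D \<phi>"
    using t by (simp add: Ugrp_def a_of_umat amat_z_triple[OF assms])
  fix z assume z: "z \<in> carrier (Ugrp G n) \<and> a_of G n z = e_pair G n D \<phi>"
  then obtain t' where t': "t' \<in> params G n" "z = umat G n t'" by (auto simp: Ugrp_def)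
  then have "amat G n t' = amat G n (z_triple G n D \<phi>)"
    using z by (simp add: a_of_umat amat_z_triple[OF assms])
  then have "t' = z_triple G n D \<phi>"
    using amat_inj t'(1) t by (cases t'; cases "z_triple G n D \<phi>") simp
  then show "z = umat G n (z_triple G n D \<phi>)" using t' by simp
qed

section \<open>Single entries of a conjugate in the columns of negative label\<close>

context conjugation
begin

lemma unit_row:
  fixes A :: "'a mat"
  assumes "A \<in> carrier_mat n k" "i < n" "l < k"
  shows "(mat 1 n (\<lambda>(_, t). if t = i then 1 else 0) * A) $$ (0, l) = A $$ (i, l)"
proof -
  have "(mat 1 n (\<lambda>(_, t). if t = i then 1 else 0) * A) $$ (0, l) =
      (\<Sum>t<n. mat 1 n (\<lambda>(_, t). if t = i then 1 else 0) $$ (0, t) * A $$ (t, l))"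
    using assms by (intro index_mult_sum) auto
  also have "\<dots> = (\<Sum>t<n. if t = i then A $$ (t, l) else 0)"
    by (intro sum.cong) auto
  finally show ?thesis using assms by simp
qed

lemma unit_row_col:
  fixes A :: "'a mat"
  assumes "A \<in> carrier_mat n n" "i < n" "j < n"
  shows "(mat 1 n (\<lambda>(_, t). if t = i then 1 else 0) * A * (mat 1 n (\<lambda>(_, t). if t = j then 1 else 0))\<^sup>T) $$ (0, 0)
    = A $$ (i, j)"
proof -
  let ?P = "mat 1 n (\<lambda>(_, t). if t = i then 1 else 0) :: 'a mat"
  let ?Q = "mat 1 n (\<lambda>(_, t). if t = j then 1 else 0) :: 'a mat"
  have "?P * A * ?Q\<^sup>T = (?Q * (?P * A)\<^sup>T)\<^sup>T"
    using assms by (simp add: transpose_mult_dim)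
  also have "\<dots> $$ (0, 0) = (?Q * (?P * A)\<^sup>T) $$ (0, 0)"
    by (subst index_transpose_mat(1)) auto
  also have "\<dots> = (?P * A)\<^sup>T $$ (j, 0)"
    using assms by (intro unit_row[of _ 1]) (auto intro!: carrier_matI)
  also have "\<dots> = (?P * A) $$ (0, j)"
    using assms by (subst index_transpose_mat(1)) auto
  also have "\<dots> = A $$ (i, j)" using assms by (intro unit_row) auto
  finally show ?thesis .
qed

text \<open>This is \<open>conj_value_blocks\<close> for unit row vectors at i and j, which may
  coincide. The signs disappear because \<open>eps G\<close> squares to 1 and equals 1 whenever a
  middle column exists.\<close>

lemma conj_value:
  assumes "i < n" "j < n" "\<And>k. k < n \<Longrightarrow> (X * (Z - 1\<^sub>m n)) $$ (i, k) = 0"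
    and "\<And>k. k < n \<Longrightarrow> (X * (Z - 1\<^sub>m n)) $$ (j, k) = 0" "r = 1 \<Longrightarrow> (X * v) $$ (j, 0) = 0"
  shows "y $$ (i, msize G n - 1 - j) =
    (X * (w * J) * X\<^sup>T) $$ (i, j) + (if r = 1 then (X * v) $$ (i, 0) * x $$ (j, n) else 0)"
proof -
  let ?P = "mat 1 n (\<lambda>(_, t). if t = i then 1 else 0) :: 'a mat"
  let ?Q = "mat 1 n (\<lambda>(_, t). if t = j then 1 else 0) :: 'a mat"
  have PA: "?P * A = 0\<^sub>m 1 k" if "A \<in> carrier_mat n k" "\<And>l. l < k \<Longrightarrow> A $$ (i, l) = 0" for A k
    using that assms(1) unit_row[OF that(1) assms(1)]
    by (intro eq_matI) (auto simp del: index_mult_mat(1))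
  have QA: "?Q * A = 0\<^sub>m 1 k" if "A \<in> carrier_mat n k" "\<And>l. l < k \<Longrightarrow> A $$ (j, l) = 0" for A k
    using that assms(2) unit_row[OF that(1) assms(2)]
    by (intro eq_matI) (auto simp del: index_mult_mat(1))
  have "?P * X * (Z - 1\<^sub>m n) = ?P * (X * (Z - 1\<^sub>m n))" "?Q * X * (Z - 1\<^sub>m n) = ?Q * (X * (Z - 1\<^sub>m n))"
    "?Q * X * v = ?Q * (X * v)"
    by (rule assoc_mult_dim; simp)+
  moreover have "?P * (X * (Z - 1\<^sub>m n)) = 0\<^sub>m 1 n" "?Q * (X * (Z - 1\<^sub>m n)) = 0\<^sub>m 1 n"
    by (rule PA QA; use assms in \<open>auto simp del: index_mult_mat(1) intro!: carrier_matI\<close>)+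
  moreover have "?Q * (X * v) = 0\<^sub>m 1 r"
  proof (rule QA)
    fix l assume "l < r"
    then have "l = 0" "r = 1" using middle_less_2[of G] by auto
    then show "(X * v) $$ (j, l) = 0" using assms(5) by simp
  qed (auto intro!: carrier_matI)
  ultimately have *: "?P * X * (Z - 1\<^sub>m n) = 0\<^sub>m 1 n" "?Q * X * (Z - 1\<^sub>m n) = 0\<^sub>m 1 n" "?Q * X * v = 0\<^sub>m 1 r"
    by simp_all
  obtain K where K: "K \<in> carrier_mat n n" "\<And>i j. i < n \<Longrightarrow> j < n \<Longrightarrow> K $$ (i, j) = y $$ (i, n + r + j)" and
    eq: "eps G \<cdot>\<^sub>m (?P * K * J * ?Q\<^sup>T) =
      eps G \<cdot>\<^sub>m (?P * X * (w * J) * (?Q * X)\<^sup>T) + ?P * X * v * (?Q * B)\<^sup>T"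
    using conj_value_blocks[OF mat_carrier mat_carrier *] by blast
  note [simp] = carrier_matD[OF K(1)]
  have "(?P * K * J * ?Q\<^sup>T) = ?P * (K * J) * ?Q\<^sup>T"
    by (simp add: mat_dim)
  then have e1: "(?P * K * J * ?Q\<^sup>T) $$ (0, 0) = (K * J) $$ (i, j)"
    using unit_row_col[of "K * J" i j] assms by (simp add: carrier_matI)
  have "?P * X * (w * J) * (?Q * X)\<^sup>T = ?P * (X * (w * J) * X\<^sup>T) * ?Q\<^sup>T"
    by (simp add: mat_dim)
  then have e2: "(?P * X * (w * J) * (?Q * X)\<^sup>T) $$ (0, 0) = (X * (w * J) * X\<^sup>T) $$ (i, j)"
    using unit_row_col[of "X * (w * J) * X\<^sup>T" i j] assms by (simp add: carrier_matI del: index_mult_mat(1))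
  have "?P * X * v * (?Q * B)\<^sup>T = ?P * (X * v * B\<^sup>T) * ?Q\<^sup>T"
    by (simp add: mat_dim)
  then have e3: "(?P * X * v * (?Q * B)\<^sup>T) $$ (0, 0) = (X * v * B\<^sup>T) $$ (i, j)"
    using unit_row_col[of "X * v * B\<^sup>T" i j] assms by (simp add: carrier_matI del: index_mult_mat(1))
  have KJ: "(K * J) $$ (i, j) = y $$ (i, msize G n - 1 - j)"
  proof -
    have "n + r + (n - 1 - j) = msize G n - 1 - j" using assms by (simp add: msize_def)
    then show ?thesis
      using K assms by (subst mult_antidiag_index[of _ n n]) auto
  qed
  have "(eps G \<cdot>\<^sub>m (?P * K * J * ?Q\<^sup>T)) $$ (0, 0) =
      (eps G \<cdot>\<^sub>m (?P * X * (w * J) * (?Q * X)\<^sup>T) + ?P * X * v * (?Q * B)\<^sup>T) $$ (0, 0)"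
    by (simp only: eq)
  then have "eps G * y $$ (i, msize G n - 1 - j) =
      eps G * (X * (w * J) * X\<^sup>T) $$ (i, j) + (X * v * B\<^sup>T) $$ (i, j)"
    unfolding e1[symmetric, unfolded KJ] e2[symmetric] e3[symmetric] by (simp del: index_mult_mat(1))
  then have "eps G * (eps G * y $$ (i, msize G n - 1 - j)) =
      eps G * (eps G * (X * (w * J) * X\<^sup>T) $$ (i, j) + (X * v * B\<^sup>T) $$ (i, j))"
    by (simp only:)
  then have main: "y $$ (i, msize G n - 1 - j) =
      (X * (w * J) * X\<^sup>T) $$ (i, j) + eps G * (X * v * B\<^sup>T) $$ (i, j)"
    by (simp add: distrib_left del: index_mult_mat(1) flip: mult.assoc)
  have "(X * v * B\<^sup>T) $$ (i, j) = (\<Sum>t<r. (X * v) $$ (i, t) * x $$ (j, n + t))"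
    using assms by (subst index_mult_sum[of _ n r _ n]) (auto intro!: carrier_matI sum.cong simp: B_def simp del: index_mult_mat(1))
  also have "eps G * \<dots> = (if r = 1 then (X * v) $$ (i, 0) * x $$ (j, n) else 0)"
    using middle_less_2[of G] by (cases G) (auto simp: middle_def eps_def simp del: index_mult_mat(1))
  finally show ?thesis unfolding main by simp
qed

end

section \<open>Products of rows of x with the matrices of single roots\<close>

lemma finite_Roots: "finite (Roots G n)"
proof -
  let ?I = "{1..int n}"
  have "\<beta> \<in> (\<lambda>(i, j). Minus i j) ` (?I \<times> ?I) \<union> (\<lambda>(i, j). Plus i j) ` (?I \<times> ?I) \<union> Twice ` ?I \<union> Single ` ?I"
    if "\<beta> \<in> Roots G n" for \<beta>
    using that by (cases rule: Roots_cases) force+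
  then have "Roots G n \<subseteq> (\<lambda>(i, j). Minus i j) ` (?I \<times> ?I) \<union> (\<lambda>(i, j). Plus i j) ` (?I \<times> ?I) \<union> Twice ` ?I \<union> Single ` ?I"
    by blast
  then show ?thesis by (rule finite_subset) auto
qed

lemma sum_unit_mat:
  fixes f :: "nat \<Rightarrow> 'a::field"
  assumes "c < msize G n"
  shows "(\<Sum>t<n. f t * unit_mat G n a b $$ (t, c)) = (if place G n a < n \<and> c = place G n b then f (place G n a) else 0)"
proof -
  have "(\<Sum>t<n. f t * unit_mat G n a b $$ (t, c)) =
      (\<Sum>t<n. if t = place G n a then (if c = place G n b then f t else 0) else 0)"
    using assms by (intro sum.cong) (auto simp: unit_mat_index msize_def)
  then show ?thesis by simp
qed

text \<open>For one root \<beta>, \<open>term_left\<close> and \<open>term_middle\<close> are the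
  entries of x times the matrix of \<beta> in row i and in column k or 0. \<open>term_right\<close>
  is the value of its upper right block, as a bilinear form, on the rows i and j. All are written
  through labelled entries Y, so that they make sense for random rows as well.\<close>

definition term_left :: "(int \<times> int \<Rightarrow> 'a::field) \<Rightarrow> int \<Rightarrow> int \<Rightarrow> root \<Rightarrow> 'a" where
  "term_left Y i k \<beta> = (case \<beta> of Minus a b \<Rightarrow> if b = k then Y (i, a) else 0 | _ \<Rightarrow> 0)"

definition term_middle :: "(int \<times> int \<Rightarrow> 'a::field) \<Rightarrow> int \<Rightarrow> root \<Rightarrow> 'a" where
  "term_middle Y i \<beta> = (case \<beta> of Single a \<Rightarrow> Y (i, a) | _ \<Rightarrow> 0)"

definition term_right :: "'a \<Rightarrow> (int \<times> int \<Rightarrow> 'a::field) \<Rightarrow> int \<Rightarrow> int \<Rightarrow> root \<Rightarrow> 'a" where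
  "term_right s Y i j \<beta> = (case \<beta> of Plus a b \<Rightarrow> Y (i, a) * Y (j, b) + s * (Y (i, b) * Y (j, a))
     | Twice a \<Rightarrow> Y (i, a) * Y (j, a) | _ \<Rightarrow> 0)"

lemma sum_root_mat_left:
  fixes x :: "'a::field mat"
  assumes "\<beta> \<in> Roots G n" "1 \<le> k" "k \<le> n" and Y: "\<And>a. 1 \<le> a \<Longrightarrow> a \<le> n \<Longrightarrow> f (a - 1) = Y (i, int a)"
  shows "(\<Sum>t<n. f t * root_mat G n \<beta> $$ (t, k - 1)) = (term_left Y i (int k) \<beta> :: 'a)"
proof -
  have k: "k - 1 < msize G n" using assms by (simp add: msize_def)
  have nm: "n \<le> msize G n" by (simp add: msize_def)
  note s = sum_unit_mat[OF k]
  have diff: "(\<Sum>t<n. f t * (A - B) $$ (t, k - 1)) = (\<Sum>t<n. f t * A $$ (t, k - 1)) - (\<Sum>t<n. f t * B $$ (t, k - 1))"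
    if "dim_row B = msize G n" "dim_col B = msize G n" for A B :: "'a mat"
    using that k nm by (simp add: right_diff_distrib sum_subtractf)
  have sum: "(\<Sum>t<n. f t * (A + B) $$ (t, k - 1)) = (\<Sum>t<n. f t * A $$ (t, k - 1)) + (\<Sum>t<n. f t * B $$ (t, k - 1))"
    if "dim_row B = msize G n" "dim_col B = msize G n" for A B :: "'a mat"
    using that k nm by (simp add: distrib_left sum.distrib)
  from assms(1) show ?thesis
  proof (cases rule: Roots_cases)
    case (1 a b)
    have "k - 1 = b - 1 \<longleftrightarrow> b = k" using 1 assms(2) by linarith
    moreover have "a - 1 < n" using 1 by linarith
    moreover have "\<not> msize G n - b < n" using 1 by (simp add: msize_def)
    ultimately show ?thesis unfolding 1(1) root_mat.simps diff[OF unit_mat_dim] s using 1(2-) Y[of a]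
      by (simp add: term_left_def place_int del: One_nat_def)
  next
    case (2 a b)
    have "k - 1 \<noteq> msize G n - a" "k - 1 \<noteq> msize G n - b"
      using 2 assms(2,3) unfolding msize_def by linarith+
    then have u: "(\<Sum>t<n. f t * unit_mat G n (int a) (- int b) $$ (t, k - 1)) = 0"
      "(\<Sum>t<n. f t * unit_mat G n (int b) (- int a) $$ (t, k - 1)) = 0"
      using 2 unfolding s by (simp_all add: place_int del: One_nat_def)
    show ?thesis
    proof (cases "G = Sp_even")
      case True
      show ?thesis unfolding 2(1) root_mat.simps if_P[OF True] sum[OF unit_mat_dim] u by (simp add: term_left_def)
    next
      case False
      show ?thesis unfolding 2(1) root_mat.simps if_not_P[OF False] diff[OF unit_mat_dim] u by (simp add: term_left_def)
    qed
  next
    case (3 a)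
    have "k - 1 \<noteq> msize G n - a" using 3 assms(2,3) unfolding msize_def by linarith
    then show ?thesis unfolding 3(1) root_mat.simps s using 3(2,3)
      by (simp add: term_left_def place_int del: One_nat_def)
  next
    case (4 a)
    have "k - 1 \<noteq> n" using assms(2,3) by linarith
    then show ?thesis unfolding 4(1) root_mat.simps diff[OF unit_mat_dim] s
      by (simp add: term_left_def place_zero del: One_nat_def)
  qed
qed

lemma sum_root_mat_middle:
  assumes "\<beta> \<in> Roots G n" "middle G = 1" and Y: "\<And>a. 1 \<le> a \<Longrightarrow> a \<le> n \<Longrightarrow> f (a - 1) = Y (i, int a)"
  shows "(\<Sum>t<n. f t * root_mat G n \<beta> $$ (t, n)) = (term_middle Y i \<beta> :: 'a::field)"
proof -
  have k: "n < msize G n" using assms by (simp add: msize_def)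
  note s = sum_unit_mat[OF k]
  have G: "G = O_odd" using assms(2) by (cases G) (auto simp: middle_def)
  have diff: "(\<Sum>t<n. f t * (A - B) $$ (t, n)) = (\<Sum>t<n. f t * A $$ (t, n)) - (\<Sum>t<n. f t * B $$ (t, n))"
    if "dim_row B = msize G n" "dim_col B = msize G n" for A B :: "'a mat"
    using that k by (simp add: right_diff_distrib sum_subtractf)
  from assms(1) show ?thesis
  proof (cases rule: Roots_cases)
    case (1 a b)
    show ?thesis unfolding 1(1) root_mat.simps diff[OF unit_mat_dim] s using 1(2-) assms(2)
      by (auto simp: term_middle_def place_int msize_def)
  next
    case (2 a b)
    have u: "(\<Sum>t<n. f t * unit_mat G n (int a) (- int b) $$ (t, n)) = 0"
      "(\<Sum>t<n. f t * unit_mat G n (int b) (- int a) $$ (t, n)) = 0"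
      using 2 assms(2) unfolding s by (auto simp: place_int msize_def)
    have G': "G \<noteq> Sp_even" using G by simp
    show ?thesis unfolding 2(1) root_mat.simps if_not_P[OF G'] diff[OF unit_mat_dim] u by (simp add: term_middle_def)
  next
    case (3 a)
    then show ?thesis using G by simp
  next
    case (4 a)
    show ?thesis unfolding 4(1) root_mat.simps diff[OF unit_mat_dim] s using Y[of a] 4(2,3) assms(2)
      by (auto simp: term_middle_def place_int place_zero msize_def)
  qed
qed

text \<open>The mirrored column index accounts for the factor J, which reverses the columns of W.
  The sign \<open>- eps G\<close> is the one of the second matrix unit for \<epsilon>_a +
  \<epsilon>_b.\<close>

lemma sum_root_mat_right:
  assumes "\<beta> \<in> Roots G n" and Y: "\<And>a. 1 \<le> a \<Longrightarrow> a \<le> n \<Longrightarrow> f (a - 1) = Y (i, int a)"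
    "\<And>a. 1 \<le> a \<Longrightarrow> a \<le> n \<Longrightarrow> g (a - 1) = Y (j, int a)"
  shows "(\<Sum>l<n. (\<Sum>t<n. f t * root_mat G n \<beta> $$ (t, msize G n - 1 - l)) * g l) =
    (term_right (- eps G) Y i j \<beta> :: 'a::field)"
proof -
  let ?S = "\<lambda>A. \<Sum>l<n. (\<Sum>t<n. f t * A $$ (t, msize G n - 1 - l)) * g l"
  have s: "?S (unit_mat G n a b) = (if place G n a < n \<and> msize G n - n \<le> place G n b \<and> place G n b < msize G n
      then f (place G n a) * g (msize G n - 1 - place G n b) else 0)" for a b
  proof -
    have "?S (unit_mat G n a b) = (\<Sum>l<n. if l = msize G n - 1 - place G n b then
        (if place G n a < n \<and> msize G n - n \<le> place G n b \<and> place G n b < msize G n then f (place G n a) * g l else 0) else 0)"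
    proof (rule sum.cong[OF refl])
      fix l assume l: "l \<in> {..<n}"
      then have "msize G n - 1 - l < msize G n" by (auto simp: msize_def)
      moreover have "msize G n - 1 - l = place G n b \<longleftrightarrow>
          l = msize G n - 1 - place G n b \<and> msize G n - n \<le> place G n b \<and> place G n b < msize G n"
        using l by (auto simp: msize_def)
      ultimately show "(\<Sum>t<n. f t * unit_mat G n a b $$ (t, msize G n - 1 - l)) * g l =
        (if l = msize G n - 1 - place G n b then
        (if place G n a < n \<and> msize G n - n \<le> place G n b \<and> place G n b < msize G n then f (place G n a) * g l else 0) else 0)"
        by (simp only: sum_unit_mat) auto
    qed
    also have "\<dots> = (if msize G n - 1 - place G n b < n \<and> place G n a < n \<and> msize G n - n \<le> place G n b \<and> place G n b < msize G n
        then f (place G n a) * g (msize G n - 1 - place G n b) else 0)"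
      by simp
    also have "\<dots> = (if place G n a < n \<and> msize G n - n \<le> place G n b \<and> place G n b < msize G n
      then f (place G n a) * g (msize G n - 1 - place G n b) else 0)"
      by (auto simp: msize_def)
    finally show ?thesis .
  qed
  have lin: "?S (A - B) = ?S A - ?S B" "?S (A + B) = ?S A + ?S B"
    if "dim_row B = msize G n" "dim_col B = msize G n" for A B :: "'a mat"
  proof -
    have "(A - B) $$ (t, msize G n - 1 - l) = A $$ (t, msize G n - 1 - l) - B $$ (t, msize G n - 1 - l)"
      "(A + B) $$ (t, msize G n - 1 - l) = A $$ (t, msize G n - 1 - l) + B $$ (t, msize G n - 1 - l)" if "t < n" for t l
      using that \<open>dim_row B = msize G n\<close> \<open>dim_col B = msize G n\<close> by (auto simp: msize_def)
    then show "?S (A - B) = ?S A - ?S B" "?S (A + B) = ?S A + ?S B"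
      by (simp_all add: right_diff_distrib left_diff_distrib distrib_left distrib_right sum_subtractf sum.distrib)
  qed
  have m: "msize G n - 1 - (msize G n - a) = a - 1" if "a \<le> n" for a using that by (simp add: msize_def)
  from assms(1) show ?thesis
  proof (cases rule: Roots_cases)
    case (1 a b)
    show ?thesis unfolding 1(1) root_mat.simps lin[OF unit_mat_dim] s using 1(2-)
      by (auto simp: term_right_def place_int msize_def)
  next
    case (2 a b)
    then have "?S (unit_mat G n (int a) (- int b)) = Y (i, int a) * Y (j, int b)"
      "?S (unit_mat G n (int b) (- int a)) = Y (i, int b) * Y (j, int a)"
      using Y(1)[of a] Y(2)[of b] Y(1)[of b] Y(2)[of a]
      unfolding s by (auto simp: place_int m simp del: diff_diff_left One_nat_def) (auto simp: msize_def)
    note u = this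
    show ?thesis
    proof (cases "G = Sp_even")
      case True
      show ?thesis unfolding 2(1) root_mat.simps if_P[OF True] lin[OF unit_mat_dim] u
        by (simp add: term_right_def eps_def True)
    next
      case False
      show ?thesis unfolding 2(1) root_mat.simps if_not_P[OF False] lin[OF unit_mat_dim] u
        by (simp add: term_right_def eps_def False)
    qed
  next
    case (3 a)
    then have "?S (unit_mat G n (int a) (- int a)) = Y (i, int a) * Y (j, int a)"
      using Y(1)[of a] Y(2)[of a]
      unfolding s by (auto simp: place_int m simp del: diff_diff_left One_nat_def) (auto simp: msize_def)
    then show ?thesis unfolding 3(1) root_mat.simps term_right_def root.case by simp
  next
    case (4 a)
    show ?thesis unfolding 4(1) root_mat.simps lin[OF unit_mat_dim] s using 4
      by (auto simp: term_right_def place_int place_zero msize_def middle_def)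
  qed
qed

section \<open>Factorisation over the roots\<close>

text \<open>One fixed x conjugating the representative. Since D enters as the set of roots of z, it
  plays the part of D' in the theorem.\<close>

locale representative =
  fixes G :: family and n :: nat and D :: "root set" and \<phi> :: "root \<Rightarrow> 'a::{field, finite}" and x :: "'a mat"
  assumes pair: "basic_pair G n D \<phi>" and two: "(2 :: 'a) \<noteq> 0" and x_in: "x \<in> iso_grp G n"
begin

lemma D_subset: "D \<subseteq> Roots G n"
  using pair by (auto simp: basic_pair_def basic_def)

lemma D_finite: "finite D"
  by (rule finite_subset[OF D_subset finite_Roots])

abbreviation "N \<equiv> eN G n D \<phi>"
abbreviation "W \<equiv> eW G n D \<phi>"

sublocale conjugation G n x "1\<^sub>m n + N" "ev G n D \<phi>"
  "W - (1 / 2) \<cdot>\<^sub>m (ev G n D \<phi> * (ev G n D \<phi>)\<^sup>T * antidiag n)"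
  by unfold_locales (rule x_in, rule z_triple_params[OF D_subset two, of \<phi>, unfolded z_triple_def])

abbreviation "V \<equiv> ev G n D \<phi>"

lemma z_eq: "z_rep G n D \<phi> = z"
  unfolding z_rep_umat[OF D_subset two] z_triple_def ..

definition "Y = (\<lambda>(k, l). entry G n x k l)"

lemma X_Y: "1 \<le> i \<Longrightarrow> i \<le> n \<Longrightarrow> 1 \<le> a \<Longrightarrow> a \<le> n \<Longrightarrow> X $$ (i - 1, a - 1) = Y (int i, int a)"
  by (simp add: X_def Y_def entry_def place_int)

lemma Z_minus: "1\<^sub>m n + N - 1\<^sub>m n = N"
  by (intro eq_matI) auto

lemma XN_index:
  assumes "1 \<le> i" "i \<le> n" "1 \<le> k" "k \<le> n"
  shows "(X * N) $$ (i - 1, k - 1) = (\<Sum>\<beta>\<in>D. \<phi> \<beta> * term_left Y (int i) (int k) \<beta>)"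
proof -
  have "(X * N) $$ (i - 1, k - 1) = (\<Sum>t<n. X $$ (i - 1, t) * N $$ (t, k - 1))"
    using assms by (intro index_mult_sum) (auto intro!: carrier_matI)
  also have "\<dots> = (\<Sum>t<n. \<Sum>\<beta>\<in>D. \<phi> \<beta> * (X $$ (i - 1, t) * root_mat G n \<beta> $$ (t, k - 1)))"
    using assms by (intro sum.cong) (auto simp: eN_def e_pair_index msize_def sum_distrib_left mult.left_commute)
  also have "\<dots> = (\<Sum>\<beta>\<in>D. \<phi> \<beta> * (\<Sum>t<n. X $$ (i - 1, t) * root_mat G n \<beta> $$ (t, k - 1)))"
    by (subst sum.swap) (simp add: sum_distrib_left)
  also have "\<dots> = (\<Sum>\<beta>\<in>D. \<phi> \<beta> * term_left Y (int i) (int k) \<beta>)"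
  proof (rule sum.cong[OF refl])
    fix \<beta> assume "\<beta> \<in> D"
    then have "\<beta> \<in> Roots G n" using D_subset by blast
    then show "\<phi> \<beta> * (\<Sum>t<n. X $$ (i - 1, t) * root_mat G n \<beta> $$ (t, k - 1)) = \<phi> \<beta> * term_left Y (int i) (int k) \<beta>"
      using sum_root_mat_left[of \<beta> G n k "\<lambda>t. X $$ (i - 1, t)" Y "int i"] assms X_Y by simp
  qed
  finally show ?thesis .
qed

lemma XV_index:
  assumes "1 \<le> i" "i \<le> n" "r = 1"
  shows "(X * V) $$ (i - 1, 0) = (\<Sum>\<beta>\<in>D. \<phi> \<beta> * term_middle Y (int i) \<beta>)"
proof -
  have "(X * V) $$ (i - 1, 0) = (\<Sum>t<n. X $$ (i - 1, t) * V $$ (t, 0))"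
    using assms by (intro index_mult_sum[of _ n _ _ 1]) (auto intro!: carrier_matI)
  also have "\<dots> = (\<Sum>t<n. \<Sum>\<beta>\<in>D. \<phi> \<beta> * (X $$ (i - 1, t) * root_mat G n \<beta> $$ (t, n)))"
    using assms by (intro sum.cong) (auto simp: ev_def e_pair_index msize_def sum_distrib_left mult.left_commute)
  also have "\<dots> = (\<Sum>\<beta>\<in>D. \<phi> \<beta> * (\<Sum>t<n. X $$ (i - 1, t) * root_mat G n \<beta> $$ (t, n)))"
    by (subst sum.swap) (simp add: sum_distrib_left)
  also have "\<dots> = (\<Sum>\<beta>\<in>D. \<phi> \<beta> * term_middle Y (int i) \<beta>)"
  proof (rule sum.cong[OF refl])
    fix \<beta> assume "\<beta> \<in> D"
    then have "\<beta> \<in> Roots G n" using D_subset by blast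
    then show "\<phi> \<beta> * (\<Sum>t<n. X $$ (i - 1, t) * root_mat G n \<beta> $$ (t, n)) = \<phi> \<beta> * term_middle Y (int i) \<beta>"
      using sum_root_mat_middle[of \<beta> G n "\<lambda>t. X $$ (i - 1, t)" Y "int i"] assms X_Y by simp
  qed
  finally show ?thesis .
qed

lemma XWX_index:
  assumes "1 \<le> i" "i \<le> n" "1 \<le> j" "j \<le> n"
  shows "(X * (W * J) * X\<^sup>T) $$ (i - 1, j - 1) =
    (\<Sum>\<beta>\<in>D. \<phi> \<beta> * term_right (- eps G) Y (int i) (int j) \<beta>)"
proof -
  have "(X * (W * J) * X\<^sup>T) $$ (i - 1, j - 1) = (\<Sum>l<n. (X * (W * J)) $$ (i - 1, l) * X\<^sup>T $$ (l, j - 1))"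
    using assms by (intro index_mult_sum) (auto intro!: carrier_matI)
  also have "\<dots> = (\<Sum>l<n. (\<Sum>t<n. X $$ (i - 1, t) * (W * J) $$ (t, l)) * X $$ (j - 1, l))"
  proof (rule sum.cong[OF refl])
    fix l assume "l \<in> {..<n}"
    moreover from this have "(X * (W * J)) $$ (i - 1, l) = (\<Sum>t<n. X $$ (i - 1, t) * (W * J) $$ (t, l))"
      using assms by (intro index_mult_sum) (auto intro!: carrier_matI)
    ultimately show "(X * (W * J)) $$ (i - 1, l) * X\<^sup>T $$ (l, j - 1) =
      (\<Sum>t<n. X $$ (i - 1, t) * (W * J) $$ (t, l)) * X $$ (j - 1, l)"
      using assms by (simp del: index_mult_mat(1))
  qed
  also have "\<dots> = (\<Sum>l<n. (\<Sum>t<n. \<Sum>\<beta>\<in>D. \<phi> \<beta> * (X $$ (i - 1, t) * root_mat G n \<beta> $$ (t, msize G n - 1 - l))) * X $$ (j - 1, l))"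
  proof (intro sum.cong refl arg_cong2[where f = "(*)"])
    fix l t assume lt: "l \<in> {..<n}" "t \<in> {..<n}"
    have "(W * J) $$ (t, l) = W $$ (t, n - 1 - l)"
      using lt by (subst mult_antidiag_index[of _ n n]) (auto intro!: carrier_matI)
    also have "\<dots> = e_pair G n D \<phi> $$ (t, msize G n - 1 - l)"
      using lt by (auto simp: eW_def msize_def intro!: arg_cong[where f = "\<lambda>k. _ $$ (_, k)"])
    also have "\<dots> = (\<Sum>\<beta>\<in>D. \<phi> \<beta> * root_mat G n \<beta> $$ (t, msize G n - 1 - l))"
      using lt by (intro e_pair_index) (auto simp: msize_def)
    finally show "X $$ (i - 1, t) * (W * J) $$ (t, l) =
        (\<Sum>\<beta>\<in>D. \<phi> \<beta> * (X $$ (i - 1, t) * root_mat G n \<beta> $$ (t, msize G n - 1 - l)))"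
      by (simp only: sum_distrib_left mult.left_commute)
  qed
  also have "\<dots> = (\<Sum>l<n. \<Sum>\<beta>\<in>D. \<phi> \<beta> * ((\<Sum>t<n. X $$ (i - 1, t) * root_mat G n \<beta> $$ (t, msize G n - 1 - l)) * X $$ (j - 1, l)))"
    by (subst sum.swap) (simp add: sum_distrib_left sum_distrib_right mult.assoc)
  also have "\<dots> = (\<Sum>\<beta>\<in>D. \<phi> \<beta> * (\<Sum>l<n. (\<Sum>t<n. X $$ (i - 1, t) * root_mat G n \<beta> $$ (t, msize G n - 1 - l)) * X $$ (j - 1, l)))"
    by (subst sum.swap) (simp only: sum_distrib_left)
  also have "\<dots> = (\<Sum>\<beta>\<in>D. \<phi> \<beta> * term_right (- eps G) Y (int i) (int j) \<beta>)"
  proof (rule sum.cong[OF refl])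
    fix \<beta> assume "\<beta> \<in> D"
    then have "\<beta> \<in> Roots G n" using D_subset by blast
    then show "\<phi> \<beta> * (\<Sum>l<n. (\<Sum>t<n. X $$ (i - 1, t) * root_mat G n \<beta> $$ (t, msize G n - 1 - l)) * X $$ (j - 1, l)) =
        \<phi> \<beta> * term_right (- eps G) Y (int i) (int j) \<beta>"
      using sum_root_mat_right[of \<beta> G n "\<lambda>t. X $$ (i - 1, t)" Y "int i" "\<lambda>l. X $$ (j - 1, l)" "int j"] assms X_Y
      by simp
  qed
  finally show ?thesis .
qed

lemma \<phi>_nonzero: "\<beta> \<in> D \<Longrightarrow> \<phi> \<beta> \<noteq> 0"
  using pair by (auto simp: basic_pair_def)

lemma basic_entries:
  assumes "\<beta> \<in> D" "\<gamma> \<in> D" "a \<in> entries \<beta>" "b \<in> entries \<gamma>" "fst a = fst b \<or> snd a = snd b"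
  shows "a = b"
proof -
  have "a \<in> Entries D" "b \<in> Entries D" using assms by (auto simp: Entries_def)
  moreover have "\<forall>a\<in>Entries D. \<forall>b\<in>Entries D. fst a = fst b \<or> snd a = snd b \<longrightarrow> a = b"
    using pair unfolding basic_pair_def basic_def by (elim conjE)
  ultimately show ?thesis using assms(5) by (meson bspec mp)
qed

text \<open>Because D is basic, at most one entry of D lies in a given column, so the sum for an
  entry of X N has at most one root contributing, with nonzero coefficient. A linear condition on
  the row thus splits into a condition for each root.\<close>

lemma row_zero_iff:
  assumes "1 \<le> i" "i \<le> n" "K \<le> n"
  shows "(\<forall>k<K. (X * N) $$ (i - 1, k) = 0) \<longleftrightarrow>
    (\<forall>\<beta>\<in>D. \<forall>a b. \<beta> = Minus a b \<and> b \<le> int K \<longrightarrow> Y (int i, a) = 0)"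
proof safe
  fix a b assume "\<forall>k<K. (X * N) $$ (i - 1, k) = 0" and m: "Minus a b \<in> D" "b \<le> int K"
  then have b: "1 \<le> b" "b \<le> int n" using D_subset assms(3) by (auto simp: Roots_def split: family.splits)
  define k where "k = nat b"
  have k: "b = int k" "1 \<le> k" "k \<le> n" "k \<le> K" using b m by (auto simp: k_def)
  have "(X * N) $$ (i - 1, k - 1) = 0" using \<open>\<forall>k<K. _\<close> k by simp
  moreover have "(X * N) $$ (i - 1, k - 1) = (\<Sum>\<beta>\<in>D. if \<beta> = Minus a b then \<phi> \<beta> * Y (int i, a) else 0)"
    unfolding XN_index[OF assms(1,2) k(2,3)]
  proof (rule sum.cong[OF refl])
    fix \<beta> assume \<beta>: "\<beta> \<in> D"
    show "\<phi> \<beta> * term_left Y (int i) (int k) \<beta> = (if \<beta> = Minus a b then \<phi> \<beta> * Y (int i, a) else 0)"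
    proof (cases "\<exists>a'. \<beta> = Minus a' b")
      case True
      then obtain a' where a': "\<beta> = Minus a' b" by blast
      then have "a' = a" using basic_entries[OF \<beta> m(1), of "(a', b)" "(a, b)"] by simp
      then show ?thesis using a' by (simp add: term_left_def k)
    next
      case False
      then show ?thesis by (cases \<beta>) (auto simp: term_left_def k)
    qed
  qed
  ultimately show "Y (int i, a) = 0" using m D_finite \<phi>_nonzero[OF m(1)] by simp
next
  fix k assume *: "\<forall>\<beta>\<in>D. \<forall>a b. \<beta> = Minus a b \<and> b \<le> int K \<longrightarrow> Y (int i, a) = 0" and k: "k < K"
  have "term_left Y (int i) (int (k + 1)) \<beta> = 0" if "\<beta> \<in> D" for \<beta>
    using that * k by (auto simp: term_left_def split: root.splits)
  then show "(X * N) $$ (i - 1, k) = 0"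
    using XN_index[OF assms(1,2), of "k + 1"] k assms(3) by simp
qed

text \<open>A basic set has at most one entry in the column 0, hence contains at most one root
  \<epsilon>_a.\<close>

lemma middle_zero_iff:
  assumes "1 \<le> i" "i \<le> n" "r = 1"
  shows "(X * V) $$ (i - 1, 0) = 0 \<longleftrightarrow> (\<forall>\<beta>\<in>D. \<forall>a. \<beta> = Single a \<longrightarrow> Y (int i, a) = 0)"
proof (cases "\<exists>a. Single a \<in> D")
  case True
  then obtain a where a: "Single a \<in> D" by blast
  have uniq: "Single a' \<in> D \<longleftrightarrow> a' = a" for a'
    using basic_entries[OF _ a, of "Single a'" "(a', 0)" "(a, 0)"] a by auto
  have "(X * V) $$ (i - 1, 0) = (\<Sum>\<beta>\<in>D. if \<beta> = Single a then \<phi> \<beta> * Y (int i, a) else 0)"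
    unfolding XV_index[OF assms]
    by (rule sum.cong[OF refl]) (auto simp: term_middle_def uniq split: root.splits)
  then have "(X * V) $$ (i - 1, 0) = \<phi> (Single a) * Y (int i, a)"
    using a D_finite by simp
  then show ?thesis using \<phi>_nonzero[OF a] uniq by auto
next
  case False
  then have "\<phi> \<beta> * term_middle Y (int i) \<beta> = 0" if "\<beta> \<in> D" for \<beta>
    using that by (auto simp: term_middle_def split: root.splits)
  then have "(X * V) $$ (i - 1, 0) = 0"
    unfolding XV_index[OF assms] by (simp add: sum.neutral del: mult_eq_0_iff)
  then show ?thesis using False by auto
qed

lemma X_Z_V:
  assumes "i < n" "r = 1" "\<And>k. k < n \<Longrightarrow> (X * N) $$ (i, k) = 0"
  shows "(X * ((1\<^sub>m n + N) * V)) $$ (i, 0) = (X * V) $$ (i, 0)"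
proof -
  have "X * ((1\<^sub>m n + N) * V) = X * V + X * N * V"
    by (simp add: mat_dim)
  moreover have "(X * N * V) $$ (i, 0) = (\<Sum>t<n. (X * N) $$ (i, t) * V $$ (t, 0))"
    using assms by (intro index_mult_sum[of _ n _ _ 1]) (auto intro!: carrier_matI)
  ultimately show ?thesis using assms by (simp del: index_mult_mat(1))
qed

text \<open>The correction with the factor 1/2 contributes a multiple of the product of the entries
  i and j of X V, and the entry j vanishes. Hence w may be replaced by the block W, which is linear
  in the roots.\<close>

lemma X_w_X:
  assumes "i < n" "j < n" "r = 1 \<Longrightarrow> (X * V) $$ (j, 0) = 0"
  shows "(X * ((W - (1 / 2) \<cdot>\<^sub>m (V * V\<^sup>T * J)) * J) * X\<^sup>T) $$ (i, j) =
    (X * (W * J) * X\<^sup>T) $$ (i, j)"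
proof -
  have "X * ((W - (1 / 2) \<cdot>\<^sub>m (V * V\<^sup>T * J)) * J) * X\<^sup>T =
      X * (W * J) * X\<^sup>T - (1 / 2) \<cdot>\<^sub>m ((X * V) * (X * V)\<^sup>T)"
    by (simp add: mat_dim)
  moreover have "((X * V) * (X * V)\<^sup>T) $$ (i, j) = (\<Sum>t<r. (X * V) $$ (i, t) * (X * V)\<^sup>T $$ (t, j))"
    using assms by (intro index_mult_sum) (auto intro!: carrier_matI)
  moreover have "(\<Sum>t<r. (X * V) $$ (i, t) * (X * V)\<^sup>T $$ (t, j)) = 0"
  proof (rule sum.neutral, rule ballI)
    fix t assume "t \<in> {..<r}"
    then have t: "t = 0" "r = 1" using middle_less_2[of G] by auto
    then have "(X * V)\<^sup>T $$ (t, j) = 0"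
      using assms by (subst index_transpose_mat(1)) (auto simp del: index_mult_mat(1))
    then show "(X * V) $$ (i, t) * (X * V)\<^sup>T $$ (t, j) = 0" by simp
  qed
  ultimately show ?thesis using assms by (simp del: index_mult_mat(1))
qed

end

text \<open>The share of \<beta> in the condition that the conjugate lies in the root subgroup of
  \<alpha>; Y stands for the rows of x. For \<epsilon>_i + \<epsilon>_j roots \<epsilon>_a constrain
  the row j only, as only there the entry in column 0 has to vanish.\<close>

definition local_cond :: "root \<Rightarrow> (int \<times> int \<Rightarrow> 'a::field) \<Rightarrow> root \<Rightarrow> bool" where
  "local_cond \<alpha> Y \<beta> = (case \<alpha> of
     Minus i j \<Rightarrow> (case \<beta> of Minus a b \<Rightarrow> b < j \<longrightarrow> Y (i, a) = 0 | _ \<Rightarrow> True)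
   | Plus i j \<Rightarrow> (case \<beta> of Minus a b \<Rightarrow> Y (i, a) = 0 \<and> Y (j, a) = 0 | Single a \<Rightarrow> Y (j, a) = 0 | _ \<Rightarrow> True)
   | Twice i \<Rightarrow> (case \<beta> of Minus a b \<Rightarrow> Y (i, a) = 0 | _ \<Rightarrow> True)
   | Single i \<Rightarrow> (case \<beta> of Minus a b \<Rightarrow> Y (i, a) = 0 | _ \<Rightarrow> True))"

text \<open>The share of \<beta> in the entry of the conjugate at the positive entry of \<alpha>, up
  to the coefficient of \<beta>. The product with Y(j, 0) arises where the column v of z meets the
  column 0 of x.\<close>

definition local_val :: "'a \<Rightarrow> root \<Rightarrow> (int \<times> int \<Rightarrow> 'a::field) \<Rightarrow> root \<Rightarrow> 'a" where
  "local_val s \<alpha> Y \<beta> = (case \<alpha> of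
     Minus i j \<Rightarrow> term_left Y i j \<beta>
   | Plus i j \<Rightarrow> term_right s Y i j \<beta> + term_middle Y i \<beta> * Y (j, 0)
   | Twice i \<Rightarrow> term_right s Y i i \<beta>
   | Single i \<Rightarrow> term_middle Y i \<beta>)"

definition local_factor ::
  "('a::field \<Rightarrow> complex) \<Rightarrow> 'a \<Rightarrow> root \<Rightarrow> 'a \<Rightarrow> 'a \<Rightarrow> root \<Rightarrow> (int \<times> int \<Rightarrow> 'a) \<Rightarrow> complex" where
  "local_factor \<theta> s \<alpha> r c \<beta> Y = (if local_cond \<alpha> Y \<beta> then \<theta> (r * (c * local_val s \<alpha> Y \<beta>)) else 0)"

lemma prod_if_all:
  "finite D \<Longrightarrow> (\<Prod>\<beta>\<in>D. if P \<beta> then f \<beta> else 0) = (if \<forall>\<beta>\<in>D. P \<beta> then \<Prod>\<beta>\<in>D. f \<beta> else (0 :: complex))"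
  by (induction D rule: finite_induct) auto

lemma label_row:
  assumes "1 \<le> i" "1 \<le> j"
  shows "(\<forall>k. int i < k \<and> k < int j \<longrightarrow> entry G n A (int i) k = 0) \<longleftrightarrow>
    (\<forall>k. i - 1 < k \<and> k < j - 1 \<longrightarrow> A $$ (i - 1, k) = 0)"
proof safe
  fix k assume *: "\<forall>k. int i < k \<and> k < int j \<longrightarrow> entry G n A (int i) k = 0" "i - 1 < k" "k < j - 1"
  have "entry G n A (int i) (int (k + 1)) = 0" using *(2,3) assms by (intro *(1)[rule_format]) linarith
  then show "A $$ (i - 1, k) = 0" using assms by (simp add: entry_def place_def nat_diff_distrib)
next
  fix k :: int assume *: "\<forall>k. i - 1 < k \<and> k < j - 1 \<longrightarrow> A $$ (i - 1, k) = 0" "int i < k" "k < int j"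
  have "A $$ (i - 1, nat k - 1) = 0" using *(2,3) assms by (intro *(1)[rule_format]) linarith
  then show "entry G n A (int i) k = 0" using assms *(2,3) by (simp add: entry_def place_def nat_diff_distrib)
qed

context representative
begin

lemma d_left_N: "i < n \<Longrightarrow> k < n \<Longrightarrow> d $$ (i, k) = (X * N) $$ (i, k)"
  using d_left[of i k] by (simp only: Z_minus)

text \<open>\<open>conjg_row\<close> passes from the conjugate to x (z - 1), and
  \<open>row_zero_iff\<close> from there to the roots. Values are claimed only for the first entry
  after the vanishing ones, where passing from one matrix to the other changes nothing.\<close>

lemma row_cond:
  assumes "1 \<le> i" "i \<le> n" "K \<le> n"
  shows "(\<forall>k. i - 1 < k \<and> k < K \<longrightarrow> y $$ (i - 1, k) = 0) \<longleftrightarrow>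
    (\<forall>\<beta>\<in>D. \<forall>a b. \<beta> = Minus a b \<and> b \<le> int K \<longrightarrow> Y (int i, a) = 0)"
    and "i - 1 < K \<Longrightarrow> K < n \<Longrightarrow> (\<forall>\<beta>\<in>D. \<forall>a b. \<beta> = Minus a b \<and> b \<le> int K \<longrightarrow> Y (int i, a) = 0) \<Longrightarrow>
      y $$ (i - 1, K) = (X * N) $$ (i - 1, K)"
    and "r = 1 \<Longrightarrow> (\<forall>\<beta>\<in>D. \<forall>a b. \<beta> = Minus a b \<and> b \<le> int n \<longrightarrow> Y (int i, a) = 0) \<Longrightarrow>
      y $$ (i - 1, n) = (X * V) $$ (i - 1, 0)"
proof -
  have m: "i - 1 < msize G n" "K \<le> msize G n" "i - 1 < n" using assms by (auto simp: msize_def)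
  have "(\<forall>k. i - 1 < k \<and> k < K \<longrightarrow> y $$ (i - 1, k) = 0) \<longleftrightarrow> (\<forall>k<K. d $$ (i - 1, k) = 0)"
    unfolding d_def by (rule conjg_row(1)[OF x_in z m(1,2)])
  also have dN: "\<dots> \<longleftrightarrow> (\<forall>k<K. (X * N) $$ (i - 1, k) = 0)"
  proof -
    have "d $$ (i - 1, k) = (X * N) $$ (i - 1, k)" if "k < K" for k
      using that assms(3) by (intro d_left_N m(3)) linarith
    then show ?thesis by (simp del: index_mult_mat(1))
  qed
  finally show "(\<forall>k. i - 1 < k \<and> k < K \<longrightarrow> y $$ (i - 1, k) = 0) \<longleftrightarrow>
    (\<forall>\<beta>\<in>D. \<forall>a b. \<beta> = Minus a b \<and> b \<le> int K \<longrightarrow> Y (int i, a) = 0)"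
    unfolding row_zero_iff[OF assms] .
  show "y $$ (i - 1, K) = (X * N) $$ (i - 1, K)"
    if "i - 1 < K" "K < n" "\<forall>\<beta>\<in>D. \<forall>a b. \<beta> = Minus a b \<and> b \<le> int K \<longrightarrow> Y (int i, a) = 0"
  proof -
    have K: "K < msize G n" using that(2) by (simp add: msize_def)
    have "\<forall>k<K. d $$ (i - 1, k) = 0"
      using that(3) unfolding dN row_zero_iff[OF assms] .
    then have "y $$ (i - 1, K) = d $$ (i - 1, K)"
      unfolding d_def by (rule conjg_row(2)[OF x_in z m(1,2) that(1) K])
    then show ?thesis unfolding d_left_N[OF m(3) that(2)] .
  qed
  show "y $$ (i - 1, n) = (X * V) $$ (i - 1, 0)"
    if "r = 1" "\<forall>\<beta>\<in>D. \<forall>a b. \<beta> = Minus a b \<and> b \<le> int n \<longrightarrow> Y (int i, a) = 0"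
  proof -
    have N0: "\<forall>k<n. (X * N) $$ (i - 1, k) = 0"
      using that(2) unfolding row_zero_iff[OF assms(1,2) order_refl] .
    then have d0: "\<forall>k<n. d $$ (i - 1, k) = 0" using d_left_N[OF m(3)] by (simp del: index_mult_mat(1))
    have n: "n \<le> msize G n" "n < msize G n" using that by (auto simp: msize_def)
    have "y $$ (i - 1, n) = d $$ (i - 1, n)"
      using d0 unfolding d_def by (rule conjg_row(2)[OF x_in z m(1) n(1) m(3) n(2)])
    also have "\<dots> = (X * V) $$ (i - 1, 0)"
      using d_middle[OF m(3) that(1)] X_Z_V[OF m(3) that(1)] N0 by simp
    finally show ?thesis .
  qed
qed

lemma Minus_le: "Minus a b \<in> D \<Longrightarrow> b \<le> int n"
  using D_subset by (auto simp: Roots_def split: family.splits)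

lemma conj_char_eq:
  "conj_char \<theta> G n \<alpha> c z x = (if y \<in> root_subgroup G n \<alpha> then root_char \<theta> G n \<alpha> c y else 0)"
  by (simp only: conj_char_def conjg_def)

lemma y_carrier: "y \<in> carrier (Ugrp G n)"
  using conjg_in_iso_grp[OF x_in z] by (simp only: carrier_Ugrp)

lemma conj_char_Minus:
  assumes "1 \<le> i" "i < j" "j \<le> n"
  shows "conj_char \<theta> G n (Minus (int i) (int j)) c z x =
    (if \<forall>\<beta>\<in>D. local_cond (Minus (int i) (int j)) Y \<beta>
     then \<theta> (c * (\<Sum>\<beta>\<in>D. \<phi> \<beta> * local_val (- eps G) (Minus (int i) (int j)) Y \<beta>)) else 0)"
proof -
  have i: "i \<le> n" "1 \<le> j" "j - 1 \<le> n" "i - 1 < j - 1" "j - 1 < n" using assms by auto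
  have cond: "(\<forall>\<beta>\<in>D. local_cond (Minus (int i) (int j)) Y \<beta>) \<longleftrightarrow>
    (\<forall>\<beta>\<in>D. \<forall>a b. \<beta> = Minus a b \<and> b \<le> int (j - 1) \<longrightarrow> Y (int i, a) = 0)"
    using i(2) by (auto simp: local_cond_def split: root.splits)
  have "y \<in> root_subgroup G n (Minus (int i) (int j)) \<longleftrightarrow> (\<forall>\<beta>\<in>D. local_cond (Minus (int i) (int j)) Y \<beta>)"
    unfolding cond row_cond(1)[OF assms(1) i(1,3), symmetric] label_row[OF assms(1) i(2), where G = G and n = n, symmetric]
    using y_carrier by simp
  moreover have "root_char \<theta> G n (Minus (int i) (int j)) c y =
      \<theta> (c * (\<Sum>\<beta>\<in>D. \<phi> \<beta> * local_val (- eps G) (Minus (int i) (int j)) Y \<beta>))"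
    if "\<forall>\<beta>\<in>D. local_cond (Minus (int i) (int j)) Y \<beta>"
  proof -
    have "root_char \<theta> G n (Minus (int i) (int j)) c y = \<theta> (c * y $$ (i - 1, j - 1))"
      using assms i by (simp add: root_char_def pos_entry_simps entry_def place_int)
    also have "y $$ (i - 1, j - 1) = (X * N) $$ (i - 1, j - 1)"
      using that unfolding cond by (rule row_cond(2)[OF assms(1) i(1,3,4,5)])
    also have "\<dots> = (\<Sum>\<beta>\<in>D. \<phi> \<beta> * local_val (- eps G) (Minus (int i) (int j)) Y \<beta>)"
      using XN_index[OF assms(1) i(1,2) assms(3)] by (simp add: local_val_def)
    finally show ?thesis .
  qed
  ultimately show ?thesis unfolding conj_char_eq by simp
qed

lemma Minus_cond:
  "(\<forall>\<beta>\<in>D. \<forall>a b. \<beta> = Minus a b \<and> b \<le> int n \<longrightarrow> Y (int i, a) = 0) \<longleftrightarrow> (\<forall>a b. Minus a b \<in> D \<longrightarrow> Y (int i, a) = 0)"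
  using Minus_le by auto

lemma row_subgroup:
  assumes "1 \<le> i" "i \<le> n"
  shows "(\<forall>k. int i < k \<and> k \<le> int n \<longrightarrow> entry G n y (int i) k = 0) \<longleftrightarrow> (\<forall>a b. Minus a b \<in> D \<longrightarrow> Y (int i, a) = 0)"
proof -
  have "(\<forall>k. int i < k \<and> k \<le> int n \<longrightarrow> entry G n y (int i) k = 0) \<longleftrightarrow>
      (\<forall>k. int i < k \<and> k < int (n + 1) \<longrightarrow> entry G n y (int i) k = 0)" by auto
  also have "\<dots> \<longleftrightarrow> (\<forall>k. i - 1 < k \<and> k < n + 1 - 1 \<longrightarrow> y $$ (i - 1, k) = 0)"
    using assms by (intro label_row) auto
  finally show ?thesis
    using row_cond(1)[OF assms, of n] unfolding Minus_cond by simp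
qed

lemma conj_char_Single:
  assumes "1 \<le> i" "i \<le> n" "G = O_odd"
  shows "conj_char \<theta> G n (Single (int i)) c z x =
    (if \<forall>\<beta>\<in>D. local_cond (Single (int i)) Y \<beta>
     then \<theta> (c * (\<Sum>\<beta>\<in>D. \<phi> \<beta> * local_val (- eps G) (Single (int i)) Y \<beta>)) else 0)"
proof -
  have r: "r = 1" using assms(3) by (simp add: middle_def)
  have cond: "(\<forall>\<beta>\<in>D. local_cond (Single (int i)) Y \<beta>) \<longleftrightarrow> (\<forall>a b. Minus a b \<in> D \<longrightarrow> Y (int i, a) = 0)"
    by (auto simp: local_cond_def split: root.splits)
  have "y \<in> root_subgroup G n (Single (int i)) \<longleftrightarrow> (\<forall>\<beta>\<in>D. local_cond (Single (int i)) Y \<beta>)"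
    unfolding cond row_subgroup[OF assms(1,2), symmetric] using y_carrier by simp
  moreover have "root_char \<theta> G n (Single (int i)) c y =
      \<theta> (c * (\<Sum>\<beta>\<in>D. \<phi> \<beta> * local_val (- eps G) (Single (int i)) Y \<beta>))"
    if "\<forall>\<beta>\<in>D. local_cond (Single (int i)) Y \<beta>"
  proof -
    have "root_char \<theta> G n (Single (int i)) c y = \<theta> (c * y $$ (i - 1, n))"
      using assms by (simp add: root_char_def pos_entry_simps entry_def place_int place_zero)
    also have "y $$ (i - 1, n) = (X * V) $$ (i - 1, 0)"
      using that unfolding cond Minus_cond[symmetric] by (rule row_cond(3)[OF assms(1,2) order_refl r])
    also have "\<dots> = (\<Sum>\<beta>\<in>D. \<phi> \<beta> * local_val (- eps G) (Single (int i)) Y \<beta>)"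
      using XV_index[OF assms(1,2) r] by (simp add: local_val_def)
    finally show ?thesis .
  qed
  ultimately show ?thesis unfolding conj_char_eq by simp
qed

text \<open>Serves \<epsilon>_i + \<epsilon>_j and, with j = i, also 2\<epsilon>_i.\<close>

lemma value_right:
  assumes "1 \<le> i" "i \<le> n" "1 \<le> j" "j \<le> n" "\<forall>a b. Minus a b \<in> D \<longrightarrow> Y (int i, a) = 0"
    "\<forall>a b. Minus a b \<in> D \<longrightarrow> Y (int j, a) = 0" "\<forall>a. Single a \<in> D \<longrightarrow> Y (int j, a) = 0"
  shows "entry G n y (int i) (- int j) =
    (\<Sum>\<beta>\<in>D. \<phi> \<beta> * (term_right (- eps G) Y (int i) (int j) \<beta> + term_middle Y (int i) \<beta> * Y (int j, 0)))"
proof -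
  have ij: "i - 1 < n" "j - 1 < n" using assms by auto
  have Ni: "(X * N) $$ (i - 1, k) = 0" if "k < n" for k
    using row_zero_iff[OF assms(1,2), of n] assms(5) that unfolding Minus_cond by simp
  have Nj: "(X * N) $$ (j - 1, k) = 0" if "k < n" for k
    using row_zero_iff[OF assms(3,4), of n] assms(6) that unfolding Minus_cond by simp
  have Vj: "(X * V) $$ (j - 1, 0) = 0" if "r = 1"
    using middle_zero_iff[OF assms(3,4) that] assms(7) by blast
  have p: "place G n (int i) = i - 1" "place G n (- int j) = msize G n - 1 - (j - 1)"
    using assms by (auto simp: place_int)
  have "entry G n y (int i) (- int j) = y $$ (i - 1, msize G n - 1 - (j - 1))"
    by (simp only: entry_def p)
  also have "\<dots> = (X * (W * J) * X\<^sup>T) $$ (i - 1, j - 1) +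
      (if r = 1 then (X * V) $$ (i - 1, 0) * x $$ (j - 1, n) else 0)"
    using conj_value[OF ij] X_w_X[OF ij] Ni Nj Vj by (simp only: Z_minus)
  also have "(X * (W * J) * X\<^sup>T) $$ (i - 1, j - 1) =
      (\<Sum>\<beta>\<in>D. \<phi> \<beta> * term_right (- eps G) Y (int i) (int j) \<beta>)"
    by (rule XWX_index[OF assms(1-4)])
  also have "(if r = 1 then (X * V) $$ (i - 1, 0) * x $$ (j - 1, n) else 0) =
      (\<Sum>\<beta>\<in>D. \<phi> \<beta> * (term_middle Y (int i) \<beta> * Y (int j, 0)))"
  proof (cases "r = 1")
    case True
    have "x $$ (j - 1, n) = Y (int j, 0)" using assms by (simp add: Y_def entry_def place_int place_zero)
    then show ?thesis using XV_index[OF assms(1,2) True] True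
      by (simp add: sum_distrib_right mult.assoc del: index_mult_mat(1))
  next
    case False
    then have "G \<noteq> O_odd" by (auto simp: middle_def)
    then have "Single a \<notin> D" for a using D_subset by (cases G) (auto simp: Roots_def)
    then have "term_middle Y (int i) \<beta> = 0" if "\<beta> \<in> D" for \<beta>
      using that by (cases \<beta>) (auto simp: term_middle_def)
    then show ?thesis using False by simp
  qed
  finally show ?thesis by (simp add: sum.distrib distrib_left)
qed

lemma second_row_subgroup:
  assumes "1 \<le> j" "j \<le> n"
  shows "(\<forall>l\<in>Idx G n. int j \<prec> l \<and> l \<preceq> 0 \<longrightarrow> entry G n y (int j) l = 0) \<longleftrightarrow>
    (\<forall>a b. Minus a b \<in> D \<longrightarrow> Y (int j, a) = 0) \<and> (\<forall>a. Single a \<in> D \<longrightarrow> Y (int j, a) = 0)"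
proof -
  have "(\<forall>l\<in>Idx G n. int j \<prec> l \<and> l \<preceq> 0 \<longrightarrow> entry G n y (int j) l = 0) \<longleftrightarrow>
      (\<forall>k. int j < k \<and> k \<le> int n \<longrightarrow> entry G n y (int j) k = 0) \<and> (G = O_odd \<longrightarrow> entry G n y (int j) 0 = 0)"
    using assms by (auto simp: Idx_def prec_def preceq_def)
  also have "\<dots> \<longleftrightarrow> (\<forall>a b. Minus a b \<in> D \<longrightarrow> Y (int j, a) = 0) \<and> (G = O_odd \<longrightarrow> entry G n y (int j) 0 = 0)"
    unfolding row_subgroup[OF assms] ..
  also have "\<dots> \<longleftrightarrow> (\<forall>a b. Minus a b \<in> D \<longrightarrow> Y (int j, a) = 0) \<and> (\<forall>a. Single a \<in> D \<longrightarrow> Y (int j, a) = 0)"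
  \<comment> \<open>The entry in column 0 equals the entry of X V only if everything between the
    diagonal and that column vanishes, so the first conjunct has to be available for the
    second.\<close>
  proof (rule conj_cong[OF refl])
    assume M: "\<forall>a b. Minus a b \<in> D \<longrightarrow> Y (int j, a) = 0"
    show "(G = O_odd \<longrightarrow> entry G n y (int j) 0 = 0) \<longleftrightarrow> (\<forall>a. Single a \<in> D \<longrightarrow> Y (int j, a) = 0)"
    proof (cases "G = O_odd")
      case True
      then have r: "r = 1" by (simp add: middle_def)
      have "entry G n y (int j) 0 = y $$ (j - 1, n)"
        using assms by (simp add: entry_def place_int place_zero)
      also have "\<dots> = (X * V) $$ (j - 1, 0)"
        using M unfolding Minus_cond[symmetric] by (rule row_cond(3)[OF assms order_refl r])
      finally show ?thesis using middle_zero_iff[OF assms r] True by auto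
    next
      case False
      then have "Single a \<notin> D" for a using D_subset by (cases G) (auto simp: Roots_def)
      then show ?thesis using False by simp
    qed
  qed
  finally show ?thesis .
qed

lemma conj_char_Plus:
  assumes "1 \<le> i" "i < j" "j \<le> n"
  shows "conj_char \<theta> G n (Plus (int i) (int j)) c z x =
    (if \<forall>\<beta>\<in>D. local_cond (Plus (int i) (int j)) Y \<beta>
     then \<theta> (c * (\<Sum>\<beta>\<in>D. \<phi> \<beta> * local_val (- eps G) (Plus (int i) (int j)) Y \<beta>)) else 0)"
proof -
  have ij: "i \<le> n" "1 \<le> j" using assms by auto
  have cond: "(\<forall>\<beta>\<in>D. local_cond (Plus (int i) (int j)) Y \<beta>) \<longleftrightarrow>
    (\<forall>a b. Minus a b \<in> D \<longrightarrow> Y (int i, a) = 0) \<and>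
    (\<forall>a b. Minus a b \<in> D \<longrightarrow> Y (int j, a) = 0) \<and> (\<forall>a. Single a \<in> D \<longrightarrow> Y (int j, a) = 0)"
    by (auto simp: local_cond_def split: root.splits)
  have "y \<in> root_subgroup G n (Plus (int i) (int j)) \<longleftrightarrow> (\<forall>\<beta>\<in>D. local_cond (Plus (int i) (int j)) Y \<beta>)"
    unfolding cond row_subgroup[OF assms(1) ij(1), symmetric] second_row_subgroup[OF ij(2) assms(3), symmetric]
    using y_carrier by simp
  moreover have "root_char \<theta> G n (Plus (int i) (int j)) c y =
      \<theta> (c * (\<Sum>\<beta>\<in>D. \<phi> \<beta> * local_val (- eps G) (Plus (int i) (int j)) Y \<beta>))"
    if "\<forall>\<beta>\<in>D. local_cond (Plus (int i) (int j)) Y \<beta>"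
    using value_right[OF assms(1) ij assms(3)] that assms ij unfolding cond
    by (simp add: root_char_def pos_entry_simps local_val_def)
  ultimately show ?thesis unfolding conj_char_eq by simp
qed

lemma conj_char_Twice:
  assumes "1 \<le> i" "i \<le> n" "G = Sp_even"
  shows "conj_char \<theta> G n (Twice (int i)) c z x =
    (if \<forall>\<beta>\<in>D. local_cond (Twice (int i)) Y \<beta>
     then \<theta> (c * (\<Sum>\<beta>\<in>D. \<phi> \<beta> * local_val (- eps G) (Twice (int i)) Y \<beta>)) else 0)"
proof -
  have S: "Single a \<notin> D" for a using D_subset assms(3) by (auto simp: Roots_def)
  then have t: "term_middle Y (int i) \<beta> = 0" if "\<beta> \<in> D" for \<beta>
    using that by (cases \<beta>) (auto simp: term_middle_def)
  have cond: "(\<forall>\<beta>\<in>D. local_cond (Twice (int i)) Y \<beta>) \<longleftrightarrow> (\<forall>a b. Minus a b \<in> D \<longrightarrow> Y (int i, a) = 0)"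
    by (auto simp: local_cond_def split: root.splits)
  have "y \<in> root_subgroup G n (Twice (int i)) \<longleftrightarrow> (\<forall>\<beta>\<in>D. local_cond (Twice (int i)) Y \<beta>)"
    unfolding cond row_subgroup[OF assms(1,2), symmetric] using y_carrier by simp
  moreover have "root_char \<theta> G n (Twice (int i)) c y =
      \<theta> (c * (\<Sum>\<beta>\<in>D. \<phi> \<beta> * local_val (- eps G) (Twice (int i)) Y \<beta>))"
    if "\<forall>\<beta>\<in>D. local_cond (Twice (int i)) Y \<beta>"
  proof -
    have "entry G n y (int i) (- int i) = (\<Sum>\<beta>\<in>D. \<phi> \<beta> * (term_right (- eps G) Y (int i) (int i) \<beta> + term_middle Y (int i) \<beta> * Y (int i, 0)))"
      using that S unfolding cond by (intro value_right assms) auto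
    also have "\<dots> = (\<Sum>\<beta>\<in>D. \<phi> \<beta> * local_val (- eps G) (Twice (int i)) Y \<beta>)"
      by (rule sum.cong) (auto simp: t local_val_def)
    finally show ?thesis using assms(1,2) by (simp add: root_char_def pos_entry_simps)
  qed
  ultimately show ?thesis unfolding conj_char_eq by simp
qed

text \<open>The condition is a conjunction over the roots of D and the value is a sum over them,
  which \<theta> turns into a product. An indicator times such a product is a product of local
  factors.\<close>

lemma conj_char_prod:
  assumes "\<alpha> \<in> Roots G n" "nontrivial_linear_char \<theta>"
  shows "conj_char \<theta> G n \<alpha> c (z_rep G n D \<phi>) x = (\<Prod>\<beta>\<in>D. local_factor \<theta> (- eps G) \<alpha> c (\<phi> \<beta>) \<beta> Y)"
proof -
  have "conj_char \<theta> G n \<alpha> c z x = (if \<forall>\<beta>\<in>D. local_cond \<alpha> Y \<beta>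
     then \<theta> (c * (\<Sum>\<beta>\<in>D. \<phi> \<beta> * local_val (- eps G) \<alpha> Y \<beta>)) else 0)"
    using assms(1)
  proof (cases rule: Roots_cases)
    case (1 i j)
    show ?thesis unfolding 1(1) by (rule conj_char_Minus[OF 1(2-4)])
  next
    case (2 i j)
    show ?thesis unfolding 2(1) by (rule conj_char_Plus[OF 2(2-4)])
  next
    case (3 i)
    show ?thesis unfolding 3(1) by (rule conj_char_Twice[OF 3(2-4)])
  next
    case (4 i)
    show ?thesis unfolding 4(1) by (rule conj_char_Single[OF 4(2-4)])
  qed
  moreover have "\<theta> (c * (\<Sum>\<beta>\<in>D. \<phi> \<beta> * local_val (- eps G) \<alpha> Y \<beta>)) =
      (\<Prod>\<beta>\<in>D. \<theta> (c * (\<phi> \<beta> * local_val (- eps G) \<alpha> Y \<beta>)))"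
    by (subst sum_distrib_left) (rule linear_char_sum[OF assms(2)])
  ultimately show ?thesis
    unfolding z_eq local_factor_def by (subst prod_if_all[OF D_finite]) simp
qed

end

section \<open>Averages of the local factors\<close>

locale averaging =
  fixes G :: family and n :: nat and \<theta> :: "'a::{field, finite} \<Rightarrow> complex" and q :: complex
  assumes char: "nontrivial_linear_char \<theta>" and two: "(2 :: 'a) \<noteq> 0" and q: "q = of_nat CARD('a)"
begin

abbreviation "E \<equiv> avg (coords G n) (range_of :: _ \<Rightarrow> 'a set)"

lemma theta_zero: "\<theta> 0 = 1"
  by (rule linear_char_zero[OF char])

lemma theta_add: "\<theta> (a + b) = \<theta> a * \<theta> b"
  using char by (simp add: nontrivial_linear_char_def)

lemma q_nonzero [simp]: "q \<noteq> 0"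
  by (simp add: q)

lemma range_props: "finite (range_of c :: 'a set)" "range_of c \<noteq> ({} :: 'a set)"
  by (auto simp: range_of_def)

lemma E_one: "E (\<lambda>_ :: int \<times> int \<Rightarrow> 'a. k) = k"
  by (rule avg_const) (auto simp: finite_coords range_props)

lemma E_fixed:
  assumes "(i, a) \<in> coords G n" "y \<in> PiE (coords G n) (range_of :: _ \<Rightarrow> 'a set)"
  shows "i = a \<Longrightarrow> y (i, a) = 1" "i \<noteq> a \<Longrightarrow> \<not> i \<prec> a \<Longrightarrow> y (i, a) = 0"
  using PiE_mem[OF assms(2,1)] by (auto simp: range_of_def split: if_splits)

text \<open>The coordinate is a separate argument of h, so that exactly the marked occurrences are
  replaced by the only value the coordinate can take.\<close>

lemma E_subst:
  fixes h :: "(int \<times> int \<Rightarrow> 'a) \<Rightarrow> 'a \<Rightarrow> complex"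
  assumes "(i, a) \<in> coords G n"
  shows "i = a \<Longrightarrow> E (\<lambda>y. h y (y (i, a))) = E (\<lambda>y. h y 1)"
    "i \<noteq> a \<Longrightarrow> \<not> i \<prec> a \<Longrightarrow> E (\<lambda>y. h y (y (i, a))) = E (\<lambda>y. h y 0)"
proof -
  show "E (\<lambda>y. h y (y (i, a))) = E (\<lambda>y. h y 1)" if "i = a"
    by (rule avg_cong) (simp only: E_fixed(1)[OF assms _ that])
  show "E (\<lambda>y. h y (y (i, a))) = E (\<lambda>y. h y 0)" if "i \<noteq> a" "\<not> i \<prec> a"
    by (rule avg_cong) (simp only: E_fixed(2)[OF assms _ that])
qed

lemma E_resample:
  fixes f :: "(int \<times> int \<Rightarrow> 'a) \<Rightarrow> complex"
  assumes "(i, a) \<in> coords G n" "i \<prec> a"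
  shows "E f = E (\<lambda>y. (\<Sum>t\<in>UNIV. f (y((i, a) := t))) / q)"
proof -
  have "i \<noteq> a" using assms(2) by (auto simp: prec_def split: if_splits)
  then have "range_of (i, a) = (UNIV :: 'a set)" using assms(2) by (simp add: range_of_def)
  then show ?thesis
    using avg_resample[OF finite_coords assms(1), of range_of f] range_props by (simp add: q)
qed

text \<open>A free entry vanishes with probability 1/q, a diagonal entry is 1 and never vanishes, an
  entry left of the diagonal is always 0. As g ignores this coordinate, it splits off.\<close>

lemma E_test:
  fixes g :: "(int \<times> int \<Rightarrow> 'a) \<Rightarrow> complex"
  assumes "(i, a) \<in> coords G n" "\<And>y t. g (y((i, a) := t)) = g y"
  shows "E (\<lambda>y. if y (i, a) = 0 then g y else 0) = (if i \<prec> a then 1 / q else if i = a then 0 else 1) * E g"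
proof -
  consider "i \<prec> a" | "\<not> i \<prec> a" "i = a" | "\<not> i \<prec> a" "i \<noteq> a" by blast
  then show ?thesis
  proof cases
    case 1
    then have "E (\<lambda>y. if y (i, a) = 0 then g y else 0) = E (\<lambda>y. (\<Sum>t\<in>(UNIV :: 'a set). if t = 0 then g y else 0) / q)"
      by (subst E_resample[OF assms(1)]) (simp_all add: assms(2) cong: if_cong del: sum.delta)
    also have "\<dots> = 1 / q * E g" by (simp add: avg_def sum_divide_distrib mult.commute)
    finally show ?thesis using 1 by simp
  next
    case 2
    show ?thesis using E_subst(1)[OF assms(1) 2(2), of "\<lambda>y t. if t = 0 then g y else 0"] 2 by (simp add: E_one)
  next
    case 3
    show ?thesis using E_subst(2)[OF assms(1) 3(2,1), of "\<lambda>y t. if t = 0 then g y else 0"] 3 by simp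
  qed
qed

text \<open>Over a free coordinate, orthogonality of characters turns \<theta> into the indicator of
  u y = 0. A fixed coordinate is replaced by its value 1 or 0.\<close>

lemma E_char:
  fixes g :: "(int \<times> int \<Rightarrow> 'a) \<Rightarrow> complex" and u :: "(int \<times> int \<Rightarrow> 'a) \<Rightarrow> 'a"
  assumes "(i, a) \<in> coords G n" "\<And>y t. g (y((i, a) := t)) = g y" "\<And>y t. u (y((i, a) := t)) = u y"
  shows "E (\<lambda>y. \<theta> (u y * y (i, a)) * g y) =
    (if i \<prec> a then E (\<lambda>y. if u y = 0 then g y else 0) else if i = a then E (\<lambda>y. \<theta> (u y) * g y) else E g)"
proof -
  consider "i \<prec> a" | "\<not> i \<prec> a" "i = a" | "\<not> i \<prec> a" "i \<noteq> a" by blast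
  then show ?thesis
  proof cases
    case 1
    then have "E (\<lambda>y. \<theta> (u y * y (i, a)) * g y) = E (\<lambda>y. (\<Sum>t\<in>UNIV. \<theta> (u y * t) * g y) / q)"
      by (subst E_resample[OF assms(1)]) (simp_all add: assms(2,3))
    also have "\<dots> = E (\<lambda>y. if u y = 0 then g y else 0)"
      by (intro avg_cong) (simp add: sum_linear_char[OF char] q flip: sum_distrib_right)
    finally show ?thesis using 1 by simp
  next
    case 2
    show ?thesis using E_subst(1)[OF assms(1) 2(2), of "\<lambda>y t. \<theta> (u y * t) * g y"] 2 by simp
  next
    case 3
    show ?thesis using E_subst(2)[OF assms(1) 3(2,1), of "\<lambda>y t. \<theta> (u y * t) * g y"] 3 by (simp add: theta_zero)
  qed
qed

lemma E_test1:
  assumes "(i, a) \<in> coords G n"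
  shows "E (\<lambda>y :: int \<times> int \<Rightarrow> 'a. if y (i, a) = 0 then 1 else 0) = (if i \<prec> a then 1 / q else if i = a then 0 else 1)"
  using E_test[OF assms, of "\<lambda>_. 1"] by (simp add: E_one)

lemma E_char1:
  assumes "(i, a) \<in> coords G n" "c \<noteq> 0"
  shows "E (\<lambda>y. \<theta> (c * y (i, a))) = (if i \<prec> a then 0 else if i = a then \<theta> c else 1)"
  using E_char[OF assms(1), of "\<lambda>_. 1" "\<lambda>_. c"] assms(2) by (simp add: E_one)

text \<open>For a free coordinate the mean of a character of a square is a quadratic Gauss sum over
  q; this case arises when both roots are of the form 2\<epsilon>.\<close>

lemma E_square:
  assumes "(i, a) \<in> coords G n" "c \<noteq> 0"
  shows "E (\<lambda>y. \<theta> (c * y (i, a) ^ 2)) =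
    (if i \<prec> a then quad_char c * gauss_sum \<theta> / q else if i = a then \<theta> c else 1)"
proof -
  consider "i \<prec> a" | "\<not> i \<prec> a" "i = a" | "\<not> i \<prec> a" "i \<noteq> a" by blast
  then show ?thesis
  proof cases
    case 1
    then have "E (\<lambda>y. \<theta> (c * y (i, a) ^ 2)) = E (\<lambda>y. (\<Sum>t\<in>UNIV. \<theta> (c * t ^ 2)) / q)"
      by (subst E_resample[OF assms(1)]) simp_all
    then show ?thesis using 1 by (simp add: sum_linear_char_square[OF char two assms(2)] E_one)
  next
    case 2
    show ?thesis using E_subst(1)[OF assms(1) 2(2), of "\<lambda>y t. \<theta> (c * t ^ 2)"] 2 by (simp add: E_one)
  next
    case 3
    show ?thesis using E_subst(2)[OF assms(1) 3(2,1), of "\<lambda>y t. \<theta> (c * t ^ 2)"] 3 by (simp add: E_one theta_zero)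
  qed
qed

end

text \<open>\<open>blocked \<alpha> \<beta>\<close> means that \<open>\<E>(\<alpha>)\<close> meets \<open>S(\<E>({\<beta>}))\<close>, and \<open>inner_count \<alpha> \<beta>\<close> is the contribution of \<open>\<beta>\<close> to
  \<open>|D'(\<alpha>)|\<close>. For \<open>\<alpha> = 2\<epsilon>\<^sub>i\<close> the two inner entries of \<open>\<beta> = \<epsilon>\<^sub>a \<plusminus> \<epsilon>\<^sub>b\<close> together cost a single factor \<open>1/q\<close>, which
  \<open>twice_factor\<close> corrects.\<close>

definition blocked :: "root \<Rightarrow> root \<Rightarrow> bool" where
  "blocked \<alpha> \<beta> = (case \<alpha> of
     Minus i j \<Rightarrow> (case \<beta> of Minus a b \<Rightarrow> a = i \<and> b < j \<or> b = j \<and> i < a | _ \<Rightarrow> False)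
   | Plus i j \<Rightarrow> (case \<beta> of Minus a b \<Rightarrow> a = i \<or> a = j | Single a \<Rightarrow> a = i \<or> a = j | Twice a \<Rightarrow> a = j
       | Plus a b \<Rightarrow> b = j \<and> i < a \<or> a = i \<and> j < b \<or> a = j)
   | Twice i \<Rightarrow> (case \<beta> of Minus a b \<Rightarrow> a = i | Plus a b \<Rightarrow> a = i | _ \<Rightarrow> False)
   | Single i \<Rightarrow> (case \<beta> of Minus a b \<Rightarrow> a = i | Single a \<Rightarrow> i < a | _ \<Rightarrow> False))"

definition inner_count :: "root \<Rightarrow> root \<Rightarrow> nat" where
  "inner_count \<alpha> \<beta> = (case \<alpha> of
     Minus i j \<Rightarrow> (case \<beta> of Minus a b \<Rightarrow> of_bool (i < a \<and> b < j) | _ \<Rightarrow> 0)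
   | Plus i j \<Rightarrow> (case \<beta> of Minus a b \<Rightarrow> of_bool (i < a) + of_bool (j < a)
       | Single a \<Rightarrow> of_bool (i < a) + of_bool (j < a) | Twice a \<Rightarrow> of_bool (j < a)
       | Plus a b \<Rightarrow> of_bool (i < a \<and> j < b) + of_bool (j < a))
   | Twice i \<Rightarrow> (case \<beta> of Minus a b \<Rightarrow> 2 * of_bool (i < a) | Plus a b \<Rightarrow> 2 * of_bool (i < a)
       | Twice a \<Rightarrow> of_bool (i < a) | Single a \<Rightarrow> 0)
   | Single i \<Rightarrow> (case \<beta> of Minus a b \<Rightarrow> of_bool (i < a) | _ \<Rightarrow> 0))"

definition twice_factor :: "('a::{field, finite} \<Rightarrow> complex) \<Rightarrow> root \<Rightarrow> 'a \<Rightarrow> root \<Rightarrow> complex" where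
  "twice_factor \<theta> \<alpha> c \<beta> = (case \<alpha> of Twice i \<Rightarrow>
     (case \<beta> of Minus a b \<Rightarrow> (if i < a then of_nat CARD('a) else 1) | Plus a b \<Rightarrow> (if i < a then of_nat CARD('a) else 1)
      | Twice a \<Rightarrow> if i < a then quad_char c * gauss_sum \<theta> else 1 | Single a \<Rightarrow> 1) | _ \<Rightarrow> 1)"

context averaging
begin

lemma coords_nat: "1 \<le> i \<Longrightarrow> i \<le> n \<Longrightarrow> 1 \<le> a \<Longrightarrow> a \<le> n \<Longrightarrow> (int i, int a) \<in> coords G n"
  by (auto simp: coords_def top_labels_iff)

lemma coords_zero: "1 \<le> i \<Longrightarrow> i \<le> n \<Longrightarrow> G = O_odd \<Longrightarrow> (int i, 0) \<in> coords G n"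
  by (auto simp: coords_def top_labels_iff)

lemma prec_int: "1 \<le> i \<Longrightarrow> 1 \<le> a \<Longrightarrow> int i \<prec> int a \<longleftrightarrow> i < a" "1 \<le> i \<Longrightarrow> int i \<prec> 0"
  by (auto simp: prec_def)

text \<open>The closed form of the average for one pair of roots; c is the product of their
  coefficients. \<open>twice_factor\<close> is the quotient by which the result deviates from one
  factor 1/q for each inner entry.\<close>

definition local_result :: "root \<Rightarrow> 'a \<Rightarrow> root \<Rightarrow> complex" where
  "local_result \<alpha> c \<beta> = (if blocked \<alpha> \<beta> then 0
     else (1 / q) ^ inner_count \<alpha> \<beta> * (if \<alpha> = \<beta> then \<theta> c else 1) * twice_factor \<theta> \<alpha> c \<beta>)"

lemmas local_simps = local_factor_def[abs_def] local_cond_def local_val_def term_left_def term_middle_def term_right_def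
  local_result_def blocked_def inner_count_def twice_factor_def[where ?'a = 'a, folded q]

text \<open>A root \<epsilon>_a - \<epsilon>_b contributes a test of Y(i, a) if b < j, a character
  in Y(i, a) if b = j, and nothing otherwise; neither do the other roots.\<close>

lemma local_avg_Minus:
  assumes "1 \<le> i" "i < j" "j \<le> n" "\<beta> \<in> Roots G n" "r \<noteq> 0" "c \<noteq> 0"
  shows "E (local_factor \<theta> s (Minus (int i) (int j)) r c \<beta>) = local_result (Minus (int i) (int j)) (r * c) \<beta>"
  using assms(4)
proof (cases rule: Roots_cases)
  case (1 a b)
  have a: "(int i, int a) \<in> coords G n" using 1 assms by (intro coords_nat; linarith)
  consider "b < j" | "b = j" | "j < b" by linarith
  then show ?thesis
  proof cases
    case 1
    then show ?thesis using \<open>\<beta> = _\<close> \<open>1 \<le> a\<close> assms E_test1[OF a]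
      by (auto simp: local_simps prec_int theta_zero fun_eq_iff cong: if_cong)
  next
    case 2
    have "E (local_factor \<theta> s (Minus (int i) (int j)) r c \<beta>) = E (\<lambda>y. \<theta> (r * c * y (int i, int a)))"
      using \<open>\<beta> = _\<close> 2 by (simp add: local_simps mult.assoc cong: if_cong)
    then show ?thesis using \<open>\<beta> = _\<close> \<open>1 \<le> a\<close> assms 2 E_char1[OF a, of "r * c"]
      by (auto simp: local_simps prec_int cong: if_cong)
  next
    case 3
    then show ?thesis using \<open>\<beta> = _\<close> by (simp add: local_simps theta_zero E_one cong: if_cong)
  qed
next
  case (2 a b)
  show ?thesis unfolding 2(1) by (simp add: local_simps theta_zero E_one cong: if_cong)
next
  case (3 a)
  show ?thesis unfolding 3(1) by (simp add: local_simps theta_zero E_one cong: if_cong)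
next
  case (4 a)
  show ?thesis unfolding 4(1) by (simp add: local_simps theta_zero E_one cong: if_cong)
qed

lemma local_avg_Single:
  assumes "1 \<le> i" "i \<le> n" "\<beta> \<in> Roots G n" "r \<noteq> 0" "c \<noteq> 0"
  shows "E (local_factor \<theta> s (Single (int i)) r c \<beta>) = local_result (Single (int i)) (r * c) \<beta>"
  using assms(3)
proof (cases rule: Roots_cases)
  case (1 a b)
  have a: "(int i, int a) \<in> coords G n" using 1 assms by (intro coords_nat; linarith)
  then show ?thesis using 1 assms E_test1[OF a]
    by (auto simp: local_simps prec_int theta_zero cong: if_cong)
next
  case (4 a)
  have a: "(int i, int a) \<in> coords G n" using 4 assms by (intro coords_nat; linarith)
  have "E (local_factor \<theta> s (Single (int i)) r c \<beta>) = E (\<lambda>y. \<theta> (r * c * y (int i, int a)))"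
    using 4 by (simp add: local_simps mult.assoc cong: if_cong)
  then show ?thesis using 4 assms E_char1[OF a, of "r * c"]
    by (auto simp: local_simps prec_int cong: if_cong)
next
  case (2 a b)
  show ?thesis unfolding 2(1) by (simp add: local_simps theta_zero E_one cong: if_cong)
next
  case (3 a)
  show ?thesis unfolding 3(1) by (simp add: local_simps theta_zero E_one cong: if_cong)
qed

text \<open>Here the row i is used twice. For \<epsilon>_a + \<epsilon>_b the value is proportional
  to 2 Y(i, a) Y(i, b), and a free Y(i, b) leaves a test of Y(i, a): one factor 1/q for the two
  inner entries when a is right of i. For 2\<epsilon>_a the value is a square.\<close>

lemma local_avg_Twice:
  assumes "1 \<le> i" "i \<le> n" "\<beta> \<in> Roots G n" "r \<noteq> 0" "c \<noteq> 0" "G = Sp_even"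
  shows "E (local_factor \<theta> 1 (Twice (int i)) r c \<beta>) = local_result (Twice (int i)) (r * c) \<beta>"
  using assms(3)
proof (cases rule: Roots_cases)
  case (1 a b)
  have a: "(int i, int a) \<in> coords G n" using 1 assms by (intro coords_nat; linarith)
  show ?thesis using 1 assms(1,2) E_test1[OF a]
    by (auto simp: local_simps prec_int theta_zero power2_eq_square cong: if_cong)
next
  case (2 a b)
  have a: "(int i, int a) \<in> coords G n" and b: "(int i, int b) \<in> coords G n"
    by (rule coords_nat; use 2 assms in linarith)+
  have ab: "(int i, int a) \<noteq> (int i, int b)" using 2 by simp
  have "E (local_factor \<theta> 1 (Twice (int i)) r c \<beta>) =
      E (\<lambda>y. \<theta> ((r * c * 2 * y (int i, int a)) * y (int i, int b)) * 1)"
    using 2(1) by (simp add: local_simps algebra_simps cong: if_cong)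
  also have "\<dots> = (if int i \<prec> int b then E (\<lambda>y. if y (int i, int a) = 0 then 1 else 0)
      else if int i = int b then E (\<lambda>y. \<theta> (r * c * 2 * y (int i, int a))) else 1)"
    using ab assms(4,5) two by (subst E_char[OF b]) (simp_all add: E_one)
  finally show ?thesis
    using 2 assms(1,2,4,5) two E_test1[OF a] E_char1[OF a, of "r * c * 2"]
    by (auto simp: local_simps prec_int power2_eq_square cong: if_cong)
next
  case (3 a)
  have a: "(int i, int a) \<in> coords G n" using 3 assms by (intro coords_nat; linarith)
  have "E (local_factor \<theta> 1 (Twice (int i)) r c \<beta>) = E (\<lambda>y. \<theta> (r * c * y (int i, int a) ^ 2))"
    using 3(1) by (simp add: local_simps mult.assoc power2_eq_square cong: if_cong)
  then show ?thesis using 3 assms(1,2,4,5) E_square[OF a, of "r * c"]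
    by (auto simp: local_simps prec_int cong: if_cong)
next
  case (4 a)
  then show ?thesis using assms(6) by simp
qed

text \<open>The rows i and j are different, so the entries met are distinct coordinates and the
  integrand is bilinear. Entries of the row j are handled first; each free one reduces the character
  to a test of an entry of the row i.\<close>

lemma local_avg_Plus:
  assumes "1 \<le> i" "i < j" "j \<le> n" "\<beta> \<in> Roots G n" "r \<noteq> 0" "c \<noteq> 0" "s \<noteq> 0"
  shows "E (local_factor \<theta> s (Plus (int i) (int j)) r c \<beta>) = local_result (Plus (int i) (int j)) (r * c) \<beta>"
  using assms(4)
proof (cases rule: Roots_cases)
  case (1 a b)
  have a: "(int i, int a) \<in> coords G n" and a': "(int j, int a) \<in> coords G n"
    by (rule coords_nat; use 1 assms in linarith)+
  have "E (local_factor \<theta> s (Plus (int i) (int j)) r c \<beta>) =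
      E (\<lambda>y. if y (int i, int a) = 0 then (if y (int j, int a) = 0 then 1 else 0) else 0)"
    using 1(1) by (intro avg_cong) (simp add: local_simps theta_zero cong: if_cong)
  also have "\<dots> = (if int i \<prec> int a then 1 / q else if int i = int a then 0 else 1) *
      (if int j \<prec> int a then 1 / q else if int j = int a then 0 else 1)"
    using assms by (subst E_test[OF a]) (simp_all add: E_test1[OF a'])
  finally show ?thesis using 1 assms(1,2)
    by (auto simp: local_simps prec_int power2_eq_square cong: if_cong)
next
  case (2 a b)
  have c: "(int i, int a) \<in> coords G n" "(int j, int a) \<in> coords G n" "(int i, int b) \<in> coords G n" "(int j, int b) \<in> coords G n"
    by (rule coords_nat; use 2 assms in linarith)+
  have ne: "a \<noteq> b" "i \<noteq> j" using 2 assms by auto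
  have "E (local_factor \<theta> s (Plus (int i) (int j)) r c \<beta>) =
      E (\<lambda>y. \<theta> ((r * c * y (int i, int a)) * y (int j, int b)) * \<theta> ((r * c * s * y (int i, int b)) * y (int j, int a)))"
    using 2(1) by (simp add: local_simps algebra_simps cong: if_cong flip: theta_add)
  \<comment> \<open>Y(j, b) is integrated out first. It is paired with Y(i, a), while Y(j, a) is
    paired with Y(i, b), so the second character stays untouched.\<close>
  also have "\<dots> = (if int j \<prec> int b then
        E (\<lambda>y. if y (int i, int a) = 0 then \<theta> ((r * c * s * y (int i, int b)) * y (int j, int a)) else 0)
      else if int j = int b then
        E (\<lambda>y. \<theta> ((r * c * s * y (int i, int b)) * y (int j, int a)) * \<theta> (r * c * y (int i, int a)))
      else E (\<lambda>y. \<theta> ((r * c * s * y (int i, int b)) * y (int j, int a)) * 1))"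
    using ne assms(5,6) by (subst E_char[OF c(4)]) (simp_all add: mult.commute)
  also have "E (\<lambda>y. if y (int i, int a) = 0 then \<theta> ((r * c * s * y (int i, int b)) * y (int j, int a)) else 0) =
      (if int i \<prec> int a then 1 / q else if int i = int a then 0 else 1) *
      E (\<lambda>y. \<theta> ((r * c * s * y (int i, int b)) * y (int j, int a)) * 1)"
    using ne by (subst E_test[OF c(1)]) simp_all
  also have "E (\<lambda>y. \<theta> ((r * c * s * y (int i, int b)) * y (int j, int a)) * 1) =
      (if int j \<prec> int a then E (\<lambda>y. if y (int i, int b) = 0 then 1 else 0)
       else if int j = int a then E (\<lambda>y. \<theta> (r * c * s * y (int i, int b))) else 1)"
    using ne assms(5,6,7) by (subst E_char[OF c(2)]) (simp_all add: E_one)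
  also have "E (\<lambda>y. \<theta> ((r * c * s * y (int i, int b)) * y (int j, int a)) * \<theta> (r * c * y (int i, int a))) =
      (if int j \<prec> int a then E (\<lambda>y. if r * c * s * y (int i, int b) = 0 then \<theta> (r * c * y (int i, int a)) else 0)
       else if int j = int a then E (\<lambda>y. \<theta> (r * c * s * y (int i, int b)) * \<theta> (r * c * y (int i, int a)))
       else E (\<lambda>y. \<theta> (r * c * y (int i, int a))))"
    using ne by (subst E_char[OF c(2)]) simp_all
  finally show ?thesis
    using 2 assms(1,2,5,6,7) E_test1[OF c(3)] E_char1[OF c(3), of "r * c * s"] E_char1[OF c(1), of "r * c"]
    by (auto simp: local_simps prec_int power2_eq_square cong: if_cong)
next
  case (3 a)
  have c: "(int i, int a) \<in> coords G n" "(int j, int a) \<in> coords G n"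
    by (rule coords_nat; use 3 assms in linarith)+
  have ne: "i \<noteq> j" using assms by auto
  have "E (local_factor \<theta> s (Plus (int i) (int j)) r c \<beta>) =
      E (\<lambda>y. \<theta> ((r * c * y (int i, int a)) * y (int j, int a)) * 1)"
    using 3(1) by (simp add: local_simps algebra_simps cong: if_cong)
  also have "\<dots> = (if int j \<prec> int a then E (\<lambda>y. if y (int i, int a) = 0 then 1 else 0)
      else if int j = int a then E (\<lambda>y. \<theta> (r * c * y (int i, int a))) else 1)"
    using ne assms(5,6) by (subst E_char[OF c(2)]) (simp_all add: E_one)
  finally show ?thesis
    using 3 assms(1,2,5,6) E_test1[OF c(1)] E_char1[OF c(1), of "r * c"]
    by (auto simp: local_simps prec_int cong: if_cong)
next
  case (4 a)
  have c: "(int i, int a) \<in> coords G n" "(int j, int a) \<in> coords G n" "(int j, 0) \<in> coords G n"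
    by (rule coords_nat coords_zero; use 4 assms in \<open>linarith | simp\<close>)+
  have ne: "i \<noteq> j" "a \<noteq> 0" using 4 assms by auto
  have "E (local_factor \<theta> s (Plus (int i) (int j)) r c \<beta>) =
      E (\<lambda>y. if y (int j, int a) = 0 then \<theta> ((r * c * y (int i, int a)) * y (int j, 0)) * 1 else 0)"
    using 4(1) by (intro avg_cong) (simp add: local_simps algebra_simps cong: if_cong)
  also have "\<dots> = (if int j \<prec> int a then 1 / q else if int j = int a then 0 else 1) *
      E (\<lambda>y. \<theta> ((r * c * y (int i, int a)) * y (int j, 0)) * 1)"
    using ne by (subst E_test[OF c(2)]) simp_all
  \<comment> \<open>The label 0 lies to the right of j, so Y(j, 0) is always free and its
    coefficient Y(i, a) is tested. This yields the second condition, although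
    \<open>local_cond\<close> constrains the row j only.\<close>
  also have "E (\<lambda>y. \<theta> ((r * c * y (int i, int a)) * y (int j, 0)) * 1) = E (\<lambda>y. if y (int i, int a) = 0 then 1 else 0)"
    using ne assms by (subst E_char[OF c(3)]) (simp_all add: prec_int)
  finally show ?thesis
    using 4 assms(1,2) E_test1[OF c(1)]
    by (auto simp: local_simps prec_int power2_eq_square cong: if_cong)
qed

lemma local_avg:
  assumes "\<alpha> \<in> Roots G n" "\<beta> \<in> Roots G n" "r \<noteq> 0" "c \<noteq> 0"
  shows "E (local_factor \<theta> (- eps G) \<alpha> r c \<beta>) = local_result \<alpha> (r * c) \<beta>"
  using assms(1)
proof (cases rule: Roots_cases)
  case (1 i j)
  then show ?thesis using local_avg_Minus assms by simp
next
  case (2 i j)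
  then show ?thesis using local_avg_Plus[of i j \<beta> r c "- eps G"] assms by (simp add: eps_def)
next
  case (3 i)
  then have "- eps G = (1 :: 'a)" by (simp add: eps_def)
  then show ?thesis using 3 local_avg_Twice[of i \<beta> r c] assms by simp
next
  case (4 i)
  then show ?thesis using local_avg_Single assms by simp
qed

end

section \<open>Independence of the factors of different roots\<close>

definition char_rows :: "root \<Rightarrow> int set" where
  "char_rows \<alpha> = (case \<alpha> of Minus i j \<Rightarrow> {i} | Plus i j \<Rightarrow> {i, j} | Twice i \<Rightarrow> {i} | Single i \<Rightarrow> {i})"

text \<open>The nonnegative labels of rows in which the matrix of \<beta> has an entry: these are
  the columns of x that its local factor can see. The label 0 for \<epsilon>_a accounts for Y(j,
  0).\<close>

definition top_support :: "root \<Rightarrow> int set" where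
  "top_support \<beta> = (case \<beta> of Minus a b \<Rightarrow> {a} | Plus a b \<Rightarrow> {a, b} | Twice a \<Rightarrow> {a} | Single a \<Rightarrow> {a, 0})"

lemma depends_on_local_factor:
  "depends_on (local_factor \<theta> s \<alpha> r c \<beta>) (char_rows \<alpha> \<times> top_support \<beta>)"
  unfolding depends_on_def
proof (intro allI impI)
  fix y y' :: "int \<times> int \<Rightarrow> 'a"
  assume "\<forall>p\<in>char_rows \<alpha> \<times> top_support \<beta>. y p = y' p"
  then show "local_factor \<theta> s \<alpha> r c \<beta> y = local_factor \<theta> s \<alpha> r c \<beta> y'"
    by (cases \<alpha>; cases \<beta>) (simp_all add: char_rows_def top_support_def local_factor_def local_cond_def local_val_def
        term_left_def term_middle_def term_right_def)
qed

lemma char_rows_coords: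
  assumes "\<alpha> \<in> Roots G n" "\<beta> \<in> Roots G n"
  shows "char_rows \<alpha> \<times> top_support \<beta> \<subseteq> coords G n"
proof -
  have "char_rows \<alpha> \<subseteq> {1..int n}"
    using assms(1) by (cases rule: Roots_cases) (auto simp: char_rows_def)
  moreover have "top_support \<beta> \<subseteq> top_labels G n"
    using assms(2) by (cases rule: Roots_cases) (auto simp: top_support_def top_labels_iff)
  ultimately show ?thesis by (auto simp: coords_def)
qed

lemma entries_disjoint:
  assumes "\<beta> \<in> Roots G n" "\<gamma> \<in> Roots G n" "e \<in> entries \<beta>" "e \<in> entries \<gamma>"
  shows "\<beta> = \<gamma>"
  by (rule Roots_cases[OF assms(1)]; rule Roots_cases[OF assms(2)]; use assms(3,4) in auto)

lemma top_support_entries: "a \<in> top_support \<beta> \<Longrightarrow> \<exists>e\<in>entries \<beta>. fst e = a"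
  by (cases \<beta>) (auto simp: top_support_def)

text \<open>A common label would give two entries of D in one row, hence one entry shared by two
  roots. It is the row condition on a basic set that makes the local factors independent.\<close>

lemma top_support_disjoint:
  assumes "basic G n D" "\<beta> \<in> D" "\<gamma> \<in> D" "\<beta> \<noteq> \<gamma>"
  shows "top_support \<beta> \<inter> top_support \<gamma> = {}"
proof (rule ccontr)
  assume "top_support \<beta> \<inter> top_support \<gamma> \<noteq> {}"
  then obtain a where a: "a \<in> top_support \<beta>" "a \<in> top_support \<gamma>" by blast
  from top_support_entries[OF a(1)] top_support_entries[OF a(2)]
  obtain e e' where e: "e \<in> entries \<beta>" "fst e = a" "e' \<in> entries \<gamma>" "fst e' = a" by blast
  then have "e \<in> Entries D" "e' \<in> Entries D" using assms(2,3) by (auto simp: Entries_def)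
  moreover have "\<forall>a\<in>Entries D. \<forall>b\<in>Entries D. fst a = fst b \<or> snd a = snd b \<longrightarrow> a = b"
    using assms(1) unfolding basic_def by (elim conjE)
  ultimately have "e = e'" using e(2,4) by simp
  moreover have "\<beta> \<in> Roots G n" "\<gamma> \<in> Roots G n" using assms(1-3) by (auto simp: basic_def)
  ultimately show False using entries_disjoint[of \<beta> G n \<gamma> e] e assms(4) by simp
qed

lemma (in averaging) elem_char_value:
  assumes "\<alpha> \<in> Roots G n" "r \<noteq> 0" "basic_pair G n D \<phi>"
  shows "elem_char \<theta> G n \<alpha> r (z_rep G n D \<phi>) =
    elem_char \<theta> G n \<alpha> r (1\<^sub>m (msize G n)) * (\<Prod>\<beta>\<in>D. local_result \<alpha> (r * \<phi> \<beta>) \<beta>)"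
proof -
  have basic: "basic G n D" and nz: "\<And>\<beta>. \<beta> \<in> D \<Longrightarrow> \<phi> \<beta> \<noteq> 0" and sub: "D \<subseteq> Roots G n"
    using assms(3) by (auto simp: basic_pair_def basic_def)
  have fin: "finite D" by (rule finite_subset[OF sub finite_Roots])
  let ?f = "\<lambda>\<beta>. local_factor \<theta> (- eps G) \<alpha> r (\<phi> \<beta>) \<beta>"
  have "conj_char \<theta> G n \<alpha> r (z_rep G n D \<phi>) x = (\<Prod>\<beta>\<in>D. ?f \<beta> (top_rows G n x))" if x: "x \<in> iso_grp G n" for x
  proof -
    \<comment> \<open>The locale concerns a single conjugating element, so it is opened afresh for
      each x of the sum.\<close>
    interpret representative G n D \<phi> x using assms(3) two x by unfold_locales
    have "conj_char \<theta> G n \<alpha> r (z_rep G n D \<phi>) x = (\<Prod>\<beta>\<in>D. ?f \<beta> Y)"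
      by (rule conj_char_prod[OF assms(1) char])
    also have "\<dots> = (\<Prod>\<beta>\<in>D. ?f \<beta> (top_rows G n x))"
    proof (rule prod.cong[OF refl])
      fix \<beta> assume "\<beta> \<in> D"
      then have "char_rows \<alpha> \<times> top_support \<beta> \<subseteq> coords G n"
        using sub by (intro char_rows_coords assms(1)) auto
      then show "?f \<beta> Y = ?f \<beta> (top_rows G n x)"
        by (intro depends_onD[OF depends_on_local_factor]) (auto simp: top_rows_def Y_def)
    qed
    finally show ?thesis .
  qed
  then have "(\<Sum>x\<in>iso_grp G n. conj_char \<theta> G n \<alpha> r (z_rep G n D \<phi>) x) / of_nat (card (iso_grp G n :: 'a mat set)) =
      (\<Sum>x\<in>iso_grp G n. \<Prod>\<beta>\<in>D. ?f \<beta> (top_rows G n x)) / of_nat (card (iso_grp G n :: 'a mat set))"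
    by simp
  also have "\<dots> = E (\<lambda>y. \<Prod>\<beta>\<in>D. ?f \<beta> y)"
    by (rule iso_grp_average[OF two])
  also have "\<dots> = (\<Prod>\<beta>\<in>D. E (?f \<beta>))"
  proof (rule avg_prod_indep[where S = "\<lambda>\<beta>. char_rows \<alpha> \<times> top_support \<beta>"])
    fix \<beta> \<gamma> assume "\<beta> \<in> D" "\<gamma> \<in> D" "\<beta> \<noteq> \<gamma>"
    then show "char_rows \<alpha> \<times> top_support \<beta> \<inter> char_rows \<alpha> \<times> top_support \<gamma> = {}"
      using top_support_disjoint[OF basic, of \<beta> \<gamma>] by (simp add: Times_Int_Times)
  qed (use fin in \<open>auto simp: finite_coords depends_on_local_factor range_props\<close>)
  also have "\<dots> = (\<Prod>\<beta>\<in>D. local_result \<alpha> (r * \<phi> \<beta>) \<beta>)"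
    by (rule prod.cong[OF refl], rule local_avg) (use assms(1,2) sub nz in auto)
  finally show ?thesis
    by (subst elem_char_average[of \<alpha> G n \<theta> r, OF assms(1) theta_zero]) simp
qed

section \<open>The combinatorial data\<close>

definition inner_of :: "nat \<Rightarrow> root \<Rightarrow> root \<Rightarrow> (int \<times> int) set" where
  "inner_of n \<alpha> \<beta> = {e \<in> entries \<beta>. fst (pos_entry n \<alpha>) \<prec> fst e \<and> fst e \<prec> snd e \<and> snd e \<prec> snd (pos_entry n \<alpha>)}"

lemma inner_UN: "inner n D \<alpha> = (\<Union>\<beta>\<in>D. inner_of n \<alpha> \<beta>)"
  by (cases "pos_entry n \<alpha>") (auto simp: inner_def inner_of_def Entries_def)

lemma finite_entries: "finite (entries \<beta>)"
  by (cases \<beta>) auto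

lemma card_inner_of:
  assumes "\<alpha> \<in> Roots G n" "\<beta> \<in> Roots G n"
  shows "card (inner_of n \<alpha> \<beta>) = inner_count \<alpha> \<beta>"
proof -
  have card: "card (inner_of n \<alpha> \<beta>) = (\<Sum>e\<in>entries \<beta>.
      if fst (pos_entry n \<alpha>) \<prec> fst e \<and> fst e \<prec> snd e \<and> snd e \<prec> snd (pos_entry n \<alpha>) then 1 else 0)"
    unfolding inner_of_def card_eq_sum by (rule sum.inter_filter[OF finite_entries])
  show ?thesis
    unfolding card by (rule Roots_cases[OF assms(1)]; rule Roots_cases[OF assms(2)])
      (auto simp: pos_entry_simps inner_count_def prec_def)
qed

lemma entries_Idx:
  assumes "\<alpha> \<in> Roots G n" "(k, l) \<in> entries \<alpha>"
  shows "k \<in> Idx G n" "l \<in> Idx G n"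
proof -
  from assms(1) have "k \<in> Idx G n \<and> l \<in> Idx G n"
    by (cases rule: Roots_cases) (use assms(2) in \<open>auto simp: Idx_def\<close>)
  then show "k \<in> Idx G n" "l \<in> Idx G n" by auto
qed

text \<open>The outer bounds in the definition of \<open>sing\<close> hold for every label, since 1
  is the first and -1 the last in the order.\<close>

lemma sing_iff:
  assumes "k \<in> Idx G n" "l \<in> Idx G n"
  shows "(k, l) \<in> sing G n D \<longleftrightarrow> (\<exists>(i, j)\<in>Entries D. k = i \<and> j \<prec> l \<or> l = j \<and> k \<prec> i)"
proof -
  have "l \<preceq> -1" "1 \<preceq> k" using assms by (auto simp: Idx_def prec_def preceq_def split: if_splits)
  then show ?thesis using assms unfolding sing_def by fastforce
qed

text \<open>A comparison of entries for each pair of root types. It identifies the vanishing cases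
  of the averages with the singular positions.\<close>

lemma blocked_iff:
  assumes "\<alpha> \<in> Roots G n" "\<beta> \<in> Roots G n"
  shows "blocked \<alpha> \<beta> \<longleftrightarrow>
    (\<exists>(k, l)\<in>entries \<alpha>. \<exists>(i, j)\<in>entries \<beta>. k = i \<and> j \<prec> l \<or> l = j \<and> k \<prec> i)"
  by (rule Roots_cases[OF assms(1)]; rule Roots_cases[OF assms(2)]) (auto simp: blocked_def prec_def)

lemma reg_roots_iff:
  assumes "\<alpha> \<in> Roots G n" "D \<subseteq> Roots G n"
  shows "\<alpha> \<in> reg_roots G n D \<longleftrightarrow> (\<forall>\<beta>\<in>D. \<not> blocked \<alpha> \<beta>)"
proof -
  have "entries \<alpha> \<subseteq> Entries (Roots G n)" using assms(1) by (auto simp: Entries_def)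
  then have "\<alpha> \<in> reg_roots G n D \<longleftrightarrow> (\<forall>(k, l)\<in>entries \<alpha>. (k, l) \<notin> sing G n D)"
    using assms(1) by (auto simp: reg_roots_def)
  also have "\<dots> \<longleftrightarrow> (\<forall>(k, l)\<in>entries \<alpha>. \<not> (\<exists>(i, j)\<in>Entries D. k = i \<and> j \<prec> l \<or> l = j \<and> k \<prec> i))"
    using sing_iff entries_Idx[OF assms(1)] by (intro ball_cong refl) auto
  also have "\<dots> \<longleftrightarrow> (\<forall>\<beta>\<in>D. \<not> (\<exists>(k, l)\<in>entries \<alpha>. \<exists>(i, j)\<in>entries \<beta>. k = i \<and> j \<prec> l \<or> l = j \<and> k \<prec> i))"
    unfolding Entries_def by blast
  also have "\<dots> \<longleftrightarrow> (\<forall>\<beta>\<in>D. \<not> blocked \<alpha> \<beta>)"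
  proof (intro ball_cong refl)
    fix \<beta> assume "\<beta> \<in> D"
    then have "\<beta> \<in> Roots G n" using assms(2) by auto
    then show "(\<not> (\<exists>(k, l)\<in>entries \<alpha>. \<exists>(i, j)\<in>entries \<beta>. k = i \<and> j \<prec> l \<or> l = j \<and> k \<prec> i)) \<longleftrightarrow> \<not> blocked \<alpha> \<beta>"
      by (simp only: blocked_iff[OF assms(1)])
  qed
  finally show ?thesis .
qed

lemma card_inner:
  assumes "\<alpha> \<in> Roots G n" "D \<subseteq> Roots G n"
  shows "card (inner n D \<alpha>) = (\<Sum>\<beta>\<in>D. inner_count \<alpha> \<beta>)"
proof -
  have sub: "inner_of n \<alpha> \<beta> \<subseteq> entries \<beta>" for \<beta>
    by (auto simp: inner_of_def)
  have "card (inner n D \<alpha>) = (\<Sum>\<beta>\<in>D. card (inner_of n \<alpha> \<beta>))"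
    unfolding inner_UN
  proof (rule card_UN_disjoint)
    show "finite D" by (rule finite_subset[OF assms(2) finite_Roots])
    show "\<forall>\<beta>\<in>D. finite (inner_of n \<alpha> \<beta>)" using finite_subset[OF sub finite_entries] by blast
    show "\<forall>\<beta>\<in>D. \<forall>\<gamma>\<in>D. \<beta> \<noteq> \<gamma> \<longrightarrow> inner_of n \<alpha> \<beta> \<inter> inner_of n \<alpha> \<gamma> = {}"
    proof (intro ballI impI)
      fix \<beta> \<gamma> assume *: "\<beta> \<in> D" "\<gamma> \<in> D" "\<beta> \<noteq> \<gamma>"
      then have "\<beta> \<in> Roots G n" "\<gamma> \<in> Roots G n" using assms(2) by auto
      then have "entries \<beta> \<inter> entries \<gamma> = {}" using entries_disjoint *(3) by (metis disjoint_iff)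
      then show "inner_of n \<alpha> \<beta> \<inter> inner_of n \<alpha> \<gamma> = {}" using sub[of \<beta>] sub[of \<gamma>] by blast
    qed
  qed
  also have "\<dots> = (\<Sum>\<beta>\<in>D. inner_count \<alpha> \<beta>)"
    by (rule sum.cong[OF refl], rule card_inner_of[OF assms(1)]) (use assms(2) in auto)
  finally show ?thesis .
qed

text \<open>Counts the roots of D with two entries inside those of \<alpha> = 2\<epsilon>_i that
  cost only a single factor 1/q. It is the exponent of q by which the naive count has to be
  corrected.\<close>

definition half_inner :: "root set \<Rightarrow> root \<Rightarrow> nat" where
  "half_inner D \<alpha> = card {\<beta> \<in> D. \<exists>i a b. \<alpha> = Twice i \<and> (\<beta> = Minus a b \<or> \<beta> = Plus a b) \<and> i < a}"

lemma inner_twices_Twice: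
  assumes "D \<subseteq> Roots G n"
  shows "inner_twices n D (Twice i) = {\<beta> \<in> D. \<exists>k. \<beta> = Twice k \<and> i < k}"
proof -
  have "k \<le> int n" if "Twice k \<in> D" for k
    using that assms by (auto simp: Roots_def split: family.splits)
  then show ?thesis by (auto simp: inner_twices_def)
qed

text \<open>Inside 2\<epsilon>_i, roots \<epsilon>_a \<plusminus> \<epsilon>_b have two entries and
  roots 2\<epsilon>_a only one. Hence the exponent with the factor 1/2 in the constant c is an
  integer.\<close>

lemma card_inner_Twice:
  assumes "Twice i \<in> Roots G n" "D \<subseteq> Roots G n"
  shows "card (inner n D (Twice i)) = 2 * half_inner D (Twice i) + card (inner_twices n D (Twice i))"
proof -
  let ?A = "{\<beta> \<in> D. \<exists>a b. (\<beta> = Minus a b \<or> \<beta> = Plus a b) \<and> i < a}" and ?T = "{\<beta> \<in> D. \<exists>k. \<beta> = Twice k \<and> i < k}"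
  have fin: "finite D" by (rule finite_subset[OF assms(2) finite_Roots])
  have "card (inner n D (Twice i)) = (\<Sum>\<beta>\<in>D. inner_count (Twice i) \<beta>)"
    by (rule card_inner[OF assms])
  also have "\<dots> = (\<Sum>\<beta>\<in>D. 2 * (if \<exists>a b. (\<beta> = Minus a b \<or> \<beta> = Plus a b) \<and> i < a then 1 else 0) +
      (if \<exists>k. \<beta> = Twice k \<and> i < k then 1 else 0))"
  proof (rule sum.cong[OF refl])
    fix \<beta>
    show "inner_count (Twice i) \<beta> = 2 * (if \<exists>a b. (\<beta> = Minus a b \<or> \<beta> = Plus a b) \<and> i < a then 1 else 0) +
      (if \<exists>k. \<beta> = Twice k \<and> i < k then 1 else 0)"
      by (cases \<beta>) (auto simp: inner_count_def)
  qed
  also have "\<dots> = 2 * card ?A + card ?T"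
    unfolding card_eq_sum sum.inter_filter[OF fin] sum.distrib sum_distrib_left ..
  finally show ?thesis
    unfolding inner_twices_Twice[OF assms(2)] half_inner_def by simp
qed

text \<open>The correction factors for one \<alpha> are separated by the type of \<beta>:
  \<epsilon>_a \<plusminus> \<epsilon>_b gives powers of q, and 2\<epsilon>_a gives Gauss sums with
  quadratic characters.\<close>

lemma prod_twice_factor:
  assumes "Twice i \<in> Roots G n" "D \<subseteq> Roots G n" "r \<noteq> 0"
  shows "(\<Prod>\<beta>\<in>D. twice_factor \<theta> (Twice i) (r * \<phi> \<beta>) \<beta>) =
    of_nat CARD('a::{field, finite}) ^ half_inner D (Twice i) * gauss_sum \<theta> ^ card (inner_twices n D (Twice i)) *
    (\<Prod>\<beta>\<in>inner_twices n D (Twice i). quad_char (inverse r * \<phi> \<beta> :: 'a))"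
proof -
  let ?P = "\<lambda>\<beta>. \<exists>a b. (\<beta> = Minus a b \<or> \<beta> = Plus a b) \<and> i < a" and ?Q = "\<lambda>\<beta>. \<exists>k. \<beta> = Twice k \<and> i < k"
  have fin: "finite D" by (rule finite_subset[OF assms(2) finite_Roots])
  have "(\<Prod>\<beta>\<in>D. twice_factor \<theta> (Twice i) (r * \<phi> \<beta>) \<beta>) =
      (\<Prod>\<beta>\<in>D. (if ?P \<beta> then of_nat CARD('a) else 1) *
        (if ?Q \<beta> then gauss_sum \<theta> * quad_char (inverse r * \<phi> \<beta>) else 1))"
  proof (rule prod.cong[OF refl])
    fix \<beta>
    show "twice_factor \<theta> (Twice i) (r * \<phi> \<beta>) \<beta> = (if ?P \<beta> then of_nat CARD('a) else 1) *
        (if ?Q \<beta> then gauss_sum \<theta> * quad_char (inverse r * \<phi> \<beta>) else 1)"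
      by (cases \<beta>) (auto simp: twice_factor_def quad_char_inverse_mult[OF assms(3)])
  qed
  also have "\<dots> = (\<Prod>\<beta>\<in>{\<beta> \<in> D. ?P \<beta>}. of_nat CARD('a)) *
      (\<Prod>\<beta>\<in>{\<beta> \<in> D. ?Q \<beta>}. gauss_sum \<theta> * quad_char (inverse r * \<phi> \<beta>))"
    unfolding prod.distrib[of _ _ D] prod.inter_filter[OF fin] ..
  finally show ?thesis
    unfolding inner_twices_Twice[OF assms(2)] half_inner_def by (simp add: prod.distrib mult.assoc)
qed

section \<open>Assembly of the character formula\<close>

lemma (in averaging) prod_local_result:
  assumes "\<alpha> \<in> Roots G n" "D \<subseteq> Roots G n"
  shows "(\<Prod>\<beta>\<in>D. local_result \<alpha> (r * \<phi> \<beta>) \<beta>) = (if \<alpha> \<in> reg_roots G n D then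
    (1 / q) ^ card (inner n D \<alpha>) * (if \<alpha> \<in> D then \<theta> (r * \<phi> \<alpha>) else 1) *
    (\<Prod>\<beta>\<in>D. twice_factor \<theta> \<alpha> (r * \<phi> \<beta>) \<beta>) else 0)"
proof -
  have fin: "finite D" by (rule finite_subset[OF assms(2) finite_Roots])
  show ?thesis
  proof (cases "\<alpha> \<in> reg_roots G n D")
    case True
    then have "(\<Prod>\<beta>\<in>D. local_result \<alpha> (r * \<phi> \<beta>) \<beta>) = (\<Prod>\<beta>\<in>D. (1 / q) ^ inner_count \<alpha> \<beta> *
        (if \<alpha> = \<beta> then \<theta> (r * \<phi> \<beta>) else 1) * twice_factor \<theta> \<alpha> (r * \<phi> \<beta>) \<beta>)"
      unfolding reg_roots_iff[OF assms] by (intro prod.cong) (auto simp: local_result_def)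
    also have "\<dots> = (1 / q) ^ card (inner n D \<alpha>) * (if \<alpha> \<in> D then \<theta> (r * \<phi> \<alpha>) else 1) *
        (\<Prod>\<beta>\<in>D. twice_factor \<theta> \<alpha> (r * \<phi> \<beta>) \<beta>)"
      unfolding prod.distrib card_inner[OF assms] power_sum using fin by simp
    finally show ?thesis using True by simp
  next
    case False
    then have "\<exists>\<beta>\<in>D. blocked \<alpha> \<beta>" unfolding reg_roots_iff[OF assms] by blast
    then show ?thesis using False fin by (auto simp: local_result_def intro!: prod_zero)
  qed
qed

lemma (in averaging) superchar_value:
  assumes D: "basic_pair G n D \<phi>" and D': "basic_pair G n D' \<phi>'"
  shows "superchar \<theta> G n D \<phi> (z_rep G n D' \<phi>') =
    (if D \<subseteq> reg_roots G n D'
     then of_nat CARD('a) powi (- int (t_num n D D')) * superchar \<theta> G n D \<phi> (1\<^sub>m (msize G n)) *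
       c_factor \<theta> n D \<phi> D' \<phi>' * (\<Prod>\<alpha>\<in>D \<inter> D'. \<theta> (\<phi> \<alpha> * \<phi>' \<alpha>))
     else 0)"
proof -
  have sub: "D \<subseteq> Roots G n" "D' \<subseteq> Roots G n" and nz: "\<And>\<alpha>. \<alpha> \<in> D \<Longrightarrow> \<phi> \<alpha> \<noteq> 0"
    using D D' by (auto simp: basic_pair_def basic_def)
  have fin: "finite D" "finite D'" by (rule finite_subset[OF sub(1) finite_Roots], rule finite_subset[OF sub(2) finite_Roots])
  let ?e1 = "\<lambda>\<alpha>. elem_char \<theta> G n \<alpha> (\<phi> \<alpha>) (1\<^sub>m (msize G n))"
  let ?tw = "\<lambda>\<alpha>. \<Prod>\<beta>\<in>D'. twice_factor \<theta> \<alpha> (\<phi> \<alpha> * \<phi>' \<beta>) \<beta>"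
  let ?R = "\<lambda>\<alpha>. (1 / q) ^ card (inner n D' \<alpha>) * (if \<alpha> \<in> D' then \<theta> (\<phi> \<alpha> * \<phi>' \<alpha>) else 1) * ?tw \<alpha>"
  have "superchar \<theta> G n D \<phi> (z_rep G n D' \<phi>') =
      (\<Prod>\<alpha>\<in>D. if \<alpha> \<in> reg_roots G n D' then ?e1 \<alpha> * ?R \<alpha> else 0)"
    unfolding superchar_def
  proof (rule prod.cong[OF refl])
    fix \<alpha> assume "\<alpha> \<in> D"
    then have \<alpha>: "\<alpha> \<in> Roots G n" "\<phi> \<alpha> \<noteq> 0" using sub nz by auto
    show "elem_char \<theta> G n \<alpha> (\<phi> \<alpha>) (z_rep G n D' \<phi>') = (if \<alpha> \<in> reg_roots G n D' then ?e1 \<alpha> * ?R \<alpha> else 0)"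
      unfolding elem_char_value[OF \<alpha> D'] prod_local_result[OF \<alpha>(1) sub(2)] by simp
  qed
  also have "\<dots> = (if D \<subseteq> reg_roots G n D' then \<Prod>\<alpha>\<in>D. ?e1 \<alpha> * ?R \<alpha> else 0)"
    unfolding prod_if_all[OF fin(1)] subset_eq ..
  also have "(\<Prod>\<alpha>\<in>D. ?e1 \<alpha> * ?R \<alpha>) = of_nat CARD('a) powi (- int (t_num n D D')) * superchar \<theta> G n D \<phi> (1\<^sub>m (msize G n)) *
       c_factor \<theta> n D \<phi> D' \<phi>' * (\<Prod>\<alpha>\<in>D \<inter> D'. \<theta> (\<phi> \<alpha> * \<phi>' \<alpha>))"
  proof -
    have 1: "(\<Prod>\<alpha>\<in>D. (1 / q) ^ card (inner n D' \<alpha>)) = of_nat CARD('a) powi (- int (t_num n D D'))"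
      unfolding power_sum[symmetric] t_num_def[symmetric] q
      by (simp add: power_int_minus inverse_eq_divide power_one_over)
    have 2: "(\<Prod>\<alpha>\<in>D. if \<alpha> \<in> D' then \<theta> (\<phi> \<alpha> * \<phi>' \<alpha>) else 1) = (\<Prod>\<alpha>\<in>D \<inter> D'. \<theta> (\<phi> \<alpha> * \<phi>' \<alpha>))"
      by (rule prod.inter_restrict[OF fin(1), symmetric])
    have tw: "twices n D = {\<alpha> \<in> D. \<exists>i. \<alpha> = Twice i}"
    proof -
      have "1 \<le> i \<and> i \<le> int n" if "Twice i \<in> D" for i
        using that sub(1) by (auto simp: Roots_def split: family.splits)
      then show ?thesis by (auto simp: twices_def)
    qed
    have fin_tw: "finite (twices n D)" using fin by (simp add: tw)
    \<comment> \<open>All correction factors are 1 unless \<alpha> has the form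
      2\<epsilon>_i.\<close>
    have "(\<Prod>\<alpha>\<in>D. ?tw \<alpha>) = (\<Prod>\<alpha>\<in>twices n D. ?tw \<alpha>)"
    proof (rule prod.mono_neutral_right[OF fin(1)])
      show "\<forall>\<alpha>\<in>D - twices n D. ?tw \<alpha> = 1"
      proof
        fix \<alpha> assume "\<alpha> \<in> D - twices n D"
        then show "?tw \<alpha> = 1" by (cases \<alpha>) (auto simp: tw twice_factor_def)
      qed
    qed (auto simp: tw)
    also have "\<dots> = (\<Prod>\<alpha>\<in>twices n D. of_nat CARD('a) ^ half_inner D' \<alpha> * gauss_sum \<theta> ^ card (inner_twices n D' \<alpha>) *
        (\<Prod>\<beta>\<in>inner_twices n D' \<alpha>. quad_char (inverse (\<phi> \<alpha>) * \<phi>' \<beta>)))"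
    proof (rule prod.cong[OF refl])
      fix \<alpha> assume "\<alpha> \<in> twices n D"
      then obtain i where i: "\<alpha> = Twice i" "\<alpha> \<in> D" by (auto simp: tw)
      then have "Twice i \<in> Roots G n" "\<phi> \<alpha> \<noteq> 0" using sub nz by auto
      from prod_twice_factor[OF this(1) sub(2) this(2), of \<theta> \<phi>']
      show "?tw \<alpha> = of_nat CARD('a) ^ half_inner D' \<alpha> * gauss_sum \<theta> ^ card (inner_twices n D' \<alpha>) *
        (\<Prod>\<beta>\<in>inner_twices n D' \<alpha>. quad_char (inverse (\<phi> \<alpha>) * \<phi>' \<beta>))"
        unfolding i(1) .
    qed
    also have "\<dots> = of_nat CARD('a) ^ (\<Sum>\<alpha>\<in>twices n D. half_inner D' \<alpha>) * gauss_sum \<theta> ^ t0_num n D D' *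
        (\<Prod>\<alpha>\<in>twices n D. \<Prod>\<beta>\<in>inner_twices n D' \<alpha>. quad_char (inverse (\<phi> \<alpha>) * \<phi>' \<beta>))"
      by (simp add: prod.distrib power_sum t0_num_def)
    also have "of_nat CARD('a) ^ (\<Sum>\<alpha>\<in>twices n D. half_inner D' \<alpha>) =
        complex_of_real (real CARD('a) powr (1 / 2 * (real (t_num n (twices n D) D') - real (t0_num n D D'))))"
    proof -
      have "t_num n (twices n D) D' = (\<Sum>\<alpha>\<in>twices n D. 2 * half_inner D' \<alpha> + card (inner_twices n D' \<alpha>))"
        unfolding t_num_def
      proof (rule sum.cong[OF refl])
        fix \<alpha> assume "\<alpha> \<in> twices n D"
        then obtain i where i: "\<alpha> = Twice i" "Twice i \<in> Roots G n" using sub by (auto simp: tw)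
        show "card (inner n D' \<alpha>) = 2 * half_inner D' \<alpha> + card (inner_twices n D' \<alpha>)"
          unfolding i(1) by (rule card_inner_Twice[OF i(2) sub(2)])
      qed
      then have "t_num n (twices n D) D' = 2 * (\<Sum>\<alpha>\<in>twices n D. half_inner D' \<alpha>) + t0_num n D D'"
        by (simp add: t0_num_def sum.distrib sum_distrib_left)
      \<comment> \<open>The real exponent is a natural number, so \<open>powr\<close> reduces to an
        ordinary power.\<close>
      then have "1 / 2 * (real (t_num n (twices n D) D') - real (t0_num n D D')) =
          real (\<Sum>\<alpha>\<in>twices n D. half_inner D' \<alpha>)" by simp
      then show ?thesis by (simp only: powr_realpow of_nat_0_less_iff zero_less_card_finite of_real_power of_real_of_nat_eq)
    qed
    finally have 3: "(\<Prod>\<alpha>\<in>D. ?tw \<alpha>) = c_factor \<theta> n D \<phi> D' \<phi>'"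
      by (simp only: c_factor_def)
    show ?thesis
      unfolding prod.distrib 1 2 3 superchar_def by (simp only: mult_ac)
  qed
  finally show ?thesis .
qed

theorem theorem5p3:
  fixes G :: family
    and n p e q :: nat
    and \<theta> :: "'a::{field, finite} \<Rightarrow> complex"
    and D D' :: "root set"
    and \<phi> \<phi>' :: "root \<Rightarrow> 'a"
  assumes "prime p" "odd p" "1 \<le> e" "q = p ^ e" "CARD('a) = q"
    and "1 \<le> n"
    and "nontrivial_linear_char \<theta>"
    and "basic_pair G n D \<phi>"
    and "basic_pair G n D' \<phi>'"
  shows "superchar \<theta> G n D \<phi> (z_rep G n D' \<phi>') =
    (if D \<subseteq> reg_roots G n D'
     then of_nat q powi (- int (t_num n D D')) *
          superchar \<theta> G n D \<phi> (1\<^sub>m (msize G n)) *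
          c_factor \<theta> n D \<phi> D' \<phi>' *
          (\<Prod>\<alpha>\<in>D \<inter> D'. \<theta> (\<phi> \<alpha> * \<phi>' \<alpha>))
     else 0)"
proof -
  have "odd CARD('a)" using assms(2,4,5) by simp
  then interpret averaging G n \<theta> "of_nat CARD('a)"
    using assms(7) two_neq_zero_if_odd_card by unfold_locales auto
  show ?thesis
    using superchar_value[OF assms(8,9)] by (simp only: assms(5))
qed

end
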